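(* Let $X\subset\{0,1\}^{\mathbb{Z}}$ be a subshift and let $\widetilde{X}$ be the smallest hereditary subshift containing $X$. Suppose that there exists an ergodic measure $\nu\in\mathcal{P}^e(S,X)$ such that $$\mathcal{P}^e(S,\widetilde{X})=\{M_*(\rho) : \rho\in\mathcal{P}^e(S\times S,X\times\{0,1\}^{\mathbb{Z}}),\ \rho|_X=\nu\}.$$ If $h_{top}(S,\widetilde{X})>0$, then the simplex $\mathcal{P}(S,\widetilde{X})$ is Poulsen.
   Context: $S$ denotes the left translation (shift) on $\{0,1\}^{\mathbb{Z}}$, and its restrictions to subshifts. A subshift $X\subset\{0,1\}^{\mathbb{Z}}$ is a (nonempty) closed set invariant under $S$. A subshift $X$ is hereditary if $x\in X$, $y\in\{0,1\}^{\mathbb{Z}}$ and $y\le x$ coordinatewise imply $y\in X$. For a subshift $X$, $\widetilde{X}=\{y\in\{0,1\}^{\mathbb{Z}} : y\le x \text{ coordinatewise for some } x\in X\}$ is the smallest hereditary subshift containing $X$. The map $M\colon X\times\{0,1\}^{\mathbb{Z}}\to\{0,1\}^{\mathbb{Z}}$ is $M(x,y)(n)=x(n)\cdot y(n)$ for $n\in\mathbb{Z}$; its image is $\widetilde{X}$, and $M_*(\rho)$ is the push-forward of $\rho$. For a homeomorphism $T$ of a compact metric space $Y$, $\mathcal{P}(T,Y)$ is the set of $T$-invariant Borel probability measures on $Y$ with the weak topology (a Choquet simplex), and $\mathcal{P}^e(T,Y)$ is the subset of ergodic measures (its extreme points). For a measure $\rho$ on $X\times\{0,1\}^{\mathbb{Z}}$,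 $\rho|_X$ is its marginal (projection) on $X$. $h_{top}$ is topological entropy. A simplex is called Poulsen if it is non-trivial (has more than one point) and its set of extreme points is dense. *)

theory Defs
  imports "HOL-Probability.Probability"
begin

section \<open>Invariant measures and topological entropy\<close>

text \<open>
  A system is a self-map \<open>T\<close> of a subset \<open>Y\<close> of a topological type, \<open>Y\<close> carrying the subspace
  topology. In the notions below \<open>T\<close> is meant to restrict to a homeomorphism of the compact
  metrizable space \<open>Y\<close>. Measures on \<open>Y\<close> have \<open>Y\<close>, not the whole type, as their space.
\<close>

definition invariant_measures :: "('a::topological_space \<Rightarrow> 'a) \<Rightarrow> 'a set \<Rightarrow> 'a measure set" where
  "invariant_measures T Y =
    {\<mu>. prob_space \<mu> \<and> sets \<mu> = sets (restrict_space borel Y) \<and> distr \<mu> \<mu> T = \<mu>}"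

definition ergodic_measures :: "('a::topological_space \<Rightarrow> 'a) \<Rightarrow> 'a set \<Rightarrow> 'a measure set" where
  "ergodic_measures T Y =
    {\<mu> \<in> invariant_measures T Y.
      \<forall>A\<in>sets \<mu>. T -` A \<inter> Y = A \<longrightarrow> measure \<mu> A = 0 \<or> measure \<mu> A = 1}"

text \<open>
  The weak topology on a set \<open>K\<close> of Borel probability measures on \<open>Y\<close>: the coarsest topology for
  which \<open>\<mu> \<mapsto> \<integral>f d\<mu>\<close> is continuous for every continuous \<open>f :: Y \<Rightarrow> real\<close>.
\<close>

definition weak_topology :: "'a::topological_space set \<Rightarrow> 'a measure set \<Rightarrow> 'a measure topology" where
  "weak_topology Y K =
    pullback_topology K
      (\<lambda>\<mu>. \<lambda>f\<in>{f. continuous_on Y f}. integral\<^sup>L \<mu> f)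
      (product_topology (\<lambda>_. euclideanreal) {f. continuous_on Y f})"

text \<open>
  The type of measures is not a vector space, so \<open>\<mu> = t \<mu>1 + (1 - t) \<mu>2\<close> is expressed setwise.
\<close>

definition extreme_measures :: "'a measure set \<Rightarrow> 'a measure set" where
  "extreme_measures K =
    {\<mu> \<in> K. \<forall>\<mu>1\<in>K. \<forall>\<mu>2\<in>K. \<forall>t::real. 0 < t \<and> t < 1 \<and>
      (\<forall>A\<in>sets \<mu>. measure \<mu> A = t * measure \<mu>1 A + (1 - t) * measure \<mu>2 A) \<longrightarrow> \<mu>1 = \<mu>2}"

text \<open>
  A simplex \<open>K\<close> of Borel probability measures on \<open>Y\<close>, with the weak topology, is Poulsen if it has
  more than one point and its extreme points are dense.
\<close>

definition Poulsen :: "'a::topological_space set \<Rightarrow> 'a measure set \<Rightarrow> bool" where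
  "Poulsen Y K \<longleftrightarrow>
    (\<exists>\<mu>1\<in>K. \<exists>\<mu>2\<in>K. \<mu>1 \<noteq> \<mu>2) \<and>
    weak_topology Y K closure_of extreme_measures K = K"

text \<open>Topological entropy in the sense of Adler, Konheim and McAndrew.\<close>

definition open_covers :: "'a::topological_space set \<Rightarrow> 'a set set set" where
  "open_covers Y = {\<U>. (\<forall>U\<in>\<U>. openin (top_of_set Y) U) \<and> \<Union>\<U> = Y}"

definition min_subcover :: "'a set \<Rightarrow> 'a set set \<Rightarrow> nat" where
  "min_subcover Y \<U> = (LEAST k. \<exists>\<V>\<subseteq>\<U>. finite \<V> \<and> card \<V> = k \<and> \<Union>\<V> = Y)"

text \<open>\<open>iterated_join T Y \<U> n\<close> is the join of the covers \<open>T\<^sup>-\<^sup>i \<U>\<close> of \<open>Y\<close> for \<open>i < n\<close>.\<close>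

definition iterated_join :: "('a \<Rightarrow> 'a) \<Rightarrow> 'a set \<Rightarrow> 'a set set \<Rightarrow> nat \<Rightarrow> 'a set set" where
  "iterated_join T Y \<U> n = {Y \<inter> (\<Inter>i<n. (T ^^ i) -` U i) | U. \<forall>i<n. U i \<in> \<U>}"

text \<open>
  The limit over \<open>n\<close> in the definition of entropy exists by subadditivity; it is written here
  as a limsup.
\<close>

definition top_entropy :: "('a::topological_space \<Rightarrow> 'a) \<Rightarrow> 'a set \<Rightarrow> ereal" where
  "top_entropy T Y =
    (SUP \<U>\<in>open_covers Y.
      limsup (\<lambda>n. ereal (ln (real (min_subcover Y (iterated_join T Y \<U> n))) / real n)))"

section \<open>Subshifts\<close>

text \<open>
  The alphabet \<open>{0,1}\<close> is represented by \<^typ>\<open>bool\<close>, with its discrete topology; bi-infinite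
  sequences carry the product topology, the coordinatewise order is the order \<open>\<le>\<close> on functions,
  and multiplication in \<open>{0,1}\<close> is conjunction.
\<close>

type_synonym binseq = "int \<Rightarrow> bool"

definition left_shift :: "binseq \<Rightarrow> binseq" where
  "left_shift x = (\<lambda>n. x (n + 1))"

definition subshift :: "binseq set \<Rightarrow> bool" where
  "subshift X \<longleftrightarrow> X \<noteq> {} \<and> closed X \<and> left_shift ` X = X"

definition hereditary :: "binseq set \<Rightarrow> bool" where
  "hereditary X \<longleftrightarrow> (\<forall>x\<in>X. \<forall>y\<le>x. y \<in> X)"

definition hereditary_hull :: "binseq set \<Rightarrow> binseq set" where
  "hereditary_hull X = {y. \<exists>x\<in>X. y \<le> x}"

definition coord_mult :: "binseq \<times> binseq \<Rightarrow> binseq" where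
  "coord_mult = (\<lambda>(x, y) n. x n \<and> y n)"

lemma hereditary_hull_eq_image: "hereditary_hull X = coord_mult ` (X \<times> UNIV)"
proof (intro equalityI subsetI)
  fix y assume "y \<in> hereditary_hull X"
  then obtain x where "x \<in> X" "y \<le> x" by (auto simp: hereditary_hull_def)
  then have "y = coord_mult (x, y)" by (auto simp: coord_mult_def le_fun_def fun_eq_iff)
  with \<open>x \<in> X\<close> show "y \<in> coord_mult ` (X \<times> UNIV)" by blast
qed (auto simp: hereditary_hull_def coord_mult_def le_fun_def)

lemma compact_UNIV_binseq: "compact (UNIV :: binseq set)"
proof -
  have "compact_space (euclidean :: bool topology)"
    unfolding compact_space_def topspace_euclidean compactin_euclidean_iff
    by (rule finite_imp_compact) simp
  then have "compact_space (product_topology (\<lambda>i::int. euclidean :: bool topology) UNIV)"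
    by (simp add: compact_space_product_topology)
  then show ?thesis
    unfolding euclidean_product_topology compact_space_def by simp
qed

lemma closed_if_compact_binseq:
  fixes A :: "binseq set"
  assumes "compact A"
  shows "closed A"
proof -
  have "Hausdorff_space (euclidean :: bool topology)"
    unfolding Hausdorff_space_def
  proof (intro allI impI)
    fix x y :: bool
    assume "x \<in> topspace euclidean \<and> y \<in> topspace euclidean \<and> x \<noteq> y"
    then show "\<exists>U V. openin euclidean U \<and> openin euclidean V \<and> x \<in> U \<and> y \<in> V \<and> disjnt U V"
      using Topological_Spaces.open_discrete[of "{x}"] Topological_Spaces.open_discrete[of "{y}"]
      by (metis disjnt_insert1 disjnt_empty1 insertI1 open_openin singletonD)
  qed
  then have "Hausdorff_space (product_topology (\<lambda>i::int. euclidean :: bool topology) UNIV)"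
    by (intro iffD2[OF Hausdorff_space_product_topology] disjI2 ballI)
  then have "Hausdorff_space (euclidean :: binseq topology)"
    by (simp only: euclidean_product_topology)
  from compactin_imp_closedin[OF this, of A] assms show ?thesis by simp
qed

lemma continuous_on_conj:
  fixes f g :: "'a::topological_space \<Rightarrow> bool"
  assumes "continuous_on A f" "continuous_on A g"
  shows "continuous_on A (\<lambda>x. f x \<and> g x)"
proof -
  have "continuous_on A (\<lambda>x. min (f x) (g x))"
    using assms by (rule continuous_on_min)
  moreover have "(\<lambda>x. min (f x) (g x)) = (\<lambda>x. f x \<and> g x)"
    by (auto simp: min_def fun_eq_iff)
  ultimately show ?thesis by (simp only:)
qed

lemma continuous_on_coord_mult: "continuous_on A coord_mult"
  unfolding coord_mult_def case_prod_beta
  by (intro continuous_on_coordinatewise_then_product continuous_on_conj)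
     (auto intro!: continuous_on_product_then_coordinatewise continuous_on_fst continuous_on_snd
       continuous_on_id)

lemma
  assumes X: "subshift X"
  shows subshift_hereditary_hull: "subshift (hereditary_hull X)"
    and hereditary_hereditary_hull: "hereditary (hereditary_hull X)"
    and subset_hereditary_hull: "X \<subseteq> hereditary_hull X"
proof -
  have "compact (X \<times> (UNIV :: binseq set))"
    using X compact_UNIV_binseq closed_Int_compact[of X UNIV]
    by (simp add: subshift_def compact_Times)
  then have cl: "closed (hereditary_hull X)"
    unfolding hereditary_hull_eq_image
    by (intro closed_if_compact_binseq compact_continuous_image continuous_on_coord_mult)
  have "left_shift ` hereditary_hull X = hereditary_hull X"
  proof (intro equalityI subsetI)
    fix y assume "y \<in> left_shift ` hereditary_hull X"
    then obtain z x where "x \<in> X" "z \<le> x" "y = left_shift z" by (auto simp: hereditary_hull_def)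
    moreover have "left_shift z \<le> left_shift x"
      using \<open>z \<le> x\<close> by (simp add: left_shift_def le_fun_def)
    ultimately show "y \<in> hereditary_hull X"
      using X by (auto simp: subshift_def hereditary_hull_def)
  next
    fix y assume "y \<in> hereditary_hull X"
    then obtain x' where "x' \<in> X" "y \<le> x'" by (auto simp: hereditary_hull_def)
    moreover have "x' \<in> left_shift ` X" using X \<open>x' \<in> X\<close> by (simp add: subshift_def)
    ultimately obtain x where "x \<in> X" "y \<le> left_shift x" by blast
    have "y (n - 1) \<le> x n" for n
      using \<open>y \<le> left_shift x\<close> le_funD[of y "left_shift x" "n - 1"] by (simp add: left_shift_def)
    then have "(\<lambda>n. y (n - 1)) \<le> x"
      by (rule le_funI)
    then have "(\<lambda>n. y (n - 1)) \<in> hereditary_hull X"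
      using \<open>x \<in> X\<close> by (auto simp: hereditary_hull_def)
    moreover have "left_shift (\<lambda>n. y (n - 1)) = y" by (simp add: left_shift_def)
    ultimately show "y \<in> left_shift ` hereditary_hull X" by (metis imageI)
  qed
  moreover show sub: "X \<subseteq> hereditary_hull X" by (auto simp: hereditary_hull_def)
  ultimately show "subshift (hereditary_hull X)"
    using X cl by (auto simp: subshift_def)
  show "hereditary (hereditary_hull X)"
    unfolding hereditary_def
  proof (intro ballI allI impI)
    fix y z assume "y \<in> hereditary_hull X" "z \<le> y"
    then obtain x where "x \<in> X" "y \<le> x" by (auto simp: hereditary_hull_def)
    moreover have "z \<le> x" using \<open>z \<le> y\<close> \<open>y \<le> x\<close> by (rule order_trans)
    ultimately show "z \<in> hereditary_hull X" by (auto simp only: hereditary_hull_def)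
  qed
qed

lemma hereditary_hull_least:
  "X \<subseteq> Y \<Longrightarrow> hereditary Y \<Longrightarrow> hereditary_hull X \<subseteq> Y"
  by (auto simp: hereditary_def hereditary_hull_def)

end

theory Submission
  imports Defs
begin

text \<open>
  Write \<open>Y\<close> for the hereditary hull of \<open>X\<close>. By hypothesis the ergodic measures on \<open>Y\<close> are exactly the
  images \<open>M\<^sub>*\<rho>\<close> of the ergodic joinings \<open>\<rho>\<close> of one fixed ergodic measure \<open>\<nu>\<close> with a measure on the full
  shift. Everything rests on one observation: a convex combination of two such joinings is again an
  invariant measure with first marginal \<open>\<nu>\<close>, and every invariant measure \<open>\<rho>\<close> with first marginal \<open>\<nu>\<close> is a
  weak limit of \<^emph>\<open>ergodic\<close> ones (\<open>ergodic_joining_approximation\<close>). Hence a convex combination of two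
  ergodic measures on \<open>Y\<close> is a weak limit of ergodic measures on \<open>Y\<close> (\<open>ergodic_almost_convex\<close>), that is,
  the weak closure of the ergodic measures is convex. As the ergodic measures are extreme points
  (\<open>ergodic_measures_subset_extreme\<close>), a Krein--Milman argument gives the density of extreme points.

  The approximation of \<open>\<rho>\<close> by ergodic joinings is by random block coding. Given \<open>x\<close> distributed by \<open>\<nu>\<close>,
  put down rare random markers, independently of \<open>x\<close>. At each marker sample a long word from the
  conditional law, given \<open>x\<close>, that \<open>\<rho>\<close> prescribes for the second coordinate, independently for different
  markers, and let \<open>y\<close> spell out these words one after the other. The pair \<open>(x, y)\<close> is a factor of the
  product of \<open>\<nu>\<close> with an i.i.d. process; this product is ergodic (\<open>skew_ergodic\<close>) since \<open>\<nu>\<close> is ergodic and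
  an i.i.d. process is mixing. With high probability a fixed window lies inside a single word, and given
  this event the pair seen in the window has law \<open>\<rho>\<close> (\<open>joining_lower_bound\<close>).

  The Krein--Milman step does not go through the ergodic decomposition. By compactness of the Cantor
  space, invariant measures are the same as finitely additive invariant functions on the clopen subsets
  of \<open>Y\<close> (\<open>measure_of_charge\<close>), and these form a compact convex set by Tychonoff's theorem. A continuous
  convex function on this set, perturbed by a small multiple of a strictly convex one, attains its
  maximum, and only at ergodic measures, because a measure that is not ergodic is a proper convex
  combination of its two conditional measures (\<open>ergodic_almost_maximiser\<close>). The distance to the set of
  ergodic measures is convex by the first paragraph and vanishes at ergodic measures; so it vanishes
  identically (\<open>ergodic_dense_if_almost_convex\<close>).

  Positive entropy makes the simplex non-trivial. If \<open>Y\<close> carries a single invariant measure, it is the point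
  mass at the zero sequence, which lies in \<open>Y\<close> by heredity. Then by a Krylov--Bogoliubov argument the
  symbol 1 occurs with uniformly small frequency, so there are only subexponentially many words and
  the entropy is zero (\<open>entropy_zero_if_rare_ones\<close>).
\<close>

section \<open>Cylinders and clopen sets\<close>

text \<open>
  This makes the Borel sets of \<^typ>\<open>binseq\<close> and of \<^typ>\<open>binseq \<times> binseq\<close> the respective product
  sigma-algebras.
\<close>

instance bool :: second_countable_topology
proof
  have "generate_topology (UNIV :: bool set set) S" for S
    by (rule generate_topology.Basis) simp
  moreover have "open S" for S :: "bool set"
    by (rule Topological_Spaces.open_discrete)
  ultimately have "open = generate_topology (UNIV :: bool set set)"
    by (intro ext) blast
  then show "\<exists>B :: bool set set. countable B \<and> open = generate_topology B"
    by (intro exI[of _ UNIV] conjI countable_finite) simp_all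
qed

text \<open>
  A word on a set \<open>W\<close> of positions is encoded by the set of positions that carry a 1, so that the words
  on \<open>W\<close> are the subsets of \<open>W\<close>. Any \<open>A\<close> stands for \<open>A \<inter> W\<close>; this allows \<open>A = Collect x\<close> for the word of \<open>x\<close>.
\<close>

definition cylinder :: "int set \<Rightarrow> int set \<Rightarrow> binseq set" where
  "cylinder W A = {x. \<forall>i\<in>W. x i \<longleftrightarrow> i \<in> A}"

abbreviation window :: "nat \<Rightarrow> int set" where
  "window L \<equiv> {- int L..int L}"

lemma continuous_on_coordinate: "continuous_on A (\<lambda>x::binseq. x i)"
  by (rule continuous_on_subset[OF continuous_on_product_coordinates]) simp

lemma clopen_coordinate: "open {x::binseq. x i = b}" "closed {x::binseq. x i = b}"
proof -
  have *: "open {x::binseq. x i = c}" for c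
  proof -
    have "open ((\<lambda>x::binseq. x i) -` {c})"
      by (rule open_vimage[OF _ continuous_on_coordinate]) (rule Topological_Spaces.open_discrete)
    then show ?thesis by (simp add: vimage_def)
  qed
  show "open {x::binseq. x i = b}" by (rule *)
  have "- {x::binseq. x i = b} = {x. x i = (\<not> b)}" by auto
  with *[of "\<not> b"] show "closed {x::binseq. x i = b}" by (simp add: closed_def)
qed

lemma clopen_cylinder:
  assumes "finite W"
  shows "open (cylinder W A)" "closed (cylinder W A)"
proof -
  have "cylinder W A = (\<Inter>i\<in>W. {x. x i = (i \<in> A)})"
    by (auto simp: cylinder_def)
  then show "open (cylinder W A)" "closed (cylinder W A)"
    using assms by (auto intro!: open_INT closed_INT clopen_coordinate)
qed

lemma mem_cylinder_self: "x \<in> cylinder W (Collect x)"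
  by (simp add: cylinder_def)

lemma mem_cylinder_iff: "A \<subseteq> W \<Longrightarrow> x \<in> cylinder W A \<longleftrightarrow> A = Collect x \<inter> W"
  by (auto simp: cylinder_def)

lemma cylinder_Int: "cylinder W A = cylinder W (A \<inter> W)"
  by (auto simp: cylinder_def)

lemma cylinder_antimono: "W \<subseteq> W' \<Longrightarrow> cylinder W' A \<subseteq> cylinder W A"
  by (auto simp: cylinder_def)

lemma window_mono: "L \<le> L' \<Longrightarrow> window L \<subseteq> window L'"
  by auto

lemma open_contains_cylinder:
  assumes "open U" "x \<in> U"
  shows "\<exists>L. cylinder (window L) (Collect x) \<subseteq> U"
proof -
  have "openin (product_topology (\<lambda>i::int. euclidean :: bool topology) UNIV) U"
    using assms unfolding euclidean_product_topology by simp
  from product_topology_open_contains_basis[OF this assms(2)]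
  obtain V where V: "x \<in> Pi\<^sub>E UNIV V" "finite {i. V i \<noteq> (UNIV::bool set)}" "Pi\<^sub>E UNIV V \<subseteq> U"
    by (auto simp: topspace_euclidean)
  obtain k where k: "\<forall>i\<in>{i. V i \<noteq> (UNIV::bool set)}. nat \<bar>i\<bar> \<le> k"
    using V(2) finite_nat_set_iff_bounded_le[of "(\<lambda>i. nat \<bar>i\<bar>) ` {i. V i \<noteq> (UNIV::bool set)}"] by auto
  have "y i \<in> V i" if y: "y \<in> cylinder (window k) (Collect x)" for y i
  proof (cases "V i = UNIV")
    case False
    then have "nat \<bar>i\<bar> \<le> k" using k by auto
    then have "i \<in> window k" by auto
    then have "y i = x i" using y by (auto simp: cylinder_def)
    then show ?thesis using V(1) by auto
  qed simp
  then show ?thesis using V(3) by (intro exI[of _ k]) (auto simp: PiE_def extensional_def)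
qed

text \<open>
  The Lebesgue number lemma, with windows in place of distances. It is the form in which compactness
  enters both the estimate of entropy and the uniform approximation of continuous functions.
\<close>

lemma cylinder_Lebesgue_number:
  assumes Y: "closed Y"
    and op: "\<And>U. U \<in> \<U> \<Longrightarrow> openin (top_of_set Y) U" and cov: "Y \<subseteq> \<Union>\<U>"
  shows "\<exists>L. \<forall>x\<in>Y. \<exists>U\<in>\<U>. cylinder (window L) (Collect x) \<inter> Y \<subseteq> U"
proof -
  have cY: "compact Y"
    using compact_Int_closed[OF compact_UNIV_binseq Y] by simp
  have "\<exists>L U. U \<in> \<U> \<and> cylinder (window L) (Collect x) \<inter> Y \<subseteq> U" if "x \<in> Y" for x
  proof -
    obtain U where U: "U \<in> \<U>" "x \<in> U" using cov \<open>x \<in> Y\<close> by auto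
    obtain V where V: "open V" "U = Y \<inter> V" using op[OF U(1)] by (auto simp: openin_open)
    obtain L where "cylinder (window L) (Collect x) \<subseteq> V"
      using open_contains_cylinder[of V x] V U by auto
    then show ?thesis using U V by blast
  qed
  then obtain l u where lu: "\<And>x. x \<in> Y \<Longrightarrow> u x \<in> \<U>"
    "\<And>x. x \<in> Y \<Longrightarrow> cylinder (window (l x)) (Collect x) \<inter> Y \<subseteq> u x" by metis
  obtain D where D: "D \<subseteq> Y" "finite D" "Y \<subseteq> (\<Union>x\<in>D. cylinder (window (l x)) (Collect x))"
  proof (rule compactE_image[OF cY, of Y "\<lambda>x. cylinder (window (l x)) (Collect x)"])
    show "open (cylinder (window (l x)) (Collect x))" for x
      by (rule clopen_cylinder) simp
    show "Y \<subseteq> (\<Union>c\<in>Y. cylinder (window (l c)) (Collect c))"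
      using mem_cylinder_self by blast
  qed blast
  define L where "L = Max (insert 0 (l ` D))"
  have lL: "l d \<le> L" if "d \<in> D" for d
    using that D(2) by (auto simp: L_def intro: Max_ge)
  show ?thesis
  proof (intro exI[of _ L] ballI)
    fix x assume "x \<in> Y"
    then obtain d where d: "d \<in> D" "x \<in> cylinder (window (l d)) (Collect d)" using D by auto
    have "cylinder (window L) (Collect x) \<subseteq> cylinder (window (l d)) (Collect d)"
    proof
      fix y assume y: "y \<in> cylinder (window L) (Collect x)"
      show "y \<in> cylinder (window (l d)) (Collect d)"
        using y d(2) window_mono[OF lL[OF d(1)]] by (simp add: cylinder_def)
    qed
    then show "\<exists>U\<in>\<U>. cylinder (window L) (Collect x) \<inter> Y \<subseteq> U"
      using lu d D(1) by blast
  qed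
qed

lemma shift_continuous: "continuous_on A left_shift"
  unfolding left_shift_def
  by (intro continuous_on_coordinatewise_then_product continuous_on_coordinate)

text \<open>
  The domain of the finitely additive measures below.
\<close>

definition clopens :: "binseq set \<Rightarrow> binseq set set" where
  "clopens Y = {A \<inter> Y | A. open A \<and> closed A}"

lemma clopensI: "open A \<Longrightarrow> closed A \<Longrightarrow> A \<inter> Y \<in> clopens Y"
  by (auto simp: clopens_def)

lemma clopens_cylinder: "finite W \<Longrightarrow> cylinder W A \<inter> Y \<in> clopens Y"
  by (intro clopensI clopen_cylinder)

lemma clopens_algebra: "algebra Y (clopens Y)"
  unfolding algebra_iff_Int
proof (intro conjI ballI)
  show "clopens Y \<subseteq> Pow Y" by (auto simp: clopens_def)
  show "{} \<in> clopens Y" using clopensI[of "{}" Y] by simp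
  fix a assume "a \<in> clopens Y"
  then obtain A where A: "open A" "closed A" "a = A \<inter> Y" by (auto simp: clopens_def)
  have "Y - a = (- A) \<inter> Y" using A by auto
  then show "Y - a \<in> clopens Y" using A by (auto intro!: clopensI)
  fix b assume "b \<in> clopens Y"
  then obtain B where B: "open B" "closed B" "b = B \<inter> Y" by (auto simp: clopens_def)
  have "a \<inter> b = (A \<inter> B) \<inter> Y" using A B by auto
  then show "a \<inter> b \<in> clopens Y" using A B by (auto intro!: clopensI)
qed

lemma clopens_shift:
  assumes "left_shift ` Y \<subseteq> Y" "A \<in> clopens Y"
  shows "left_shift -` A \<inter> Y \<in> clopens Y"
proof -
  obtain B where B: "open B" "closed B" "A = B \<inter> Y" using assms by (auto simp: clopens_def)
  have "left_shift -` A \<inter> Y = left_shift -` B \<inter> Y" using B assms by auto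
  then show ?thesis using B
    by (auto intro!: clopensI open_vimage closed_vimage shift_continuous)
qed

text \<open>
  Every open set is the union of the cylinders that it contains, and there are only countably many
  cylinders over windows.
\<close>

lemma borel_eq_sigma_clopen: "sets (borel :: binseq measure) = sigma_sets UNIV {A. open A \<and> closed A}"
proof -
  have "U \<in> sigma_sets UNIV {A :: binseq set. open A \<and> closed A}" if "open U" for U :: "binseq set"
  proof -
    let ?C = "{cylinder (window L) A | L A. A \<subseteq> window L \<and> cylinder (window L) A \<subseteq> U}"
    have "?C \<subseteq> (\<Union>L. cylinder (window L) ` Pow (window L))" by blast
    then have cnt: "countable ?C"
      by (rule countable_subset) (intro countable_UN countable_image, auto intro: countable_finite)
    have eq: "U = \<Union>?C"
    proof (intro equalityI subsetI)
      fix x assume "x \<in> U"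
      then obtain L where "cylinder (window L) (Collect x) \<subseteq> U"
        using open_contains_cylinder[OF \<open>open U\<close>] by blast
      then have "cylinder (window L) (Collect x \<inter> window L) \<in> ?C"
        unfolding cylinder_Int[of "window L" "Collect x"] by blast
      then show "x \<in> \<Union>?C"
        using mem_cylinder_self[of x "window L"] unfolding cylinder_Int[of "window L" "Collect x"]
        by blast
    qed blast
    have "?C \<subseteq> sigma_sets UNIV {A :: binseq set. open A \<and> closed A}"
      by (auto intro!: sigma_sets.Basic clopen_cylinder)
    then have "\<Union>?C \<in> sigma_sets UNIV {A :: binseq set. open A \<and> closed A}"
      by (intro sigma_sets_UNION[OF cnt]) blast
    then show ?thesis by (simp only: eq[symmetric])
  qed
  then show ?thesis
    unfolding borel_def
    by (simp only: sets_measure_of[of _ UNIV] Pow_UNIV subset_UNIV)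
       (rule sigma_sets_eqI, auto intro: sigma_sets.Basic)
qed

lemma sets_restrict_borel_clopens:
  assumes "closed Y"
  shows "sets (restrict_space borel Y) = sigma_sets Y (clopens Y)"
proof -
  have "Y \<in> sets borel" using assms by simp
  then have "Y \<in> sigma_sets UNIV {A :: binseq set. open A \<and> closed A}"
    using borel_eq_sigma_clopen by simp
  from sigma_sets_Int[OF this]
  have "(\<inter>) Y ` sigma_sets UNIV {A. open A \<and> closed A} = sigma_sets Y ((\<inter>) Y ` {A. open A \<and> closed A})"
    by auto
  moreover have "(\<inter>) Y ` {A. open A \<and> closed A} = clopens Y" by (auto simp: clopens_def)
  ultimately show ?thesis
    unfolding sets_restrict_space borel_eq_sigma_clopen by simp
qed

lemma compact_unit_box: "compact {m :: 'a \<Rightarrow> real. \<forall>A. 0 \<le> m A \<and> m A \<le> 1}"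
proof -
  have "compactin (product_topology (\<lambda>_::'a. euclideanreal) UNIV) (PiE UNIV (\<lambda>_. {0..1}))"
    unfolding compactin_PiE by simp
  moreover have "PiE UNIV (\<lambda>_. {0..1}) = {m :: 'a \<Rightarrow> real. \<forall>A. 0 \<le> m A \<and> m A \<le> 1}"
    by auto
  ultimately show ?thesis
    unfolding euclidean_product_topology by simp
qed

lemma continuous_on_eval: "continuous_on S (\<lambda>m :: 'a \<Rightarrow> real. m A)"
  by (rule continuous_on_subset[OF continuous_on_product_coordinates]) simp

section \<open>Invariant measures as finitely additive charges\<close>

lemma invariant_measuresD:
  assumes "\<mu> \<in> invariant_measures T Y" "Y \<in> sets borel"
  shows "prob_space \<mu>" "sets \<mu> = sets (restrict_space borel Y)" "space \<mu> = Y" "distr \<mu> \<mu> T = \<mu>"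
proof -
  show *: "prob_space \<mu>" "sets \<mu> = sets (restrict_space borel Y)" "distr \<mu> \<mu> T = \<mu>"
    using assms by (auto simp: invariant_measures_def)
  show "space \<mu> = Y"
    using sets_eq_imp_space_eq[OF *(2)] assms(2) by (simp add: space_restrict_space)
qed

lemma measurable_selfmap:
  assumes "sets \<mu> = sets (restrict_space borel Y)" "T \<in> borel \<rightarrow>\<^sub>M borel" "T ` Y \<subseteq> Y"
  shows "T \<in> \<mu> \<rightarrow>\<^sub>M \<mu>"
proof -
  have "T \<in> restrict_space borel Y \<rightarrow>\<^sub>M restrict_space borel Y"
    using assms(2,3) by (intro measurable_restrict_space3) auto
  then show ?thesis using measurable_cong_sets[OF assms(1) assms(1)] by simp
qed

lemma invariant_measure_vimage:
  assumes "\<mu> \<in> invariant_measures T Y" "Y \<in> sets borel" "T \<in> borel \<rightarrow>\<^sub>M borel" "T ` Y \<subseteq> Y" "A \<in> sets \<mu>"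
  shows "measure \<mu> (T -` A \<inter> Y) = measure \<mu> A"
proof -
  note D = invariant_measuresD[OF assms(1,2)]
  have "measure \<mu> A = measure (distr \<mu> \<mu> T) A" by (simp add: D(4))
  also have "\<dots> = measure \<mu> (T -` A \<inter> Y)"
    using measurable_selfmap[OF D(2) assms(3,4)] assms(5) D(3) by (simp add: measure_distr)
  finally show ?thesis by simp
qed

lemma invariant_measuresI:
  assumes "prob_space \<mu>" "sets \<mu> = sets (restrict_space borel Y)" "Y \<in> sets borel"
    and "T \<in> borel \<rightarrow>\<^sub>M borel" "T ` Y \<subseteq> Y"
    and "\<And>A. A \<in> sets \<mu> \<Longrightarrow> measure \<mu> (T -` A \<inter> Y) = measure \<mu> A"
  shows "\<mu> \<in> invariant_measures T Y"
proof -
  interpret prob_space \<mu> by fact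
  have sp: "space \<mu> = Y"
    using sets_eq_imp_space_eq[OF assms(2)] assms(3) by (simp add: space_restrict_space)
  note T = measurable_selfmap[OF assms(2,4,5)]
  have "distr \<mu> \<mu> T = \<mu>"
    by (rule measure_eqI) (use T assms(6) in \<open>auto simp: emeasure_distr sp emeasure_eq_measure\<close>)
  then show ?thesis using assms by (simp add: invariant_measures_def)
qed

lemma left_shift_measurable: "left_shift \<in> borel \<rightarrow>\<^sub>M borel"
  by (intro borel_measurable_continuous_onI shift_continuous)

lemma clopens_sets:
  assumes "closed Y" "sets \<mu> = sets (restrict_space borel Y)" "A \<in> clopens Y"
  shows "A \<in> sets \<mu>"
  using assms by (auto simp: sets_restrict_borel_clopens intro: sigma_sets.Basic)

lemma clopens_closed: "closed Y \<Longrightarrow> A \<in> clopens Y \<Longrightarrow> closed A"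
  by (auto simp: clopens_def intro: closed_Int)

text \<open>
  The Lebesgue number of the cover by a clopen set and its complement is a window that decides
  membership in the clopen set.
\<close>

lemma clopens_eq_cylinders:
  assumes "closed Y" "A \<in> clopens Y"
  shows "\<exists>L. A = (\<Union>a\<in>{a \<in> Pow (window L). cylinder (window L) a \<inter> Y \<subseteq> A}. cylinder (window L) a \<inter> Y)"
proof -
  obtain B where B: "open B" "closed B" "A = B \<inter> Y" using assms by (auto simp: clopens_def)
  have "\<exists>L. \<forall>x\<in>Y. \<exists>U\<in>{B \<inter> Y, -B \<inter> Y}. cylinder (window L) (Collect x) \<inter> Y \<subseteq> U"
    using B by (intro cylinder_Lebesgue_number[OF assms(1)]) (auto simp: openin_open)
  then obtain L where L: "\<And>x. x \<in> Y \<Longrightarrow> cylinder (window L) (Collect x) \<inter> Y \<subseteq> B \<inter> Y \<or>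
      cylinder (window L) (Collect x) \<inter> Y \<subseteq> - B \<inter> Y" by blast
  show ?thesis
  proof (intro exI[of _ L] equalityI subsetI)
    fix x assume x: "x \<in> A"
    with L[of x] B mem_cylinder_self[of x "window L"]
    have "cylinder (window L) (Collect x) \<inter> Y \<subseteq> A" by auto
    moreover have "cylinder (window L) (Collect x \<inter> window L) = cylinder (window L) (Collect x)"
      by (rule cylinder_Int[symmetric])
    ultimately show "x \<in> (\<Union>a\<in>{a \<in> Pow (window L). cylinder (window L) a \<inter> Y \<subseteq> A}. cylinder (window L) a \<inter> Y)"
      using x B mem_cylinder_self[of x "window L"]
      by (intro UN_I[of "Collect x \<inter> window L"]) simp_all
  qed blast
qed

lemma disjoint_cylinders: "disjoint_family_on (\<lambda>a. cylinder W a \<inter> Y) (Pow W)"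
  by (auto simp: disjoint_family_on_def mem_cylinder_iff)

lemma measure_eqI_clopens:
  assumes "closed Y" and M: "prob_space M" "sets M = sets (restrict_space borel Y)"
    and N: "sets N = sets (restrict_space borel Y)"
    and eq: "\<And>A. A \<in> clopens Y \<Longrightarrow> emeasure M A = emeasure N A"
  shows "M = N"
proof (rule measure_eqI_generator_eq[where \<Omega> = Y and E = "clopens Y" and A = "\<lambda>_. Y"])
  interpret M: prob_space M by fact
  interpret algebra Y "clopens Y" by (rule clopens_algebra)
  show "Int_stable (clopens Y)" unfolding Int_stable_def by blast
  show "clopens Y \<subseteq> Pow Y" by (rule space_closed)
  show "sets M = sigma_sets Y (clopens Y)" "sets N = sigma_sets Y (clopens Y)"
    using M N sets_restrict_borel_clopens[OF assms(1)] by simp_all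
  show "range (\<lambda>_::nat. Y) \<subseteq> clopens Y" by auto
  show "emeasure M Y \<noteq> \<infinity>" by simp
qed (use eq in auto)

lemma measure_eqI_cylinders:
  assumes Y: "closed Y" and M: "prob_space M" "sets M = sets (restrict_space borel Y)"
    and N: "prob_space N" "sets N = sets (restrict_space borel Y)"
    and eq: "\<And>L a. measure M (cylinder (window L) a \<inter> Y) = measure N (cylinder (window L) a \<inter> Y)"
  shows "M = N"
proof (rule measure_eqI_clopens[OF Y M N(2)])
  interpret M: prob_space M by fact
  interpret N: prob_space N by fact
  fix A assume "A \<in> clopens Y"
  then obtain L where L: "A = (\<Union>a\<in>{a \<in> Pow (window L). cylinder (window L) a \<inter> Y \<subseteq> A}. cylinder (window L) a \<inter> Y)"
    using clopens_eq_cylinders[OF Y] by blast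
  let ?I = "{a \<in> Pow (window L). cylinder (window L) a \<inter> Y \<subseteq> A}"
  have *: "disjoint_family_on (\<lambda>a. cylinder (window L) a \<inter> Y) ?I"
    by (rule disjoint_family_on_mono[OF _ disjoint_cylinders]) auto
  have "measure M A = (\<Sum>a\<in>?I. measure M (cylinder (window L) a \<inter> Y))"
    using clopens_sets[OF Y M(2) clopens_cylinder] *
    by (subst L) (intro M.finite_measure_finite_Union, auto)
  also have "\<dots> = (\<Sum>a\<in>?I. measure N (cylinder (window L) a \<inter> Y))" by (simp add: eq)
  also have "\<dots> = measure N A"
    using clopens_sets[OF Y N(2) clopens_cylinder] *
    by (subst (2) L) (intro N.finite_measure_finite_Union[symmetric], auto)
  finally show "emeasure M A = emeasure N A" by (simp add: M.emeasure_eq_measure N.emeasure_eq_measure)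
qed

text \<open>
  Shift-invariant finitely additive probabilities on the clopen subsets of \<open>Y\<close>. The value 0 off the
  clopen sets makes a charge determined by its values on them. Each condition is closed for pointwise
  convergence, which gives compactness.
\<close>

definition charges :: "binseq set \<Rightarrow> (binseq set \<Rightarrow> real) set" where
  "charges Y = {m. (\<forall>A. 0 \<le> m A \<and> m A \<le> 1) \<and> m Y = 1 \<and>
     (\<forall>A. A \<notin> clopens Y \<longrightarrow> m A = 0) \<and>
     (\<forall>A\<in>clopens Y. \<forall>B\<in>clopens Y. A \<inter> B = {} \<longrightarrow> m (A \<union> B) = m A + m B) \<and>
     (\<forall>A\<in>clopens Y. m (left_shift -` A \<inter> Y) = m A)}"

lemma compact_charges: "compact (charges Y)"
proof -
  have "charges Y = {m. \<forall>A. 0 \<le> m A \<and> m A \<le> 1} \<inter> ({m. m Y = 1} \<inter>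
     (\<Inter>A\<in>- clopens Y. {m. m A = 0}) \<inter>
     (\<Inter>A\<in>clopens Y. \<Inter>B\<in>{B \<in> clopens Y. A \<inter> B = {}}. {m. m (A \<union> B) = m A + m B}) \<inter>
     (\<Inter>A\<in>clopens Y. {m. m (left_shift -` A \<inter> Y) = m A}))"
    by (auto simp: charges_def)
  also have "compact \<dots>"
    by (intro compact_Int_closed compact_unit_box closed_Int closed_INT ballI closed_Collect_eq
        continuous_on_eval continuous_on_const continuous_on_add)
  finally show ?thesis .
qed

definition charge_of :: "binseq set \<Rightarrow> binseq measure \<Rightarrow> binseq set \<Rightarrow> real" where
  "charge_of Y \<mu> A = (if A \<in> clopens Y then measure \<mu> A else 0)"

lemma charge_of_charges:
  assumes Y: "closed Y" "left_shift ` Y = Y" and \<mu>: "\<mu> \<in> invariant_measures left_shift Y"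
  shows "charge_of Y \<mu> \<in> charges Y"
proof -
  have "Y \<in> sets borel" using Y by simp
  note D = invariant_measuresD[OF \<mu> this]
  interpret prob_space \<mu> by (rule D)
  interpret A: algebra Y "clopens Y" by (rule clopens_algebra)
  have "measure \<mu> (left_shift -` A \<inter> Y) = measure \<mu> A" if "A \<in> clopens Y" for A
    using Y clopens_sets[OF Y(1) D(2) that]
    by (intro invariant_measure_vimage[OF \<mu>] left_shift_measurable) auto
  moreover have "measure \<mu> (A \<union> B) = measure \<mu> A + measure \<mu> B"
    if "A \<in> clopens Y" "B \<in> clopens Y" "A \<inter> B = {}" for A B
    using clopens_sets[OF Y(1) D(2)] that by (intro finite_measure_Union) auto
  ultimately show ?thesis
    using Y clopens_shift[of Y] A.top prob_space
    by (auto simp: charges_def charge_of_def D(3))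
qed

text \<open>
  Caratheodory's theorem applies since continuity at the empty set is automatic: a decreasing sequence
  of clopen subsets of a compact set with empty intersection is eventually empty.
\<close>

lemma measure_of_charge:
  assumes Y: "closed Y" "left_shift ` Y = Y" and m: "m \<in> charges Y"
  shows "\<exists>\<mu>\<in>invariant_measures left_shift Y. charge_of Y \<mu> = m"
proof -
  interpret A: algebra Y "clopens Y" by (rule clopens_algebra)
  have m0: "0 \<le> m A" "m A \<le> 1" for A using m by (auto simp: charges_def)
  have mY: "m Y = 1" using m by (auto simp: charges_def)
  have add: "m (A \<union> B) = m A + m B" if "A \<in> clopens Y" "B \<in> clopens Y" "A \<inter> B = {}" for A B
    using m that by (auto simp: charges_def)
  have me: "m {} = 0" using add[of "{}" "{}"] by simp
  have cY: "compact Y" using compact_Int_closed[OF compact_UNIV_binseq Y(1)] by simp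
  have "\<exists>\<mu> :: binseq set \<Rightarrow> ennreal. (\<forall>s\<in>clopens Y. \<mu> s = ennreal (m s)) \<and>
      measure_space Y (sigma_sets Y (clopens Y)) \<mu>"
  proof (rule A.caratheodory_empty_continuous)
    show "positive (clopens Y) (\<lambda>A. ennreal (m A))" by (simp add: positive_def me)
    show "additive (clopens Y) (\<lambda>A. ennreal (m A))"
      using m0 by (auto simp: additive_def add simp flip: ennreal_plus)
    fix A :: "nat \<Rightarrow> binseq set"
    assume A: "range A \<subseteq> clopens Y" "decseq A" "(\<Inter>i. A i) = {}"
    have "\<exists>i. A i = {}"
    proof (rule ccontr)
      assume ne: "\<not> ?thesis"
      have "Y \<inter> (\<Inter>i\<in>UNIV. A i) \<noteq> {}"
      proof (rule compact_imp_fip_image[OF cY])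
        fix i have "A i \<in> clopens Y" using A by auto
        then show "closed (A i)" by (rule clopens_closed[OF Y(1)])
      next
        fix I :: "nat set" assume I: "finite I"
        have "A (Max (insert 0 I)) \<subseteq> A i" if "i \<in> I" for i
          using I that by (intro decseqD[OF A(2)] Max_ge) auto
        moreover have "A (Max (insert 0 I)) \<subseteq> Y" using A A.space_closed by blast
        ultimately show "Y \<inter> (\<Inter>i\<in>I. A i) \<noteq> {}" using ne by blast
      qed
      then show False using A by auto
    qed
    then obtain i where i: "A i = {}" by blast
    have "\<forall>\<^sub>F j in sequentially. ennreal (m (A j)) = 0"
      using eventually_ge_at_top[of i]
    proof eventually_elim
      case (elim j)
      then have "A j = {}" using decseqD[OF A(2), of i j] i by auto
      then show ?case by (simp add: me)
    qed
    then show "(\<lambda>i. ennreal (m (A i))) \<longlonglongrightarrow> 0" by (rule tendsto_eventually)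
  qed simp
  then obtain \<mu>0 where \<mu>0: "\<And>s. s \<in> clopens Y \<Longrightarrow> \<mu>0 s = ennreal (m s)"
    "measure_space Y (sigma_sets Y (clopens Y)) \<mu>0" by blast
  define \<mu> where "\<mu> = measure_of Y (sigma_sets Y (clopens Y)) \<mu>0"
  have sa: "sigma_algebra Y (sigma_sets Y (clopens Y))"
    using \<mu>0(2) by (simp add: measure_space_def)
  have sets: "sets \<mu> = sigma_sets Y (clopens Y)"
    unfolding \<mu>_def by (rule sigma_algebra.sets_measure_of_eq[OF sa])
  have sp: "space \<mu> = Y"
    unfolding \<mu>_def by (rule sigma_algebra.space_measure_of_eq[OF sa])
  have em: "emeasure \<mu> A = ennreal (m A)" if "A \<in> clopens Y" for A
    unfolding \<mu>_def using \<mu>0(2) that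
    by (subst emeasure_measure_of_sigma) (auto simp: measure_space_def \<mu>0(1) intro: sigma_sets.Basic)
  have P: "prob_space \<mu>"
    by (rule prob_spaceI) (simp add: sp em mY)
  have sets': "sets \<mu> = sets (restrict_space borel Y)"
    using sets sets_restrict_borel_clopens[OF Y(1)] by simp
  have meas: "left_shift \<in> \<mu> \<rightarrow>\<^sub>M \<mu>"
    using Y by (intro measurable_selfmap[OF sets'] left_shift_measurable) auto
  have "\<mu> = distr \<mu> \<mu> left_shift"
  proof (rule measure_eqI_clopens[OF Y(1) P sets'])
    show "sets (distr \<mu> \<mu> left_shift) = sets (restrict_space borel Y)" using sets' by simp
    fix A assume A: "A \<in> clopens Y"
    have "A \<in> sets \<mu>" using A sets by (auto intro: sigma_sets.Basic)
    then have "emeasure (distr \<mu> \<mu> left_shift) A = emeasure \<mu> (left_shift -` A \<inter> Y)"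
      using meas by (simp add: emeasure_distr sp)
    also have "\<dots> = emeasure \<mu> A"
      using A m clopens_shift[of Y A] Y by (simp add: em) (simp add: charges_def)
    finally show "emeasure \<mu> A = emeasure (distr \<mu> \<mu> left_shift) A" by simp
  qed
  then have "\<mu> \<in> invariant_measures left_shift Y"
    using P sets' by (simp add: invariant_measures_def)
  moreover have "charge_of Y \<mu> = m"
    using em m m0 by (auto simp: charge_of_def fun_eq_iff measure_def charges_def)
  ultimately show ?thesis by blast
qed

section \<open>Approximate maximisers at ergodic measures\<close>

text \<open>
  Conditioning on an invariant set keeps invariance. The two conditional measures given a non-trivial
  invariant set and its complement witness that a measure which is not ergodic is not extreme.
\<close>

lemma invariant_uniform_measure:
  assumes Y: "closed Y" "left_shift ` Y = Y" and \<mu>: "\<mu> \<in> invariant_measures left_shift Y"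
    and A: "A \<in> sets \<mu>" "left_shift -` A \<inter> Y = A" "measure \<mu> A > 0"
  shows "uniform_measure \<mu> A \<in> invariant_measures left_shift Y"
proof -
  have bY: "Y \<in> sets borel" using Y by simp
  note D = invariant_measuresD[OF \<mu> bY]
  interpret prob_space \<mu> by (rule D)
  have LY: "left_shift ` Y \<subseteq> Y" using Y(2) by simp
  note S = measurable_selfmap[OF D(2) left_shift_measurable LY]
  show ?thesis
  proof (rule invariant_measuresI[OF _ _ bY left_shift_measurable LY])
    show "prob_space (uniform_measure \<mu> A)"
      using A by (intro prob_space_uniform_measure) (auto simp: emeasure_eq_measure)
    show "sets (uniform_measure \<mu> A) = sets (restrict_space borel Y)" using D by simp
    fix B assume "B \<in> sets (uniform_measure \<mu> A)"
    then have B: "B \<in> sets \<mu>" by simp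
    have SB: "left_shift -` B \<inter> Y \<in> sets \<mu>" using measurable_sets[OF S B] D(3) by simp
    have "A \<inter> (left_shift -` B \<inter> Y) = left_shift -` (A \<inter> B) \<inter> Y" using A(2) by blast
    then have "measure \<mu> (A \<inter> (left_shift -` B \<inter> Y)) = measure \<mu> (A \<inter> B)"
      using invariant_measure_vimage[OF \<mu> bY left_shift_measurable LY, of "A \<inter> B"] A(1) B by simp
    then show "measure (uniform_measure \<mu> A) (left_shift -` B \<inter> Y) = measure (uniform_measure \<mu> A) B"
      using A(1) B SB A(3) by (simp add: emeasure_eq_measure)
  qed
qed

text \<open>
  An enumeration of countably many clopen sets that separate the charges.
\<close>

definition basic_cylinder :: "nat \<Rightarrow> binseq set" where
  "basic_cylinder n = (case from_nat n of (xs, ys) \<Rightarrow> cylinder (set (xs :: int list)) (set (ys :: int list)))"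

lemma basic_cylinder_window: "\<exists>n. basic_cylinder n = cylinder (window L) a"
proof -
  obtain xs where xs: "set xs = window L" using finite_list[of "window L"] by auto
  obtain ys where ys: "set ys = a \<inter> window L" using finite_list[of "a \<inter> window L"] by auto
  have "basic_cylinder (to_nat (xs, ys)) = cylinder (window L) a"
    unfolding basic_cylinder_def by (simp add: xs ys cylinder_Int[of _ a])
  then show ?thesis by blast
qed

text \<open>
  A strictly convex continuous functional on the charges, of size at most 1.
\<close>

definition charge_energy :: "binseq set \<Rightarrow> (binseq set \<Rightarrow> real) \<Rightarrow> real" where
  "charge_energy Y m = (\<Sum>n. (1/2)^Suc n * (m (basic_cylinder n \<inter> Y))\<^sup>2)"

context
  fixes Y :: "binseq set"
begin

lemma charge_bounds: "m \<in> charges Y \<Longrightarrow> 0 \<le> m A" "m \<in> charges Y \<Longrightarrow> m A \<le> 1"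
  by (auto simp: charges_def)

lemma charge_energy_term_bounds:
  assumes "m \<in> charges Y"
  shows "0 \<le> (1/2)^Suc n * (m A)\<^sup>2" "(1/2)^Suc n * (m A)\<^sup>2 \<le> (1/2)^Suc n"
proof -
  have "(m A)\<^sup>2 \<le> 1" using charge_bounds[OF assms] by (simp add: power_le_one)
  then show "(1/2)^Suc n * (m A)\<^sup>2 \<le> (1/2)^Suc n" by (intro mult_left_le) auto
qed simp

lemma charge_energy_summable:
  assumes "m \<in> charges Y"
  shows "summable (\<lambda>n. (1/2)^Suc n * (m (basic_cylinder n \<inter> Y))\<^sup>2)"
proof (rule summable_comparison_test'[where N = 0])
  show "summable (\<lambda>n. (1/2)^Suc n :: real)" using power_half_series by (rule sums_summable)
  fix n show "norm ((1/2)^Suc n * (m (basic_cylinder n \<inter> Y))\<^sup>2) \<le> (1/2)^Suc n"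
    using charge_energy_term_bounds[OF assms] by (simp add: abs_of_nonneg)
qed

lemma charge_energy_bounds:
  assumes "m \<in> charges Y"
  shows "0 \<le> charge_energy Y m" "charge_energy Y m \<le> 1"
proof -
  show "0 \<le> charge_energy Y m"
    unfolding charge_energy_def using assms
    by (intro suminf_nonneg charge_energy_summable charge_energy_term_bounds)
  have "charge_energy Y m \<le> (\<Sum>n. (1/2)^Suc n)"
    unfolding charge_energy_def using assms sums_summable[OF power_half_series]
    by (intro suminf_le charge_energy_summable charge_energy_term_bounds) auto
  then show "charge_energy Y m \<le> 1" using power_half_series by (simp add: sums_iff)
qed

lemma continuous_charge_energy: "continuous_on (charges Y) (charge_energy Y)"
proof (rule uniform_limit_theorem)
  show "uniform_limit (charges Y)
     (\<lambda>N m. \<Sum>n<N. (1/2)^Suc n * (m (basic_cylinder n \<inter> Y))\<^sup>2) (charge_energy Y) sequentially"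
    unfolding charge_energy_def
  proof (rule Weierstrass_m_test)
    fix n m assume "m \<in> charges Y"
    then show "norm ((1/2)^Suc n * (m (basic_cylinder n \<inter> Y))\<^sup>2) \<le> (1/2)^Suc n"
      using charge_energy_term_bounds[of m] by (simp add: abs_of_nonneg)
  next
    show "summable (\<lambda>n. (1/2)^Suc n :: real)" using power_half_series by (rule sums_summable)
  qed
  show "\<forall>\<^sub>F N in sequentially. continuous_on (charges Y)
     (\<lambda>m. \<Sum>n<N. (1/2)^Suc n * (m (basic_cylinder n \<inter> Y))\<^sup>2)"
    by (intro always_eventually allI continuous_on_sum continuous_on_mult continuous_on_const
        continuous_on_power continuous_on_eval)
qed simp

text \<open>
  The identity \<open>t a\<^sup>2 + (1 - t) b\<^sup>2 - (t a + (1 - t) b)\<^sup>2 = t (1 - t) (a - b)\<^sup>2\<close>, summed over the basic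
  cylinders.
\<close>

lemma charge_energy_strict:
  assumes m: "m1 \<in> charges Y" "m2 \<in> charges Y" "(\<lambda>A. t * m1 A + (1 - t) * m2 A) \<in> charges Y"
    and t: "0 < t" "t < 1" and ne: "m1 (basic_cylinder k \<inter> Y) \<noteq> m2 (basic_cylinder k \<inter> Y)"
  shows "charge_energy Y (\<lambda>A. t * m1 A + (1 - t) * m2 A) <
    t * charge_energy Y m1 + (1 - t) * charge_energy Y m2"
proof -
  let ?e = "\<lambda>m n. (1/2::real)^Suc n * (m (basic_cylinder n \<inter> Y))\<^sup>2"
  let ?m = "\<lambda>A. t * m1 A + (1 - t) * m2 A"
  note s = charge_energy_summable[OF m(1)] charge_energy_summable[OF m(2)] charge_energy_summable[OF m(3)]
  have eq: "t * ?e m1 n + (1 - t) * ?e m2 n - ?e ?m n =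
      (1/2)^Suc n * (t * (1 - t) * (m1 (basic_cylinder n \<inter> Y) - m2 (basic_cylinder n \<inter> Y))\<^sup>2)" for n
    by (simp only: power2_eq_square) algebra
  have "0 < (\<Sum>n. t * ?e m1 n + (1 - t) * ?e m2 n - ?e ?m n)"
  proof (rule suminf_pos2[where i = k])
    show "summable (\<lambda>n. t * ?e m1 n + (1 - t) * ?e m2 n - ?e ?m n)"
      by (intro summable_diff summable_add summable_mult s)
    show "0 \<le> t * ?e m1 n + (1 - t) * ?e m2 n - ?e ?m n" for n
      unfolding eq using t by simp
    show "0 < t * ?e m1 k + (1 - t) * ?e m2 k - ?e ?m k"
      unfolding eq using t ne by simp
  qed
  also have "\<dots> = t * charge_energy Y m1 + (1 - t) * charge_energy Y m2 - charge_energy Y ?m"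
    unfolding charge_energy_def
    by (rule sums_unique[symmetric])
       (intro sums_diff sums_add sums_mult summable_sums s)
  finally show ?thesis by simp
qed

text \<open>
  The substitute for Krein--Milman and for the ergodic decomposition. Maximise \<open>f\<close> plus \<open>\<eta>\<close> times the
  energy. At a maximiser that is not ergodic, splitting into the two conditional measures of a
  non-trivial invariant set would contradict strict convexity; and the perturbation costs at most \<open>\<eta>\<close>.
\<close>

lemma ergodic_almost_maximiser:
  assumes Y: "closed Y" "left_shift ` Y = Y" and ne: "charges Y \<noteq> {}"
    and cont: "continuous_on (charges Y) f"
    and conv: "\<And>m1 m2 t. m1 \<in> charges Y \<Longrightarrow> m2 \<in> charges Y \<Longrightarrow> 0 < t \<Longrightarrow> t < 1 \<Longrightarrow>
      f (\<lambda>A. t * m1 A + (1 - t) * m2 A) \<le> t * f m1 + (1 - t) * f m2"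
    and \<eta>: "0 < (\<eta>::real)"
  shows "\<exists>\<mu>\<in>ergodic_measures left_shift Y. \<forall>m\<in>charges Y. f m \<le> f (charge_of Y \<mu>) + \<eta>"
proof -
  let ?g = "\<lambda>m. f m + \<eta> * charge_energy Y m"
  have "continuous_on (charges Y) ?g"
    by (intro continuous_intros cont continuous_charge_energy)
  from continuous_attains_sup[OF compact_charges ne this]
  obtain m where m: "m \<in> charges Y" "\<And>m'. m' \<in> charges Y \<Longrightarrow> ?g m' \<le> ?g m" by blast
  obtain \<mu> where \<mu>: "\<mu> \<in> invariant_measures left_shift Y" "charge_of Y \<mu> = m"
    using measure_of_charge[OF Y m(1)] by blast
  have bY: "Y \<in> sets borel" using Y by simp
  note D = invariant_measuresD[OF \<mu>(1) bY]
  interpret prob_space \<mu> by (rule D)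
  have "measure \<mu> A = 0 \<or> measure \<mu> A = 1" if A: "A \<in> sets \<mu>" "left_shift -` A \<inter> Y = A" for A
  proof (rule ccontr)
    assume "\<not> ?thesis"
    then have pos: "0 < measure \<mu> A" "measure \<mu> A < 1"
      using measure_nonneg[of \<mu> A] prob_le_1[of A] by linarith+
    define t where "t = measure \<mu> A"
    have A': "Y - A \<in> sets \<mu>" "left_shift -` (Y - A) \<inter> Y = Y - A" "measure \<mu> (Y - A) = 1 - t"
    proof -
      show "Y - A \<in> sets \<mu>" using sets.compl_sets[OF A(1)] D(3) by simp
      have "left_shift -` Y \<inter> Y = Y" using Y(2) by blast
      then show "left_shift -` (Y - A) \<inter> Y = Y - A" using A(2) by blast
      show "measure \<mu> (Y - A) = 1 - t" using prob_compl[OF A(1)] D(3) by (simp add: t_def)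
    qed
    let ?N1 = "uniform_measure \<mu> A" and ?N2 = "uniform_measure \<mu> (Y - A)"
    have N: "?N1 \<in> invariant_measures left_shift Y" "?N2 \<in> invariant_measures left_shift Y"
      using invariant_uniform_measure[OF Y \<mu>(1) A] invariant_uniform_measure[OF Y \<mu>(1) A'(1,2)] pos A'
      by (simp_all add: t_def)
    let ?m1 = "charge_of Y ?N1" and ?m2 = "charge_of Y ?N2"
    note C = charge_of_charges[OF Y N(1)] charge_of_charges[OF Y N(2)]
    have mix: "(\<lambda>B. t * ?m1 B + (1 - t) * ?m2 B) = m"
    proof
      fix B
      show "t * ?m1 B + (1 - t) * ?m2 B = m B"
      proof (cases "B \<in> clopens Y")
        case True
        have B: "B \<in> sets \<mu>" by (rule clopens_sets[OF Y(1) D(2) True])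
        have "t * measure ?N1 B = measure \<mu> (A \<inter> B)"
          using A B pos by (simp add: emeasure_eq_measure t_def)
        moreover have "(1 - t) * measure ?N2 B = measure \<mu> ((Y - A) \<inter> B)"
          using A' B pos by (simp add: emeasure_eq_measure t_def)
        moreover have "measure \<mu> (A \<inter> B) + measure \<mu> ((Y - A) \<inter> B) = measure \<mu> B"
        proof -
          have "B = (A \<inter> B) \<union> ((Y - A) \<inter> B)" using sets.sets_into_space[OF B] D(3) by auto
          then show ?thesis using A A' B by (subst (3) \<open>B = _\<close>, subst finite_measure_Union) auto
        qed
        ultimately show ?thesis using True by (simp add: charge_of_def flip: \<mu>(2))
      qed (simp add: charge_of_def flip: \<mu>(2))
    qed
    have "\<exists>k. ?m1 (basic_cylinder k \<inter> Y) \<noteq> ?m2 (basic_cylinder k \<inter> Y)"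
    proof (rule ccontr)
      assume "\<not> ?thesis"
      then have *: "?m1 (basic_cylinder k \<inter> Y) = ?m2 (basic_cylinder k \<inter> Y)" for k by blast
      have "?N1 = ?N2"
      proof (rule measure_eqI_cylinders[OF Y(1)])
        fix L a
        obtain k where "basic_cylinder k = cylinder (window L) a" using basic_cylinder_window by blast
        with *[of k] show "measure ?N1 (cylinder (window L) a \<inter> Y) = measure ?N2 (cylinder (window L) a \<inter> Y)"
          by (simp add: charge_of_def clopens_cylinder)
      qed (use N[THEN invariant_measuresD(1)] N[THEN invariant_measuresD(2)] bY in auto)
      moreover have "measure ?N1 A = 1"
        using A pos by (simp add: emeasure_eq_measure)
      moreover have "measure ?N2 A = 0"
      proof -
        have "(Y - A) \<inter> A = {}" by blast
        then show ?thesis using A A' pos by (simp add: emeasure_eq_measure t_def)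
      qed
      ultimately show False by simp
    qed
    then obtain k where k: "?m1 (basic_cylinder k \<inter> Y) \<noteq> ?m2 (basic_cylinder k \<inter> Y)" by blast
    have t: "0 < t" "t < 1" using pos by (auto simp: t_def)
    have "charge_energy Y m < t * charge_energy Y ?m1 + (1 - t) * charge_energy Y ?m2"
      using charge_energy_strict[OF C _ t k] m(1) unfolding mix by simp
    then have "\<eta> * charge_energy Y m < \<eta> * (t * charge_energy Y ?m1 + (1 - t) * charge_energy Y ?m2)"
      using \<eta> by simp
    moreover have "f m \<le> t * f ?m1 + (1 - t) * f ?m2"
      using conv[OF C t] unfolding mix .
    ultimately have "?g m < t * ?g ?m1 + (1 - t) * ?g ?m2"
      by (simp add: algebra_simps)
    moreover have "t * ?g ?m1 \<le> t * ?g m" "(1 - t) * ?g ?m2 \<le> (1 - t) * ?g m"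
      using t by (auto intro!: mult_left_mono m(2) C simp del: add_le_cancel_left)
    moreover have "t * ?g m + (1 - t) * ?g m = ?g m" by algebra
    ultimately show False by linarith
  qed
  then have "\<mu> \<in> ergodic_measures left_shift Y"
    using \<mu> by (auto simp: ergodic_measures_def)
  moreover have "f m' \<le> f (charge_of Y \<mu>) + \<eta>" if "m' \<in> charges Y" for m'
  proof -
    have "f m' \<le> ?g m'" using \<eta> charge_energy_bounds(1)[OF that] by simp
    also have "\<dots> \<le> ?g m" by (rule m(2)[OF that])
    also have "\<dots> \<le> f m + \<eta>" using \<eta> charge_energy_bounds(2)[OF m(1)] by simp
    finally show ?thesis unfolding \<mu>(2) .
  qed
  ultimately show ?thesis by blast
qed

end

section \<open>Ergodic measures are extreme\<close>

text \<open>
  An almost invariant set agrees up to a null set with the set of points that visit it infinitely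
  often, and the latter is strictly invariant.
\<close>

lemma ergodic_almost_invariant_set:
  assumes \<mu>: "\<mu> \<in> ergodic_measures T Y" and Y: "Y \<in> sets borel" "T \<in> borel \<rightarrow>\<^sub>M borel" "T ` Y \<subseteq> Y"
    and E: "E \<in> sets \<mu>" "measure \<mu> (E - T -` E) = 0"
  shows "measure \<mu> E = 0 \<or> measure \<mu> E = 1"
proof -
  have \<mu>i: "\<mu> \<in> invariant_measures T Y" using \<mu> by (simp add: ergodic_measures_def)
  note D = invariant_measuresD[OF \<mu>i Y(1)]
  interpret prob_space \<mu> by (rule D)
  note T = measurable_selfmap[OF D(2) Y(2,3)]
  note inv = invariant_measure_vimage[OF \<mu>i Y]
  have EY: "E \<subseteq> Y" using sets.sets_into_space[OF E(1)] D(3) by simp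
  define F where "F n = (T ^^ n) -` E \<inter> Y" for n :: nat
  have TnY: "(T ^^ n) x \<in> Y" if "x \<in> Y" for n x
    using that Y(3) by (induction n) auto
  have FS: "F (Suc n) = T -` F n \<inter> Y" for n
    using Y(3) by (auto simp: F_def funpow_swap1 simp del: funpow.simps) (auto simp: funpow_swap1)
  have F0: "F 0 = E" using EY by (auto simp: F_def)
  have Fs[measurable]: "F n \<in> sets \<mu>" for n
  proof (induction n)
    case (Suc n)
    then show ?case using measurable_sets[OF T, of "F n"] by (simp add: FS D(3))
  qed (use E F0 in simp)
  have null: "measure \<mu> (F n - F (Suc n)) = 0" for n
  proof (induction n)
    case 0
    have "F 0 - F (Suc 0) = E - T -` E" using EY by (auto simp: F0 FS)
    then show ?case using E by simp
  next
    case (Suc n)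
    have "F (Suc n) - F (Suc (Suc n)) = T -` (F n - F (Suc n)) \<inter> Y"
      unfolding FS[of "Suc n"] FS[of n] by auto
    then show ?case using inv[of "F n - F (Suc n)"] Suc by simp
  qed
  have mF: "measure \<mu> (F n) = measure \<mu> E" for n
  proof (induction n)
    case (Suc n)
    then show ?case unfolding FS using inv[OF Fs[of n]] by simp
  qed (simp add: F0)
  define G where "G n = (\<Union>k. F (n + k))" for n
  have Gs[measurable]: "G n \<in> sets \<mu>" for n unfolding G_def by measurable
  \<comment> \<open>the points that visit \<open>E\<close> infinitely often\<close>
  define H where "H = (\<Inter>n. G n)"
  have Hs: "H \<in> sets \<mu>" unfolding H_def by measurable
  have GS: "G (Suc n) = T -` G n \<inter> Y" for n
    unfolding G_def using FS by auto
  have Gdec: "G (Suc n) \<subseteq> G n" for n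
  proof
    fix x assume "x \<in> G (Suc n)"
    then obtain k where "x \<in> F (n + Suc k)" by (auto simp: G_def)
    then show "x \<in> G n" unfolding G_def by blast
  qed
  have GY: "G n \<subseteq> Y" for n by (auto simp: G_def F_def)
  have "T -` H \<inter> Y = (\<Inter>n. G (Suc n))"
    unfolding GS H_def by auto
  also have "\<dots> = H"
    unfolding H_def using Gdec by auto
  finally have HT: "T -` H \<inter> Y = H" .
  have EH: "measure \<mu> (E - F n) = 0" for n
  proof (induction n)
    case (Suc n)
    have "measure \<mu> (E - F (Suc n)) \<le> measure \<mu> ((E - F n) \<union> (F n - F (Suc n)))"
      using E(1) by (intro finite_measure_mono) auto
    also have "\<dots> \<le> measure \<mu> (E - F n) + measure \<mu> (F n - F (Suc n))"
      using E(1) by (intro measure_Un_le) auto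
    finally show ?case using Suc null[of n] measure_nonneg[of \<mu> "E - F (Suc n)"] by linarith
  qed (simp add: F0)
  have FE: "measure \<mu> (F n - E) = 0" for n
  proof -
    have "measure \<mu> (F n \<union> E) = measure \<mu> (F n) + measure \<mu> (E - F n)"
      using finite_measure_Union'[of "F n" E] E by simp
    moreover have "measure \<mu> (E \<union> F n) = measure \<mu> E + measure \<mu> (F n - E)"
      using finite_measure_Union'[of E "F n"] E by simp
    ultimately show ?thesis using EH[of n] mF[of n] by (simp add: Un_commute)
  qed
  have AEF: "AE x in \<mu>. x \<in> F n \<longleftrightarrow> x \<in> E" for n
  proof -
    have null: "E - F n \<in> null_sets \<mu>" "F n - E \<in> null_sets \<mu>"
      using EH[of n] FE[of n] E(1) by (auto simp: null_sets_def emeasure_eq_measure)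
    from null[THEN AE_not_in] show ?thesis by eventually_elim auto
  qed
  then have "AE x in \<mu>. \<forall>n. x \<in> F n \<longleftrightarrow> x \<in> E" by (simp add: AE_all_countable)
  then have "AE x in \<mu>. x \<in> H \<longleftrightarrow> x \<in> E"
    by eventually_elim (auto simp: H_def G_def)
  then have "measure \<mu> H = measure \<mu> E"
    using E(1) Hs by (intro finite_measure_eq_AE) auto
  moreover have "measure \<mu> H = 0 \<or> measure \<mu> H = 1"
    using \<mu> HT Hs by (auto simp: ergodic_measures_def)
  ultimately show ?thesis by simp
qed

text \<open>
  Let \<open>f\<close> be the density. Both measures give equal mass to \<open>E - T\<^sup>-\<^sup>1E\<close> and \<open>T\<^sup>-\<^sup>1E - E\<close>, where \<open>E = {f > 1}\<close>;
  but \<open>f > 1\<close> on the first set and \<open>f \<le> 1\<close> on the second, so that both sets are null. By ergodicity \<open>E\<close> is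
  null, as it cannot have full measure, and \<open>f \<le> 1\<close> with integral 1 leaves only \<open>f = 1\<close>.
\<close>

lemma ergodic_dominated_eq:
  assumes \<mu>: "\<mu> \<in> ergodic_measures T Y" and Y: "Y \<in> sets borel" "T \<in> borel \<rightarrow>\<^sub>M borel" "T ` Y \<subseteq> Y"
    and \<mu>1: "\<mu>1 \<in> invariant_measures T Y" and ac: "absolutely_continuous \<mu> \<mu>1"
  shows "\<mu>1 = \<mu>"
proof -
  have \<mu>i: "\<mu> \<in> invariant_measures T Y" using \<mu> by (simp add: ergodic_measures_def)
  note D = invariant_measuresD[OF \<mu>i Y(1)]
  note D1 = invariant_measuresD[OF \<mu>1 Y(1)]
  interpret prob_space \<mu> by (rule D)
  interpret P1: prob_space \<mu>1 by (rule D1)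
  note T = measurable_selfmap[OF D(2) Y(2,3)]
  note inv = invariant_measure_vimage[OF \<mu>i Y] and inv1 = invariant_measure_vimage[OF \<mu>1 Y]
  have ss: "sets \<mu>1 = sets \<mu>" using D D1 by simp
  define f where "f = RN_deriv \<mu> \<mu>1"
  have fm[measurable]: "f \<in> borel_measurable \<mu>" by (simp add: f_def)
  have df: "density \<mu> f = \<mu>1" unfolding f_def by (rule density_RN_deriv[OF ac ss])
  have em1: "emeasure \<mu>1 B = (\<integral>\<^sup>+x. f x * indicator B x \<partial>\<mu>)" if "B \<in> sets \<mu>" for B
    unfolding df[symmetric] using that by (simp add: emeasure_density)
  define E where "E = {x \<in> space \<mu>. 1 < f x}"
  have Es[measurable]: "E \<in> sets \<mu>" unfolding E_def by measurable
  define E' where "E' = T -` E \<inter> Y"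
  have E's[measurable]: "E' \<in> sets \<mu>" using measurable_sets[OF T Es] by (simp add: E'_def D(3))
  have mE: "measure \<mu> E' = measure \<mu> E" "measure \<mu>1 E' = measure \<mu>1 E"
    using inv[of E] inv1[of E] ss by (auto simp: E'_def)
  have sym: "measure \<mu> (E - E') = measure \<mu> (E' - E)" "measure \<mu>1 (E - E') = measure \<mu>1 (E' - E)"
    using mE finite_measure_Diff'[of E E'] finite_measure_Diff'[of E' E]
      P1.finite_measure_Diff'[of E E'] P1.finite_measure_Diff'[of E' E] ss
    by (auto simp: Int_commute)
  have gt: "measure \<mu> B = 0" if B: "B \<in> sets \<mu>" "B \<subseteq> E" "measure \<mu>1 B \<le> measure \<mu> B" for B
  proof -
    have "(\<integral>\<^sup>+x. f x * indicator B x \<partial>\<mu>) \<le> (\<integral>\<^sup>+x. indicator B x \<partial>\<mu>)"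
      using em1[OF B(1), symmetric] B by (simp add: P1.emeasure_eq_measure emeasure_eq_measure)
    then have "AE x in \<mu>. f x * indicator B x \<le> (indicator B x :: ennreal)"
    proof (rule contrapos_pp)
      assume n: "\<not> (AE x in \<mu>. f x * indicator B x \<le> (indicator B x :: ennreal))"
      have "(\<integral>\<^sup>+x. indicator B x \<partial>\<mu>) < (\<integral>\<^sup>+x. f x * indicator B x \<partial>\<mu>)"
      proof (rule nn_integral_less)
        show "(\<integral>\<^sup>+x. indicator B x \<partial>\<mu>) \<noteq> \<infinity>" using B by simp
        show "AE x in \<mu>. (indicator B x :: ennreal) \<le> f x * indicator B x"
          using B(2) by (intro AE_I2) (auto simp: E_def indicator_def less_imp_le)
      qed (use B n in auto)
      then show "\<not> (\<integral>\<^sup>+x. f x * indicator B x \<partial>\<mu>) \<le> (\<integral>\<^sup>+x. indicator B x \<partial>\<mu>)" by simp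
    qed
    then have "AE x in \<mu>. x \<notin> B"
      by eventually_elim (use B(2) in \<open>auto simp: E_def indicator_def split: if_splits\<close>)
    then show ?thesis using B(1) prob_eq_0[of B] by simp
  qed
  have "measure \<mu>1 (E' - E) \<le> measure \<mu> (E' - E)"
  proof -
    have "(\<integral>\<^sup>+x. f x * indicator (E' - E) x \<partial>\<mu>) \<le> (\<integral>\<^sup>+x. indicator (E' - E) x \<partial>\<mu>)"
      by (intro nn_integral_mono) (auto simp: E_def indicator_def not_less)
    then show ?thesis
      using em1[of "E' - E", symmetric] by (simp add: P1.emeasure_eq_measure emeasure_eq_measure)
  qed
  then have "measure \<mu> (E - E') = 0" using sym by (intro gt) auto
  moreover have "E - E' = E - T -` E" using sets.sets_into_space[OF Es] by (auto simp: E'_def D(3))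
  ultimately have "measure \<mu> E = 0 \<or> measure \<mu> E = 1"
    by (intro ergodic_almost_invariant_set[OF \<mu> Y Es]) simp
  then have E0: "measure \<mu> E = 0"
    using gt[OF Es] P1.prob_le_1[of E] by fastforce
  have le: "measure \<mu>1 B \<le> measure \<mu> B" if B: "B \<in> sets \<mu>" for B
  proof -
    have "AE x in \<mu>. x \<notin> E" using E0 prob_eq_0[of E] by simp
    then have "AE x in \<mu>. f x * indicator B x \<le> (indicator B x :: ennreal)"
      using AE_space by eventually_elim (auto simp: E_def indicator_def not_less)
    then have "(\<integral>\<^sup>+x. f x * indicator B x \<partial>\<mu>) \<le> (\<integral>\<^sup>+x. indicator B x \<partial>\<mu>)"
      by (rule nn_integral_mono_AE)
    then show ?thesis
      using em1[OF B, symmetric] B by (simp add: P1.emeasure_eq_measure emeasure_eq_measure)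
  qed
  show ?thesis
  proof (rule measure_eqI[OF ss])
    fix B assume "B \<in> sets \<mu>1"
    then have B: "B \<in> sets \<mu>" using ss by simp
    have "measure \<mu> (space \<mu> - B) \<ge> measure \<mu>1 (space \<mu> - B)" using B by (intro le) auto
    then have "measure \<mu>1 B \<ge> measure \<mu> B"
      using prob_compl[OF B] P1.prob_compl[of B] B ss D(3) D1(3) by simp
    then show "emeasure \<mu>1 B = emeasure \<mu> B"
      using le[OF B] by (simp add: P1.emeasure_eq_measure emeasure_eq_measure)
  qed
qed

lemma ergodic_measures_subset_extreme:
  assumes Y: "Y \<in> sets borel" "T \<in> borel \<rightarrow>\<^sub>M borel" "T ` Y \<subseteq> Y"
  shows "ergodic_measures T Y \<subseteq> extreme_measures (invariant_measures T Y)"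
proof
  fix \<mu> assume \<mu>: "\<mu> \<in> ergodic_measures T Y"
  then have \<mu>i: "\<mu> \<in> invariant_measures T Y" by (simp add: ergodic_measures_def)
  note D = invariant_measuresD[OF \<mu>i Y(1)]
  interpret prob_space \<mu> by (rule D)
  have "\<mu>1 = \<mu>2" if \<mu>12: "\<mu>1 \<in> invariant_measures T Y" "\<mu>2 \<in> invariant_measures T Y"
    and t: "0 < t" "t < 1"
    and mix: "\<forall>A\<in>sets \<mu>. measure \<mu> A = t * measure \<mu>1 A + (1 - t) * measure \<mu>2 A" for \<mu>1 \<mu>2 t
  proof -
    note D1 = invariant_measuresD[OF \<mu>12(1) Y(1)] and D2 = invariant_measuresD[OF \<mu>12(2) Y(1)]
    interpret P1: prob_space \<mu>1 by (rule D1)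
    interpret P2: prob_space \<mu>2 by (rule D2)
    have z: "measure \<mu>1 A = 0 \<and> measure \<mu>2 A = 0" if "A \<in> sets \<mu>" "measure \<mu> A = 0" for A
    proof -
      have "0 = t * measure \<mu>1 A + (1 - t) * measure \<mu>2 A" using mix that by simp
      moreover have "0 \<le> t * measure \<mu>1 A" "0 \<le> (1 - t) * measure \<mu>2 A" using t by auto
      ultimately have "t * measure \<mu>1 A = 0" "(1 - t) * measure \<mu>2 A = 0" by linarith+
      then show ?thesis using t by simp
    qed
    have "absolutely_continuous \<mu> \<mu>1" "absolutely_continuous \<mu> \<mu>2"
      using z D(2) D1(2) D2(2)
      by (auto simp: absolutely_continuous_def null_sets_def emeasure_eq_measure
          P1.emeasure_eq_measure P2.emeasure_eq_measure)
    then show ?thesis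
      using ergodic_dominated_eq[OF \<mu> Y \<mu>12(1)] ergodic_dominated_eq[OF \<mu> Y \<mu>12(2)] by simp
  qed
  then show "\<mu> \<in> extreme_measures (invariant_measures T Y)"
    using \<mu>i unfolding extreme_measures_def by blast
qed

section \<open>Zero entropy when the symbol 1 is rare\<close>

lemma funpow_left_shift: "(left_shift ^^ i) x = (\<lambda>j. x (j + int i))"
  by (induction i arbitrary: x) (auto simp: left_shift_def fun_eq_iff algebra_simps)

lemma funpow_left_shift_mem: "left_shift ` Y \<subseteq> Y \<Longrightarrow> x \<in> Y \<Longrightarrow> (left_shift ^^ i) x \<in> Y"
  by (induction i) auto

lemma funpow_left_shift_surj:
  assumes "left_shift ` Y = Y" "x \<in> Y"
  shows "\<exists>z\<in>Y. (left_shift ^^ i) z = x"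
proof (induction i)
  case (Suc i)
  then obtain z where "z \<in> Y" "(left_shift ^^ i) z = x" by blast
  moreover then obtain w where "w \<in> Y" "z = left_shift w" using assms by blast
  ultimately show ?case by (intro bexI[of _ w]) (auto simp: funpow_swap1)
qed (use assms in simp)

text \<open>
  The empirical measure of an orbit segment of length \<open>n\<close>, as a function on clopen sets. It is a charge
  except that invariance holds only up to \<open>1 / n\<close>.
\<close>

definition visit_frequency :: "binseq set \<Rightarrow> nat \<Rightarrow> binseq \<Rightarrow> binseq set \<Rightarrow> real" where
  "visit_frequency Y n x A =
    (if A \<in> clopens Y then (\<Sum>i<n. indicator A ((left_shift ^^ i) x)) / n else 0)"

lemma visit_frequency_bounds: "0 \<le> visit_frequency Y n x A" "visit_frequency Y n x A \<le> 1"
proof -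
  have "(\<Sum>i<n. indicator A ((left_shift ^^ i) x) :: real) \<le> (\<Sum>i<n. 1)"
    by (intro sum_mono) (auto simp: indicator_def)
  then show "visit_frequency Y n x A \<le> 1"
    by (auto simp: visit_frequency_def divide_le_eq)
qed (auto simp: visit_frequency_def intro!: divide_nonneg_nonneg sum_nonneg)

lemma visit_frequency_shift:
  assumes Y: "left_shift ` Y = Y" "x \<in> Y" "A \<in> clopens Y"
  shows "\<bar>visit_frequency Y n x (left_shift -` A \<inter> Y) - visit_frequency Y n x A\<bar> \<le> 1 / n"
proof -
  let ?g = "\<lambda>i. indicator A ((left_shift ^^ i) x) :: real"
  have A': "left_shift -` A \<inter> Y \<in> clopens Y" using clopens_shift[of Y A] Y by simp
  have "indicator (left_shift -` A \<inter> Y) ((left_shift ^^ i) x) = ?g (Suc i)" for i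
    using funpow_left_shift_mem[of Y x i] Y by (auto simp: indicator_def)
  then have "visit_frequency Y n x (left_shift -` A \<inter> Y) - visit_frequency Y n x A =
      ((\<Sum>i<n. ?g (Suc i)) - (\<Sum>i<n. ?g i)) / n"
    using Y A' by (simp add: visit_frequency_def diff_divide_distrib del: funpow.simps)
  also have "\<dots> = (?g n - ?g 0) / n"
    using sum_lessThan_telescope[of ?g n] by (simp only: sum_subtractf)
  also have "\<bar>\<dots>\<bar> \<le> 1 / n"
    by (auto simp: indicator_def abs_divide intro!: divide_right_mono)
  finally show ?thesis .
qed

text \<open>
  A limit point of the empirical measures is obtained as a common point of closed sets of functions
  that are invariant up to \<open>1 / k\<close>, by the finite intersection property.
\<close>

lemma Krylov_Bogoliubov_frequency:
  assumes Y: "closed Y" "left_shift ` Y = Y" and A: "A \<in> clopens Y"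
    and freq: "\<And>N. \<exists>n\<ge>N. \<exists>x\<in>Y. \<alpha> \<le> visit_frequency Y n x A"
  shows "\<exists>m\<in>charges Y. \<alpha> \<le> m A"
proof -
  interpret C: algebra Y "clopens Y" by (rule clopens_algebra)
  let ?B = "{m :: binseq set \<Rightarrow> real. \<forall>A. 0 \<le> m A \<and> m A \<le> 1}"
  define F where "F k = {m. m Y = 1 \<and> \<alpha> \<le> m A \<and> (\<forall>A\<in>- clopens Y. m A = 0) \<and>
     (\<forall>A\<in>clopens Y. \<forall>B\<in>{B \<in> clopens Y. A \<inter> B = {}}. m (A \<union> B) = m A + m B) \<and>
     (\<forall>A\<in>clopens Y. \<bar>m (left_shift -` A \<inter> Y) - m A\<bar> \<le> 1 / Suc k)}" for k
  have F_eq: "F k = {m. m Y = 1} \<inter> ({m. \<alpha> \<le> m A} \<inter> ((\<Inter>A\<in>- clopens Y. {m. m A = 0}) \<inter>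
     ((\<Inter>A\<in>clopens Y. \<Inter>B\<in>{B \<in> clopens Y. A \<inter> B = {}}. {m. m (A \<union> B) = m A + m B}) \<inter>
     (\<Inter>A\<in>clopens Y. {m. \<bar>m (left_shift -` A \<inter> Y) - m A\<bar> \<le> 1 / Suc k}))))" for k
    by (auto simp: F_def)
  have cl: "closed (F k)" for k
    unfolding F_eq
    by (intro closed_Int closed_INT ballI closed_Collect_eq closed_Collect_le
        continuous_on_eval continuous_on_const continuous_on_add continuous_on_diff continuous_on_rabs)
  have mono: "F k' \<subseteq> F k" if "k \<le> k'" for k k'
  proof -
    have "1 / real (Suc k') \<le> 1 / Suc k" using that by (simp add: frac_le)
    then show ?thesis unfolding F_def by (auto intro: order_trans)
  qed
  have ne: "?B \<inter> F k \<noteq> {}" for k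
  proof -
    obtain n x where nx: "n \<ge> Suc k" "x \<in> Y" "\<alpha> \<le> visit_frequency Y n x A" using freq by blast
    let ?m = "visit_frequency Y n x"
    have inY: "(left_shift ^^ i) x \<in> Y" for i using funpow_left_shift_mem[of Y x i] Y nx by simp
    have "?m (A \<union> B) = ?m A + ?m B" if "A \<in> clopens Y" "B \<in> clopens Y" "A \<inter> B = {}" for A B
    proof -
      have "indicator (A \<union> B) z = (indicator A z + indicator B z :: real)" for z
        using that(3) by (auto simp: indicator_def)
      moreover have "A \<union> B \<in> clopens Y" using that by blast
      ultimately show ?thesis using that
        by (simp add: visit_frequency_def sum.distrib add_divide_distrib)
    qed
    moreover have "?m Y = 1" using C.top nx inY by (simp add: visit_frequency_def indicator_def)
    moreover have "\<bar>?m (left_shift -` A \<inter> Y) - ?m A\<bar> \<le> 1 / Suc k" if "A \<in> clopens Y" for A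
    proof -
      have "1 / real n \<le> 1 / Suc k" using nx(1) by (intro divide_left_mono) auto
      then show ?thesis using visit_frequency_shift[OF Y(2) nx(2) that, of n] by linarith
    qed
    ultimately have "?m \<in> ?B \<inter> F k"
      using nx(3) visit_frequency_bounds by (auto simp: F_def visit_frequency_def)
    then show ?thesis by blast
  qed
  have "?B \<inter> (\<Inter>k\<in>UNIV. F k) \<noteq> {}"
  proof (rule compact_imp_fip_image[OF compact_unit_box cl])
    fix I :: "nat set" assume "finite I"
    then have "F (Max (insert 0 I)) \<subseteq> F i" if "i \<in> I" for i
      using that by (intro mono Max_ge) auto
    then show "?B \<inter> (\<Inter>i\<in>I. F i) \<noteq> {}" using ne[of "Max (insert 0 I)"] by blast
  qed
  then obtain m where m: "m \<in> ?B" "\<And>k. m \<in> F k" by blast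
  have "m (left_shift -` A \<inter> Y) = m A" if "A \<in> clopens Y" for A
  proof -
    have "\<bar>m (left_shift -` A \<inter> Y) - m A\<bar> \<le> 1 / Suc k" for k
      using m(2)[of k] that by (simp add: F_def)
    then have "\<bar>m (left_shift -` A \<inter> Y) - m A\<bar> \<le> 0"
      by (intro LIMSEQ_le_const[OF LIMSEQ_inverse_real_of_nat]) (auto simp: field_simps inverse_eq_divide)
    then show ?thesis by simp
  qed
  then have "m \<in> charges Y"
    using m(1) m(2)[of 0] by (auto simp: charges_def F_def)
  moreover have "\<alpha> \<le> m A" using m(2)[of 0] by (simp add: F_def)
  ultimately show ?thesis by blast
qed

text \<open>
  Otherwise Krylov--Bogoliubov yields a charge, and then the approximate maximiser an ergodic measure,
  that gives positive mass to the sequences with a 1 at position 0.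
\<close>

lemma uniformly_rare_ones:
  assumes Y: "closed Y" "left_shift ` Y = Y"
    and erg: "\<And>\<mu>. \<mu> \<in> ergodic_measures left_shift Y \<Longrightarrow> measure \<mu> ({x. x 0} \<inter> Y) = 0"
    and \<alpha>: "\<alpha> > (0::real)"
  shows "\<exists>N. \<forall>n\<ge>N. \<forall>x\<in>Y. real (card {i\<in>{..<n}. x (int i)}) \<le> \<alpha> * n"
proof (rule ccontr)
  assume neg: "\<not> ?thesis"
  let ?A = "{x. x 0} \<inter> Y"
  have A: "?A \<in> clopens Y"
    using clopen_coordinate[of 0 True] by (intro clopensI) simp_all
  have "\<exists>m\<in>charges Y. \<alpha> \<le> m ?A"
  proof (rule Krylov_Bogoliubov_frequency[OF Y A])
    fix N
    obtain n x where nx: "n \<ge> max N 1" "x \<in> Y" "real (card {i\<in>{..<n}. x (int i)}) > \<alpha> * n"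
      using neg by (meson not_le)
    have "indicator ?A ((left_shift ^^ i) x) = (if x (int i) then 1 else 0 :: real)" for i
      using funpow_left_shift_mem[of Y x i] Y nx by (auto simp: indicator_def funpow_left_shift)
    then have "visit_frequency Y n x ?A = real (card {i\<in>{..<n}. x (int i)}) / n"
      using A by (simp add: visit_frequency_def sum.If_cases Int_def)
    moreover have "\<alpha> \<le> real (card {i\<in>{..<n}. x (int i)}) / n"
      using nx by (simp add: pos_le_divide_eq)
    ultimately have "\<alpha> \<le> visit_frequency Y n x ?A" by simp
    then show "\<exists>n\<ge>N. \<exists>x\<in>Y. \<alpha> \<le> visit_frequency Y n x ?A" using nx by auto
  qed
  then obtain m where m: "m \<in> charges Y" "\<alpha> \<le> m ?A" by blast
  have "\<exists>\<mu>\<in>ergodic_measures left_shift Y. \<forall>m\<in>charges Y. m ?A \<le> charge_of Y \<mu> ?A + \<alpha> / 2"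
    using m \<alpha> by (intro ergodic_almost_maximiser[OF Y]) (auto intro: continuous_on_eval)
  then obtain \<mu> where \<mu>: "\<mu> \<in> ergodic_measures left_shift Y" "m ?A \<le> charge_of Y \<mu> ?A + \<alpha> / 2"
    using m(1) by blast
  then have "\<alpha> \<le> \<alpha> / 2" using m(2) erg[OF \<mu>(1)] by (simp add: charge_of_def split: if_splits)
  then show False using \<alpha> by simp
qed

lemma sum_Pow_power_card:
  assumes "finite V"
  shows "(\<Sum>a\<in>Pow V. t ^ card a) = (1 + t :: real) ^ card V"
  using assms
proof (induction V rule: finite_induct)
  case (insert v V)
  have "(\<Sum>a\<in>Pow (insert v V). t ^ card a) = (\<Sum>a\<in>Pow V. t ^ card a) + (\<Sum>a\<in>insert v ` Pow V. t ^ card a)"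
    unfolding Pow_insert using insert by (intro sum.union_disjoint) auto
  also have "(\<Sum>a\<in>insert v ` Pow V. t ^ card a) = (\<Sum>a\<in>Pow V. t ^ card (insert v a))"
    using insert by (intro sum.reindex_cong[of "insert v"]) (auto simp: inj_on_def)
  also have "\<dots> = (\<Sum>a\<in>Pow V. t * t ^ card a)"
    using insert by (intro sum.cong) (auto simp: card_insert_if finite_subset)
  finally show ?case using insert by (simp add: sum_distrib_left[symmetric] algebra_simps)
qed simp

text \<open>
  Chernoff's bound: weigh a set \<open>a\<close> by \<open>t ^ card a\<close> and sum over all subsets.
\<close>

lemma card_small_subsets:
  assumes "finite V" "0 < t" "t \<le> 1"
  shows "real (card {a \<in> Pow V. real (card a) \<le> \<beta>}) \<le> (1 + t) ^ card V * t powr (- \<beta>)"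
proof -
  let ?W = "{a \<in> Pow V. real (card a) \<le> \<beta>}"
  have "real (card ?W) * t powr \<beta> = (\<Sum>a\<in>?W. t powr \<beta>)" by simp
  also have "\<dots> \<le> (\<Sum>a\<in>?W. t ^ card a)"
    using assms by (intro sum_mono) (auto simp: powr_realpow[symmetric] intro!: powr_mono')
  also have "\<dots> \<le> (\<Sum>a\<in>Pow V. t ^ card a)"
    using assms by (intro sum_mono2) auto
  also have "\<dots> = (1 + t) ^ card V" by (rule sum_Pow_power_card[OF assms(1)])
  finally show ?thesis
    using assms by (simp add: powr_minus field_simps)
qed

text \<open>
  If windows of size \<open>L\<close> decide a member of the cover, then a word on \<open>[-L, n + L)\<close> decides a member of
  the join of \<open>n\<close> shifted covers.
\<close>

lemma min_subcover_le_words: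
  assumes Y: "left_shift ` Y = Y"
    and L: "\<And>x. x \<in> Y \<Longrightarrow> \<exists>U\<in>\<U>. cylinder (window L) (Collect x) \<inter> Y \<subseteq> U"
  defines "I n \<equiv> {- int L..<int n + int L}"
  shows "min_subcover Y (iterated_join left_shift Y \<U> n) \<le> card ((\<lambda>x. Collect x \<inter> I n) ` Y)"
proof -
  have "\<exists>J\<in>iterated_join left_shift Y \<U> n. cylinder (I n) (Collect x) \<inter> Y \<subseteq> J" if x: "x \<in> Y" for x
  proof -
    have Sx: "(left_shift ^^ i) z \<in> Y" if "z \<in> Y" for i z
      using funpow_left_shift_mem[of Y z i] Y that by simp
    have "\<forall>i. \<exists>U\<in>\<U>. cylinder (window L) (Collect ((left_shift ^^ i) x)) \<inter> Y \<subseteq> U"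
      using L[OF Sx[OF x]] by blast
    then obtain U where U: "\<And>i. U i \<in> \<U>"
      "\<And>i. cylinder (window L) (Collect ((left_shift ^^ i) x)) \<inter> Y \<subseteq> U i" by metis
    have "(left_shift ^^ i) z \<in> U i" if z: "z \<in> cylinder (I n) (Collect x)" "z \<in> Y" and i: "i < n" for z i
    proof -
      have "(left_shift ^^ i) z \<in> cylinder (window L) (Collect ((left_shift ^^ i) x))"
        using z(1) i by (auto simp: cylinder_def funpow_left_shift I_def)
      then show ?thesis using U(2)[of i] Sx[OF z(2)] by blast
    qed
    then have "cylinder (I n) (Collect x) \<inter> Y \<subseteq> Y \<inter> (\<Inter>i<n. (left_shift ^^ i) -` U i)" by blast
    moreover have "Y \<inter> (\<Inter>i<n. (left_shift ^^ i) -` U i) \<in> iterated_join left_shift Y \<U> n"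
      unfolding iterated_join_def using U(1) by blast
    ultimately show ?thesis by blast
  qed
  then obtain J where J: "\<And>x. x \<in> Y \<Longrightarrow> J x \<in> iterated_join left_shift Y \<U> n"
    "\<And>x. x \<in> Y \<Longrightarrow> cylinder (I n) (Collect x) \<inter> Y \<subseteq> J x" by metis
  let ?W = "(\<lambda>x. Collect x \<inter> I n) ` Y"
  define r where "r w = (SOME x. x \<in> Y \<and> Collect x \<inter> I n = w)" for w
  have r: "r w \<in> Y \<and> Collect (r w) \<inter> I n = w" if "w \<in> ?W" for w
  proof -
    from that obtain x where "x \<in> Y \<and> Collect x \<inter> I n = w" by blast
    then show ?thesis unfolding r_def by (rule someI[of "\<lambda>x. x \<in> Y \<and> Collect x \<inter> I n = w"])
  qed
  have fin: "finite ?W"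
    by (rule finite_subset[of _ "Pow (I n)"]) (auto simp: I_def)
  let ?V = "(\<lambda>w. J (r w)) ` ?W"
  have JY: "J x \<subseteq> Y" if "x \<in> Y" for x using J(1)[OF that] by (auto simp: iterated_join_def)
  have "\<Union>?V = Y"
  proof (intro equalityI subsetI)
    fix z assume "z \<in> \<Union>?V"
    then show "z \<in> Y" using JY r by blast
  next
    fix z assume z: "z \<in> Y"
    let ?w = "Collect z \<inter> I n"
    have w: "?w \<in> ?W" using z by blast
    have "Collect (r ?w) \<inter> I n = ?w" using r[OF w] by simp
    then have "z \<in> cylinder (I n) (Collect (r ?w))" by (auto simp: cylinder_def)
    then show "z \<in> \<Union>?V" using J(2)[of "r ?w"] r[OF w] z w by blast
  qed
  moreover have "?V \<subseteq> iterated_join left_shift Y \<U> n" using J(1) r by blast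
  ultimately have "min_subcover Y (iterated_join left_shift Y \<U> n) \<le> card ?V"
    unfolding min_subcover_def using fin by (intro Least_le exI[of _ ?V]) simp
  also have "\<dots> \<le> card ?W" by (rule card_image_le[OF fin])
  finally show ?thesis .
qed

text \<open>
  Words in which 1 has frequency at most \<open>\<alpha>\<close> have exponential growth rate at most
  \<open>ln (1 + t) - \<alpha> ln t\<close> for every \<open>t\<close>. This is small if first \<open>t\<close> and then \<open>\<alpha>\<close> is chosen small.
\<close>

lemma entropy_zero_if_rare_ones:
  assumes Y: "closed Y" "left_shift ` Y = Y"
    and erg: "\<And>\<mu>. \<mu> \<in> ergodic_measures left_shift Y \<Longrightarrow> measure \<mu> ({x. x 0} \<inter> Y) = 0"
  shows "top_entropy left_shift Y \<le> 0"
  unfolding top_entropy_def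
proof (rule SUP_least)
  fix \<U> assume \<U>: "\<U> \<in> open_covers Y"
  obtain L where L: "\<And>x. x \<in> Y \<Longrightarrow> \<exists>U\<in>\<U>. cylinder (window L) (Collect x) \<inter> Y \<subseteq> U"
    using cylinder_Lebesgue_number[OF Y(1), of \<U>] \<U> by (auto simp: open_covers_def)
  let ?m = "\<lambda>n. min_subcover Y (iterated_join left_shift Y \<U> n)"
  show "limsup (\<lambda>n. ereal (ln (real (?m n)) / real n)) \<le> 0"
  proof (rule ereal_le_epsilon2)
    fix \<epsilon> :: real assume \<epsilon>: "0 < \<epsilon>"
    \<comment> \<open>\<open>t\<close> and \<open>\<alpha>\<close> bound the growth rate by \<open>\<epsilon> / 2\<close>; the factor 2 that remains absorbs the ends of the words on \<open>[-L, n + L)\<close>\<close>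
    define t where "t = min 1 (\<epsilon> / 4)"
    have t: "0 < t" "t \<le> 1" "ln (1 + t) \<le> \<epsilon> / 4"
      using \<epsilon> ln_add_one_self_le_self[of t] by (auto simp: t_def)
    define \<alpha> where "\<alpha> = \<epsilon> / (4 * (1 - ln t))"
    have lt: "ln t \<le> 0" using t by simp
    have \<alpha>: "0 < \<alpha>" "- \<alpha> * ln t \<le> \<epsilon> / 4"
    proof -
      show "0 < \<alpha>" using \<epsilon> lt by (simp add: \<alpha>_def)
      have "\<alpha> * (1 - ln t) = \<epsilon> / 4" using lt by (simp add: \<alpha>_def field_simps)
      then show "- \<alpha> * ln t \<le> \<epsilon> / 4" using \<open>0 < \<alpha>\<close> by (simp add: algebra_simps)
    qed
    obtain N where N: "\<And>n x. n \<ge> N \<Longrightarrow> x \<in> Y \<Longrightarrow> real (card {i\<in>{..<n}. x (int i)}) \<le> \<alpha> * n"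
      using uniformly_rare_ones[OF Y erg \<alpha>(1)] by blast
    have "ln (real (?m n)) / real n \<le> \<epsilon>" if n: "n \<ge> N" "n \<ge> 2 * L" "n \<ge> 1" for n
    proof -
      let ?I = "{- int L..<int n + int L}"
      let ?p = "n + 2 * L"
      have cI: "card ?I = ?p" by simp
      have "(\<lambda>x. Collect x \<inter> ?I) ` Y \<subseteq> {a \<in> Pow ?I. real (card a) \<le> \<alpha> * ?p}"
      proof clarsimp
        fix x assume "x \<in> Y"
        then obtain z where z: "z \<in> Y" "(left_shift ^^ L) z = x"
          using funpow_left_shift_surj[OF Y(2)] by blast
        \<comment> \<open>the frequency bound concerns words that start at 0; so shift back by \<open>L\<close>\<close>
        have "bij_betw (\<lambda>i. int i - int L) {i\<in>{..<?p}. z (int i)} (Collect x \<inter> ?I)"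
          by (rule bij_betw_byWitness[where f' = "\<lambda>j. nat (j + int L)"])
             (auto simp: z(2)[symmetric] funpow_left_shift)
        then have "card (Collect x \<inter> ?I) = card {i\<in>{..<?p}. z (int i)}"
          by (simp add: bij_betw_same_card)
        then show "real (card (Collect x \<inter> ?I)) \<le> \<alpha> * (real n + 2 * real L)"
          using N[of ?p z] n z(1) by simp
      qed
      then have "card ((\<lambda>x. Collect x \<inter> ?I) ` Y) \<le> card {a \<in> Pow ?I. real (card a) \<le> \<alpha> * ?p}"
        by (intro card_mono) auto
      then have "real (?m n) \<le> real (card {a \<in> Pow ?I. real (card a) \<le> \<alpha> * ?p})"
        using min_subcover_le_words[OF Y(2) L, of n] by simp
      also have "\<dots> \<le> (1 + t) ^ ?p * t powr (- (\<alpha> * ?p))"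
        using card_small_subsets[of ?I t "\<alpha> * ?p"] t cI by simp
      finally have le: "real (?m n) \<le> (1 + t) ^ ?p * t powr (- (\<alpha> * ?p))" .
      have "ln ((1 + t) ^ ?p * t powr (- (\<alpha> * ?p))) = ?p * (ln (1 + t) - \<alpha> * ln t)"
        using t by (simp add: ln_mult ln_realpow ln_powr algebra_simps)
      also have "\<dots> \<le> ?p * (\<epsilon> / 2)"
        using t \<alpha> by (intro mult_left_mono) auto
      also have "\<dots> \<le> (2 * n) * (\<epsilon> / 2)"
        using n \<epsilon> by (intro mult_right_mono) auto
      finally have le2: "ln ((1 + t) ^ ?p * t powr (- (\<alpha> * ?p))) \<le> n * \<epsilon>" by simp
      have "ln (real (?m n)) \<le> n * \<epsilon>"
      proof (cases "?m n = 0")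
        case False
        then have "ln (real (?m n)) \<le> ln ((1 + t) ^ ?p * t powr (- (\<alpha> * ?p)))"
          using le by (subst ln_le_cancel_iff) (auto intro: less_le_trans)
        with le2 show ?thesis by linarith
      qed (use \<epsilon> in simp)
      then show ?thesis using n by (simp add: field_simps)
    qed
    then have "\<forall>\<^sub>F n in sequentially. ereal (ln (real (?m n)) / real n) \<le> ereal \<epsilon>"
      by (intro eventually_sequentiallyI[of "max N (max (2 * L) 1)"]) simp
    then have "limsup (\<lambda>n. ereal (ln (real (?m n)) / real n)) \<le> ereal \<epsilon>"
      by (rule Limsup_bounded)
    then show "limsup (\<lambda>n. ereal (ln (real (?m n)) / real n)) \<le> 0 + ereal \<epsilon>" by simp
  qed
qed

section \<open>Ergodicity of a product with independent noise\<close>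

lemma (in prob_space) abs_measure_diff_le_sym_diff:
  assumes "A \<in> sets M" "B \<in> sets M"
  shows "\<bar>measure M A - measure M B\<bar> \<le> measure M (sym_diff A B)"
proof -
  have "measure M A \<le> measure M (B \<union> sym_diff A B)" "measure M B \<le> measure M (A \<union> sym_diff A B)"
    using assms by (auto intro!: finite_measure_mono)
  moreover have "measure M (B \<union> sym_diff A B) \<le> measure M B + measure M (sym_diff A B)"
    "measure M (A \<union> sym_diff A B) \<le> measure M A + measure M (sym_diff A B)"
    using assms by (auto intro!: measure_Un_le)
  ultimately show ?thesis by linarith
qed

text \<open>
  The sets that can be approximated form a sigma-algebra.
\<close>

lemma (in prob_space) approximation_by_algebra:
  assumes alg: "algebra (space M) G" and gen: "sets M = sigma_sets (space M) G"
    and A: "A \<in> sets M" and \<epsilon>: "0 < (\<epsilon>::real)"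
  shows "\<exists>B\<in>G. measure M (sym_diff A B) < \<epsilon>"
proof -
  interpret G: algebra "space M" G by (rule alg)
  have Gs: "B \<in> sets M" if "B \<in> G" for B using that gen by (auto intro: sigma_sets.Basic)
  have "A \<in> sigma_sets (space M) G" using A gen by simp
  then show ?thesis using \<epsilon>
  proof (induction arbitrary: \<epsilon>)
    case (Basic a)
    then show ?case by (intro bexI[of _ a]) auto
  next
    case Empty
    then show ?case by (intro bexI[of _ "{}"]) auto
  next
    case (Compl a)
    then obtain B where B: "B \<in> G" "measure M (sym_diff a B) < \<epsilon>" by blast
    have "a \<subseteq> space M" "B \<subseteq> space M"
      using Compl(1) B(1) G.space_closed sigma_sets_into_sp by blast+
    then have "sym_diff (space M - a) (space M - B) = sym_diff a B" by blast
    then show ?case using B by (intro bexI[of _ "space M - B"]) auto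
  next
    case (Union a)
    have as: "a i \<in> sets M" for i using Union(1) gen by simp
    let ?U = "\<lambda>n. \<Union>i\<le>n. a i"
    have "(\<lambda>n. measure M (?U n)) \<longlonglongrightarrow> measure M (\<Union>n. ?U n)"
      using as by (intro finite_Lim_measure_incseq) (auto simp: incseq_def, force)
    moreover have "(\<Union>n. ?U n) = (\<Union>i. a i)" by auto
    ultimately have "(\<lambda>n. measure M (?U n)) \<longlonglongrightarrow> measure M (\<Union>i. a i)" by simp
    from LIMSEQ_D[OF this, of "\<epsilon> / 2"] Union(3)
    obtain n where n: "\<bar>measure M (?U n) - measure M (\<Union>i. a i)\<bar> < \<epsilon> / 2" by auto
    have "\<exists>B\<in>G. measure M (sym_diff (a i) B) < \<epsilon> / (2 * Suc n)" for i
      using Union(3) by (intro Union(2)) simp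
    then obtain B where B: "\<And>i. B i \<in> G" "\<And>i. measure M (sym_diff (a i) (B i)) < \<epsilon> / (2 * Suc n)"
      by metis
    let ?B = "\<Union>i\<le>n. B i"
    have BG: "?B \<in> G" using B(1) by (intro G.finite_UN) auto
    have s: "sym_diff (a i) (B i) \<in> sets M" for i using as Gs[OF B(1)] by auto
    have Us: "(\<Union>i. a i) - ?U n \<in> sets M" using as by auto
    have "measure M ((\<Union>i. a i) - ?U n) = measure M (\<Union>i. a i) - measure M (?U n)"
      using as by (intro finite_measure_Diff) auto
    then have 1: "measure M ((\<Union>i. a i) - ?U n) < \<epsilon> / 2" using n by linarith
    have 2: "measure M (\<Union>i\<le>n. sym_diff (a i) (B i)) < \<epsilon> / 2"
    proof -
      have "measure M (\<Union>i\<le>n. sym_diff (a i) (B i)) \<le> (\<Sum>i\<le>n. measure M (sym_diff (a i) (B i)))"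
        using s by (intro finite_measure_subadditive_finite) auto
      also have "\<dots> < (\<Sum>i\<le>n. \<epsilon> / (2 * Suc n))"
        using B(2) by (intro sum_strict_mono) auto
      also have "\<dots> = \<epsilon> / 2" by (simp add: divide_simps)
      finally show ?thesis .
    qed
    have "measure M (sym_diff (\<Union>i. a i) ?B) \<le>
        measure M (((\<Union>i. a i) - ?U n) \<union> (\<Union>i\<le>n. sym_diff (a i) (B i)))"
      using s Us by (intro finite_measure_mono) (auto intro!: sets.Un)
    also have "\<dots> \<le> measure M ((\<Union>i. a i) - ?U n) + measure M (\<Union>i\<le>n. sym_diff (a i) (B i))"
      using s Us by (intro measure_Un_le) auto
    finally show ?case using 1 2 BG by (intro bexI[of _ ?B]) linarith+
  qed
qed

lemma measure_pair_measure_integral: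
  assumes "prob_space N" "prob_space M" and X: "X \<in> sets (N \<Otimes>\<^sub>M M)"
  shows "(\<lambda>x. measure M (Pair x -` X)) \<in> borel_measurable N"
    and "measure (N \<Otimes>\<^sub>M M) X = (\<integral>x. measure M (Pair x -` X) \<partial>N)"
proof -
  interpret N: prob_space N by fact
  interpret M: prob_space M by fact
  interpret pair_prob_space N M ..
  show m: "(\<lambda>x. measure M (Pair x -` X)) \<in> borel_measurable N"
    unfolding measure_def using M.measurable_emeasure_Pair[OF X] by measurable
  have "emeasure (N \<Otimes>\<^sub>M M) X = (\<integral>\<^sup>+x. ennreal (measure M (Pair x -` X)) \<partial>N)"
    by (simp add: M.emeasure_pair_measure_alt[OF X] M.emeasure_eq_measure)
  also have "\<dots> = ennreal (\<integral>x. measure M (Pair x -` X) \<partial>N)"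
    using m by (intro nn_integral_eq_integral N.integrable_const_bound[where B = 1]) auto
  finally show "measure (N \<Otimes>\<^sub>M M) X = (\<integral>x. measure M (Pair x -` X) \<partial>N)"
    by (simp add: measure_def integral_nonneg_AE)
qed

lemma (in prob_space) invariant_function_AE_const:
  assumes T: "T \<in> M \<rightarrow>\<^sub>M M"
    and erg: "\<And>A. A \<in> sets M \<Longrightarrow> T -` A \<inter> space M = A \<Longrightarrow> prob A = 0 \<or> prob A = 1"
    and g[measurable]: "g \<in> borel_measurable M" and inv: "\<And>x. x \<in> space M \<Longrightarrow> g (T x) = (g x :: real)"
    and int: "integrable M g"
  shows "AE x in M. g x = expectation g"
proof -
  let ?c = "expectation g"
  let ?A = "{x \<in> space M. g x < ?c}" and ?B = "{x \<in> space M. ?c < g x}"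
  have TA: "T -` ?A \<inter> space M = ?A" "T -` ?B \<inter> space M = ?B"
    using inv measurable_space[OF T] by auto
  have "prob ?A = 0 \<or> prob ?A = 1" "prob ?B = 0 \<or> prob ?B = 1" by (intro erg TA; measurable)+
  moreover have "prob ?A \<noteq> 1"
  proof
    assume "prob ?A = 1"
    then have "AE x in M. g x < ?c" by (subst (asm) prob_eq_1) (auto elim: eventually_mono)
    then have "expectation g < ?c" using int by (intro expectation_less) auto
    then show False by simp
  qed
  moreover have "prob ?B \<noteq> 1"
  proof
    assume "prob ?B = 1"
    then have "AE x in M. ?c < g x" by (subst (asm) prob_eq_1) (auto elim: eventually_mono)
    then have "?c < expectation g" using int by (intro expectation_greater) auto
    then show False by simp
  qed
  ultimately have "prob ?A = 0" "prob ?B = 0" by auto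
  then have "AE x in M. x \<notin> ?A" "AE x in M. x \<notin> ?B" by (simp_all add: prob_eq_0)
  then show ?thesis using AE_space by eventually_elim auto
qed

text \<open>
  The product of an ergodic system with a two-sided i.i.d. process of law \<open>H\<close>.
\<close>

locale noise_extension = base: prob_space \<nu> + noise: prob_space H
  for \<nu> :: "'a measure" and T :: "'a \<Rightarrow> 'a" and H :: "'b measure" +
  assumes T[measurable]: "T \<in> \<nu> \<rightarrow>\<^sub>M \<nu>" and distr_T: "distr \<nu> \<nu> T = \<nu>"
    and ergodic: "\<And>A. A \<in> sets \<nu> \<Longrightarrow> T -` A \<inter> space \<nu> = A \<Longrightarrow> measure \<nu> A = 0 \<or> measure \<nu> A = 1"
begin

definition \<Omega> :: "(int \<Rightarrow> 'b) measure" where "\<Omega> = PiM UNIV (\<lambda>_. H)"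

definition translate :: "nat \<Rightarrow> (int \<Rightarrow> 'b) \<Rightarrow> int \<Rightarrow> 'b" where "translate n \<omega> = (\<lambda>i. \<omega> (i + int n))"

definition \<Theta> :: "('a \<times> (int \<Rightarrow> 'b)) measure" where "\<Theta> = \<nu> \<Otimes>\<^sub>M \<Omega>"

definition skew :: "nat \<Rightarrow> 'a \<times> (int \<Rightarrow> 'b) \<Rightarrow> 'a \<times> (int \<Rightarrow> 'b)" where
  "skew n = (\<lambda>(x, \<omega>). ((T ^^ n) x, translate n \<omega>))"

sublocale \<Omega>: product_prob_space "\<lambda>_::int. H" UNIV ..

sublocale \<Omega>: prob_space \<Omega> unfolding \<Omega>_def by (rule \<Omega>.prob_space_axioms)

sublocale \<Theta>: pair_prob_space \<nu> \<Omega> ..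

sublocale \<Theta>: prob_space \<Theta> unfolding \<Theta>_def by (rule \<Theta>.prob_space_axioms)

lemma space_\<Omega>: "space \<Omega> = (UNIV \<rightarrow> space H)"
  by (auto simp: \<Omega>_def space_PiM)

lemma space_\<Theta>: "space \<Theta> = space \<nu> \<times> space \<Omega>"
  by (simp add: \<Theta>_def space_pair_measure)

lemma coordinate_measurable[measurable]: "(\<lambda>\<omega>. \<omega> i) \<in> \<Omega> \<rightarrow>\<^sub>M H"
  unfolding \<Omega>_def by measurable

lemma translate_measurable[measurable]: "translate n \<in> \<Omega> \<rightarrow>\<^sub>M \<Omega>"
  unfolding translate_def by (subst (2) \<Omega>_def) (rule measurable_PiM_single', auto simp: space_\<Omega>)

lemma distr_translate: "distr \<Omega> \<Omega> (translate n) = \<Omega>"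
  using distr_PiM_reindex[of UNIV "\<lambda>_::int. H" "\<lambda>i. i + int n" UNIV] noise.prob_space_axioms
  by (simp add: \<Omega>_def translate_def[abs_def] restrict_def)

lemma funpow_T_measurable[measurable]: "T ^^ n \<in> \<nu> \<rightarrow>\<^sub>M \<nu>"
  by (induction n) auto

lemma distr_funpow_T: "distr \<nu> \<nu> (T ^^ n) = \<nu>"
proof (induction n)
  case (Suc n)
  have "distr \<nu> \<nu> (T ^^ Suc n) = distr (distr \<nu> \<nu> (T ^^ n)) \<nu> T"
    by (subst distr_distr) (auto simp: comp_def simp del: funpow.simps(2) simp add: funpow.simps(2))
  then show ?case unfolding Suc distr_T .
qed (simp add: distr_id2 id_def)

lemma skew_measurable[measurable]: "skew n \<in> \<Theta> \<rightarrow>\<^sub>M \<Theta>"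
  unfolding skew_def \<Theta>_def by measurable

lemma distr_skew: "distr \<Theta> \<Theta> (skew n) = \<Theta>"
proof -
  have "\<Theta> = distr \<nu> \<nu> (T ^^ n) \<Otimes>\<^sub>M distr \<Omega> \<Omega> (translate n)"
    by (simp add: distr_funpow_T distr_translate \<Theta>_def)
  also have "\<dots> = distr \<Theta> \<Theta> (skew n)"
    unfolding \<Theta>_def skew_def
    by (rule pair_measure_distr) (simp_all add: distr_translate \<Omega>.sigma_finite_measure_axioms)
  finally show ?thesis by simp
qed

definition view :: "nat \<Rightarrow> 'a \<times> (int \<Rightarrow> 'b) \<Rightarrow> 'a \<times> (int \<Rightarrow> 'b)" where
  "view L = (\<lambda>(x, \<omega>). (x, restrict \<omega> (window L)))"

text \<open>
  The events of the product that depend on the noise in a window only.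
\<close>

definition windowed :: "nat \<Rightarrow> ('a \<times> (int \<Rightarrow> 'b)) set set" where
  "windowed L = {view L -` R \<inter> space \<Theta> | R. R \<in> sets (\<nu> \<Otimes>\<^sub>M PiM (window L) (\<lambda>_. H))}"

lemma restrict_window_measurable:
  "W \<subseteq> W' \<Longrightarrow> (\<lambda>\<omega>. restrict \<omega> W) \<in> PiM W' (\<lambda>_. H) \<rightarrow>\<^sub>M PiM W (\<lambda>_. H)"
  by (rule measurable_restrict_subset)

lemma restrict_measurable[measurable]: "(\<lambda>\<omega>. restrict \<omega> W) \<in> \<Omega> \<rightarrow>\<^sub>M PiM W (\<lambda>_. H)"
  unfolding \<Omega>_def by (rule measurable_restrict_subset) simp

lemma view_measurable[measurable]: "view L \<in> \<Theta> \<rightarrow>\<^sub>M \<nu> \<Otimes>\<^sub>M PiM (window L) (\<lambda>_. H)"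
  unfolding view_def \<Theta>_def by measurable

lemma windowed_mono: "L \<le> L' \<Longrightarrow> windowed L \<subseteq> windowed L'"
proof
  fix A assume L: "L \<le> L'" and "A \<in> windowed L"
  then obtain R where R: "A = view L -` R \<inter> space \<Theta>" "R \<in> sets (\<nu> \<Otimes>\<^sub>M PiM (window L) (\<lambda>_. H))"
    by (auto simp: windowed_def)
  let ?N = "\<nu> \<Otimes>\<^sub>M PiM (window L') (\<lambda>_. H)"
  have W: "window L \<subseteq> window L'" using L by (rule window_mono)
  note [measurable] = restrict_window_measurable[OF W]
  let ?f = "\<lambda>(x, \<omega>). (x, restrict \<omega> (window L))"
  have f: "?f \<in> ?N \<rightarrow>\<^sub>M \<nu> \<Otimes>\<^sub>M PiM (window L) (\<lambda>_. H)" by measurable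
  have "view L p = ?f (view L' p)" for p
  proof -
    have "window L' \<inter> window L = window L" using W by blast
    then show ?thesis by (auto simp: view_def split_beta)
  qed
  moreover have "view L' p \<in> space ?N" if "p \<in> space \<Theta>" for p
    using measurable_space[OF view_measurable that] .
  ultimately have "A = view L' -` (?f -` R \<inter> space ?N) \<inter> space \<Theta>"
    unfolding R(1) by auto
  then show "A \<in> windowed L'"
    unfolding windowed_def using measurable_sets[OF f R(2)] by blast
qed

lemma windowed_algebra: "algebra (space \<Theta>) (\<Union>L. windowed L)"
  unfolding algebra_iff_Un
proof (intro conjI ballI)
  show "(\<Union>L. windowed L) \<subseteq> Pow (space \<Theta>)" by (auto simp: windowed_def)
  have "{} \<in> windowed 0" unfolding windowed_def by (auto intro!: exI[of _ "{}"])
  then show "{} \<in> (\<Union>L. windowed L)" by blast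
next
  fix A assume "A \<in> (\<Union>L. windowed L)"
  then obtain L R where R: "A = view L -` R \<inter> space \<Theta>" "R \<in> sets (\<nu> \<Otimes>\<^sub>M PiM (window L) (\<lambda>_. H))"
    by (auto simp: windowed_def)
  have "space \<Theta> - A = view L -` (space (\<nu> \<Otimes>\<^sub>M PiM (window L) (\<lambda>_. H)) - R) \<inter> space \<Theta>"
    using measurable_space[OF view_measurable] unfolding R(1) by blast
  then have "space \<Theta> - A \<in> windowed L" unfolding windowed_def using sets.compl_sets[OF R(2)] by blast
  then show "space \<Theta> - A \<in> (\<Union>L. windowed L)" by blast
next
  fix A B assume "A \<in> (\<Union>L. windowed L)" "B \<in> (\<Union>L. windowed L)"
  then obtain L L' where "A \<in> windowed L" "B \<in> windowed L'" by blast
  then have "A \<in> windowed (max L L')" "B \<in> windowed (max L L')"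
    using windowed_mono[of L "max L L'"] windowed_mono[of L' "max L L'"] by auto
  then obtain R R' where
    "A = view (max L L') -` R \<inter> space \<Theta>" "R \<in> sets (\<nu> \<Otimes>\<^sub>M PiM (window (max L L')) (\<lambda>_. H))"
    "B = view (max L L') -` R' \<inter> space \<Theta>" "R' \<in> sets (\<nu> \<Otimes>\<^sub>M PiM (window (max L L')) (\<lambda>_. H))"
    by (auto simp: windowed_def)
  then have "A \<union> B = view (max L L') -` (R \<union> R') \<inter> space \<Theta>"
    "R \<union> R' \<in> sets (\<nu> \<Otimes>\<^sub>M PiM (window (max L L')) (\<lambda>_. H))" by auto
  then have "A \<union> B \<in> windowed (max L L')" unfolding windowed_def by blast
  then show "A \<union> B \<in> (\<Union>L. windowed L)" by blast
qed

text \<open>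
  The identity is measurable from the sigma-algebra generated by the windowed events, because the base
  point and each single coordinate of the noise are.
\<close>

lemma sets_\<Theta>_windowed: "sets \<Theta> = sigma_sets (space \<Theta>) (\<Union>L. windowed L)"
proof
  have "windowed L \<subseteq> sets \<Theta>" for L
    unfolding windowed_def using measurable_sets[OF view_measurable] by blast
  then show "sigma_sets (space \<Theta>) (\<Union>L. windowed L) \<subseteq> sets \<Theta>"
    by (intro sets.sigma_sets_subset) blast
next
  interpret A: algebra "space \<Theta>" "\<Union>L. windowed L" by (rule windowed_algebra)
  define N where "N = sigma (space \<Theta>) (\<Union>L. windowed L)"
  have spN: "space N = space \<Theta>" unfolding N_def using A.space_closed by (rule space_measure_of)
  have seN: "sets N = sigma_sets (space \<Theta>) (\<Union>L. windowed L)"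
    unfolding N_def using A.space_closed by (rule sets_measure_of)
  have win: "view L -` R \<inter> space N \<in> sets N" if "R \<in> sets (\<nu> \<Otimes>\<^sub>M PiM (window L) (\<lambda>_. H))" for L R
  proof -
    have "view L -` R \<inter> space N \<in> windowed L" using that unfolding windowed_def spN by blast
    then show ?thesis unfolding seN by (blast intro: sigma_sets.Basic)
  qed
  have viewN: "view L \<in> N \<rightarrow>\<^sub>M \<nu> \<Otimes>\<^sub>M PiM (window L) (\<lambda>_. H)" for L
    using measurable_space[OF view_measurable[of L]] win[of _ L] spN by (intro measurableI) auto
  have "fst \<in> N \<rightarrow>\<^sub>M \<nu>"
  proof -
    have "fst \<circ> view 0 \<in> N \<rightarrow>\<^sub>M \<nu>" by (rule measurable_comp[OF viewN]) simp
    moreover have "fst \<circ> view 0 = fst" by (auto simp: view_def fun_eq_iff)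
    ultimately show ?thesis by simp
  qed
  moreover have "snd \<in> N \<rightarrow>\<^sub>M \<Omega>"
    unfolding \<Omega>_def
  proof (rule measurable_PiM_single')
    show "snd \<in> space N \<rightarrow> UNIV \<rightarrow>\<^sub>E space H"
      by (auto simp: spN space_\<Theta> space_\<Omega>)
    fix i :: int
    have i: "i \<in> window (nat \<bar>i\<bar>)" by auto
    have "(\<lambda>p. snd p i) \<in> \<nu> \<Otimes>\<^sub>M PiM (window (nat \<bar>i\<bar>)) (\<lambda>_. H) \<rightarrow>\<^sub>M H"
      by (rule measurable_compose[OF measurable_snd measurable_component_singleton[OF i]])
    from measurable_comp[OF viewN this]
    have "(\<lambda>p. snd p i) \<circ> view (nat \<bar>i\<bar>) \<in> N \<rightarrow>\<^sub>M H" .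
    moreover have "(\<lambda>p. snd p i) \<circ> view (nat \<bar>i\<bar>) = (\<lambda>p. snd p i)"
      using i by (auto simp: view_def fun_eq_iff)
    ultimately show "(\<lambda>p. snd p i) \<in> N \<rightarrow>\<^sub>M H" by simp
  qed
  ultimately have id: "(\<lambda>p. (fst p, snd p)) \<in> N \<rightarrow>\<^sub>M \<Theta>"
    unfolding \<Theta>_def by (rule measurable_Pair)
  show "sets \<Theta> \<subseteq> sigma_sets (space \<Theta>) (\<Union>L. windowed L)"
  proof
    fix A assume A: "A \<in> sets \<Theta>"
    then have "A = (\<lambda>p. (fst p, snd p)) -` A \<inter> space N"
      using sets.sets_into_space[OF A] by (auto simp: spN)
    then show "A \<in> sigma_sets (space \<Theta>) (\<Union>L. windowed L)"
      using measurable_sets[OF id A] seN by simp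
  qed
qed

lemma indep_coordinates: "\<Omega>.indep_vars (\<lambda>_. H) (\<lambda>i \<omega>. \<omega> i) (UNIV :: int set)"
proof (subst \<Omega>.indep_vars_iff_distr_eq_PiM)
  have "distr \<Omega> (PiM UNIV (\<lambda>_. H)) (\<lambda>\<omega>. \<lambda>i\<in>UNIV. \<omega> i) = \<Omega>"
    by (simp add: \<Omega>_def restrict_UNIV distr_id2)
  moreover have "distr \<Omega> H (\<lambda>\<omega>. \<omega> i) = H" for i
    unfolding \<Omega>_def by (rule \<Omega>.PiM_component) simp
  ultimately show "distr \<Omega> (PiM UNIV (\<lambda>_. H)) (\<lambda>\<omega>. \<lambda>i\<in>UNIV. \<omega> i) = PiM UNIV (\<lambda>i. distr \<Omega> H (\<lambda>\<omega>. \<omega> i))"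
    by (simp add: \<Omega>_def)
qed (auto)

lemma disjoint_windows_independent:
  assumes "W \<inter> W' = {}" "Q \<in> sets (PiM W (\<lambda>_. H))" "Q' \<in> sets (PiM W' (\<lambda>_. H))"
  shows "measure \<Omega> {\<omega>\<in>space \<Omega>. restrict \<omega> W \<in> Q \<and> restrict \<omega> W' \<in> Q'} =
    measure \<Omega> {\<omega>\<in>space \<Omega>. restrict \<omega> W \<in> Q} * measure \<Omega> {\<omega>\<in>space \<Omega>. restrict \<omega> W' \<in> Q'}"
proof -
  have "\<Omega>.indep_var (PiM W (\<lambda>_. H)) (\<lambda>\<omega>. restrict \<omega> W) (PiM W' (\<lambda>_. H)) (\<lambda>\<omega>. restrict \<omega> W')"
    using \<Omega>.indep_var_restrict[OF indep_coordinates assms(1)] by simp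
  from \<Omega>.indep_varD[OF this assms(2,3)]
  show ?thesis by (simp add: vimage_def Int_def conj_commute)
qed

lemma translated_window_independent:
  assumes Q: "Q \<in> sets (PiM (window L) (\<lambda>_. H))" "Q' \<in> sets (PiM (window L) (\<lambda>_. H))"
  shows "measure \<Omega> {\<omega>\<in>space \<Omega>. restrict \<omega> (window L) \<in> Q \<and>
      restrict (translate (2 * L + 1) \<omega>) (window L) \<in> Q'} =
    measure \<Omega> {\<omega>\<in>space \<Omega>. restrict \<omega> (window L) \<in> Q} *
    measure \<Omega> {\<omega>\<in>space \<Omega>. restrict \<omega> (window L) \<in> Q'}"
proof -
  let ?n = "2 * L + 1"
  let ?W = "window L" and ?W' = "{int L + 1..3 * int L + 1}"
  let ?f = "\<lambda>w::int \<Rightarrow> 'b. \<lambda>i\<in>?W. w (i + int ?n)"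
  have f: "?f \<in> PiM ?W' (\<lambda>_. H) \<rightarrow>\<^sub>M PiM ?W (\<lambda>_. H)"
    by (rule measurable_restrict) (rule measurable_component_singleton, auto)
  let ?Q = "?f -` Q' \<inter> space (PiM ?W' (\<lambda>_. H))"
  have tr: "restrict (translate ?n \<omega>) ?W = ?f (restrict \<omega> ?W')" for \<omega>
    by (auto simp: translate_def fun_eq_iff)
  have eq: "restrict (translate ?n \<omega>) ?W \<in> Q' \<longleftrightarrow> restrict \<omega> ?W' \<in> ?Q" if "\<omega> \<in> space \<Omega>" for \<omega>
    using measurable_space[OF restrict_measurable that, of ?W'] unfolding tr by simp
  have "measure \<Omega> {\<omega>\<in>space \<Omega>. restrict \<omega> ?W \<in> Q \<and> restrict (translate ?n \<omega>) ?W \<in> Q'} =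
      measure \<Omega> {\<omega>\<in>space \<Omega>. restrict \<omega> ?W \<in> Q \<and> restrict \<omega> ?W' \<in> ?Q}"
    using eq by (intro arg_cong[of _ _ "measure \<Omega>"]) blast
  also have "\<dots> = measure \<Omega> {\<omega>\<in>space \<Omega>. restrict \<omega> ?W \<in> Q} * measure \<Omega> {\<omega>\<in>space \<Omega>. restrict \<omega> ?W' \<in> ?Q}"
    by (rule disjoint_windows_independent[OF _ Q(1) measurable_sets[OF f Q(2)]]) auto
  also have "{\<omega>\<in>space \<Omega>. restrict \<omega> ?W' \<in> ?Q} = translate ?n -` {\<omega>\<in>space \<Omega>. restrict \<omega> ?W \<in> Q'} \<inter> space \<Omega>"
    using eq measurable_space[OF translate_measurable] by blast
  also have "measure \<Omega> \<dots> = measure (distr \<Omega> \<Omega> (translate ?n)) {\<omega>\<in>space \<Omega>. restrict \<omega> ?W \<in> Q'}"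
    using measurable_sets[OF restrict_measurable Q(2)]
    by (subst measure_distr) (auto simp: vimage_def Int_def conj_commute)
  also have "\<dots> = measure \<Omega> {\<omega>\<in>space \<Omega>. restrict \<omega> ?W \<in> Q'}" by (simp add: distr_translate)
  finally show ?thesis .
qed

text \<open>
  Let \<open>A\<close> be invariant with measure \<open>c\<close> and let \<open>R\<close> be a windowed event close to \<open>A\<close>. For a translation \<open>S\<close>
  that moves the window off itself, independence gives \<open>\<integral> h(x) h(S x)\<close> for the measure of \<open>R \<inter> S\<^sup>-\<^sup>1R\<close>, where
  \<open>h(x)\<close> is the conditional probability of \<open>R\<close> given \<open>x\<close>. The conditional probability of \<open>A\<close> given \<open>x\<close> is an
  invariant function of \<open>x\<close>, hence equal to \<open>c\<close>; so \<open>h\<close> is close to \<open>c\<close> in mean, and the measure of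
  \<open>R \<inter> S\<^sup>-\<^sup>1R\<close> is close to \<open>c\<^sup>2\<close>. It is also close to the measure of \<open>A \<inter> S\<^sup>-\<^sup>1A = A\<close>. Thus \<open>c = c\<^sup>2\<close>.
\<close>

lemma skew_ergodic:
  assumes A: "A \<in> sets \<Theta>" "skew 1 -` A \<inter> space \<Theta> = A"
  shows "measure \<Theta> A = 0 \<or> measure \<Theta> A = 1"
proof -
  define c where "c = measure \<Theta> A"
  have close: "\<bar>c - c * c\<bar> \<le> 4 * \<epsilon>" if \<epsilon>: "0 < \<epsilon>" for \<epsilon>
  proof -
    obtain R where "R \<in> (\<Union>L. windowed L)" and R: "measure \<Theta> (sym_diff A R) < \<epsilon>"
      using \<Theta>.approximation_by_algebra[OF windowed_algebra sets_\<Theta>_windowed A(1) \<epsilon>] by blast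
    then obtain L where "R \<in> windowed L" by blast
    then obtain R' where R': "R = view L -` R' \<inter> space \<Theta>" "R' \<in> sets (\<nu> \<Otimes>\<^sub>M PiM (window L) (\<lambda>_. H))"
      by (auto simp: windowed_def)
    have Rs: "R \<in> sets \<Theta>" unfolding R'(1) using R'(2) by measurable
    \<comment> \<open>the least translation that makes the window disjoint from its translate\<close>
    let ?n = "2 * L + 1"
    let ?S = "skew ?n"
    have SRs: "?S -` R \<inter> space \<Theta> \<in> sets \<Theta>" using Rs by measurable
    have inv: "measure \<Theta> (?S -` B \<inter> space \<Theta>) = measure \<Theta> B" if "B \<in> sets \<Theta>" for B
      using measure_distr[OF skew_measurable that, of ?n] by (simp add: distr_skew)
    have skew_Suc: "skew (Suc k) p = skew 1 (skew k p)" for k p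
      by (auto simp: skew_def translate_def split_beta fun_eq_iff algebra_simps)
    have memA: "skew 1 p \<in> A \<longleftrightarrow> p \<in> A" if "p \<in> space \<Theta>" for p using A(2) that by blast
    have An: "skew k p \<in> A \<longleftrightarrow> p \<in> A" if "p \<in> space \<Theta>" for k p
    proof (induction k)
      case (Suc k)
      then show ?case unfolding skew_Suc using memA[OF measurable_space[OF skew_measurable that]] by simp
    qed (use that in \<open>auto simp: skew_def translate_def\<close>)
    have Asub: "A \<subseteq> space \<Theta>" using sets.sets_into_space[OF A(1)] .
    define h where "h x = measure \<Omega> (Pair x -` R)" for x
    define g where "g x = measure \<Omega> (Pair x -` A)" for x
    note P = base.prob_space_axioms \<Omega>.prob_space_axioms
    have hm[measurable]: "h \<in> borel_measurable \<nu>" and gm[measurable]: "g \<in> borel_measurable \<nu>"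
      unfolding h_def g_def
      using measure_pair_measure_integral(1)[OF P] Rs A(1) unfolding \<Theta>_def by blast+
    have h01: "0 \<le> h x" "h x \<le> 1" for x by (auto simp: h_def)
    have g01: "0 \<le> g x" "g x \<le> 1" for x by (auto simp: g_def)
    have hi: "integrable \<nu> h" and gi: "integrable \<nu> g"
      using h01 g01 by (auto intro!: base.integrable_const_bound[where B = 1])
    have cg: "c = (\<integral>x. g x \<partial>\<nu>)"
      unfolding c_def g_def using measure_pair_measure_integral(2)[OF P] A(1) unfolding \<Theta>_def by blast
    have "g (T x) = g x" if x: "x \<in> space \<nu>" for x
    proof -
      have "Pair x -` A = translate 1 -` (Pair (T x) -` A) \<inter> space \<Omega>"
        using memA[of "(x, _)"] x Asub by (auto simp: skew_def space_\<Theta>)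
      moreover have "Pair (T x) -` A \<in> sets \<Omega>"
        using A(1) unfolding \<Theta>_def by (rule sets_Pair1)
      ultimately have "g x = measure (distr \<Omega> \<Omega> (translate 1)) (Pair (T x) -` A)"
        unfolding g_def by (simp add: measure_distr)
      then show ?thesis by (simp add: distr_translate g_def)
    qed
    then have gc: "AE x in \<nu>. g x = c"
      unfolding cg by (intro base.invariant_function_AE_const[OF T ergodic gm _ gi])
    have "(\<integral>x. \<bar>h x - c\<bar> \<partial>\<nu>) = (\<integral>x. \<bar>h x - g x\<bar> \<partial>\<nu>)"
      using gc by (intro integral_cong_AE) (auto elim: eventually_mono)
    also have "\<dots> \<le> (\<integral>x. measure \<Omega> (Pair x -` (sym_diff A R)) \<partial>\<nu>)"
    proof (intro integral_mono)
      show "integrable \<nu> (\<lambda>x. \<bar>h x - g x\<bar>)" using hi gi by auto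
      show "integrable \<nu> (\<lambda>x. measure \<Omega> (Pair x -` (sym_diff A R)))"
        using measure_pair_measure_integral(1)[OF P, of "sym_diff A R"] A(1) Rs
        by (intro base.integrable_const_bound[where B = 1]) (auto simp: \<Theta>_def)
      fix x
      have "Pair x -` (sym_diff A R) = sym_diff (Pair x -` A) (Pair x -` R)" by auto
      then show "\<bar>h x - g x\<bar> \<le> measure \<Omega> (Pair x -` (sym_diff A R))"
        using \<Omega>.abs_measure_diff_le_sym_diff[of "Pair x -` A" "Pair x -` R"]
          sets_Pair1[of A \<nu> \<Omega> x] sets_Pair1[of R \<nu> \<Omega> x] A(1) Rs
        unfolding h_def g_def \<Theta>_def by (simp add: abs_minus_commute)
    qed
    also have "\<dots> = measure \<Theta> (sym_diff A R)"
      unfolding \<Theta>_def using A(1) Rs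
      by (intro measure_pair_measure_integral(2)[OF P, symmetric]) (auto simp: \<Theta>_def)
    finally have hc: "(\<integral>x. \<bar>h x - c\<bar> \<partial>\<nu>) < \<epsilon>" using R by simp
    have Tn: "(T ^^ ?n) \<in> \<nu> \<rightarrow>\<^sub>M \<nu>" by (rule funpow_T_measurable)
    have hcT: "(\<integral>x. \<bar>h ((T ^^ ?n) x) - c\<bar> \<partial>\<nu>) = (\<integral>x. \<bar>h x - c\<bar> \<partial>\<nu>)"
      using integral_distr[OF Tn, of "\<lambda>x. \<bar>h x - c\<bar>"] by (simp only: distr_funpow_T) simp
    have RR: "measure \<Theta> (R \<inter> (?S -` R \<inter> space \<Theta>)) = (\<integral>x. h x * h ((T ^^ ?n) x) \<partial>\<nu>)"
    proof -
      have "measure \<Theta> (R \<inter> (?S -` R \<inter> space \<Theta>)) =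
          (\<integral>x. measure \<Omega> (Pair x -` (R \<inter> (?S -` R \<inter> space \<Theta>))) \<partial>\<nu>)"
        unfolding \<Theta>_def using Rs SRs
        by (intro measure_pair_measure_integral(2)[OF P]) (auto simp: \<Theta>_def)
      also have "\<dots> = (\<integral>x. h x * h ((T ^^ ?n) x) \<partial>\<nu>)"
      proof (intro Bochner_Integration.integral_cong refl)
        fix x assume x: "x \<in> space \<nu>"
        have Tx: "(T ^^ ?n) x \<in> space \<nu>" by (rule measurable_space[OF Tn x])
        have slice: "Pair y -` R = {\<omega>\<in>space \<Omega>. restrict \<omega> (window L) \<in> Pair y -` R'}" if "y \<in> space \<nu>" for y
          using that unfolding R'(1) by (auto simp: view_def space_\<Theta>)
        have "Pair x -` (R \<inter> (?S -` R \<inter> space \<Theta>)) = {\<omega>\<in>space \<Omega>. restrict \<omega> (window L) \<in> Pair x -` R' \<and>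
            restrict (translate ?n \<omega>) (window L) \<in> Pair ((T ^^ ?n) x) -` R'}"
          using x Tx measurable_space[OF translate_measurable, of _ ?n]
          unfolding R'(1) by (auto simp: view_def space_\<Theta> skew_def)
        then show "measure \<Omega> (Pair x -` (R \<inter> (?S -` R \<inter> space \<Theta>))) = h x * h ((T ^^ ?n) x)"
          unfolding h_def slice[OF x] slice[OF Tx]
          using translated_window_independent[OF sets_Pair1[OF R'(2)] sets_Pair1[OF R'(2)]] by simp
      qed
      finally show ?thesis .
    qed
    have c01: "0 \<le> c" "c \<le> 1" by (auto simp: c_def)
    have "\<bar>h y - c\<bar> \<le> 1" for y using h01[of y] c01 by linarith
    then have di: "integrable \<nu> (\<lambda>x. \<bar>h x - c\<bar>)" "integrable \<nu> (\<lambda>x. \<bar>h ((T ^^ ?n) x) - c\<bar>)"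
      by (auto intro!: base.integrable_const_bound[where B = 1])
    have "\<bar>(\<integral>x. h x * h ((T ^^ ?n) x) \<partial>\<nu>) - c * c\<bar> = \<bar>\<integral>x. h x * h ((T ^^ ?n) x) - c * c \<partial>\<nu>\<bar>"
    proof -
      have "integrable \<nu> (\<lambda>x. h x * h ((T ^^ ?n) x))"
        using h01 by (intro base.integrable_const_bound[where B = 1]) (auto simp: abs_mult mult_le_one)
      then show ?thesis by (subst Bochner_Integration.integral_diff) (auto simp: base.prob_space)
    qed
    also have "\<dots> \<le> (\<integral>x. \<bar>h x - c\<bar> + \<bar>h ((T ^^ ?n) x) - c\<bar> \<partial>\<nu>)"
    proof (intro integral_abs_bound[THEN order_trans] integral_mono)
      show "integrable \<nu> (\<lambda>x. \<bar>h x * h ((T ^^ ?n) x) - c * c\<bar>)"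
      proof (rule base.integrable_const_bound[where B = 1])
        have "h x * h y \<le> 1" "0 \<le> h x * h y" "c * c \<le> 1" "0 \<le> c * c" for x y
          using h01 c01 by (auto intro: mult_le_one)
        then have "\<bar>h x * h y - c * c\<bar> \<le> 1" for x y by (smt (verit))
        then show "AE x in \<nu>. norm \<bar>h x * h ((T ^^ ?n) x) - c * c\<bar> \<le> 1" by simp
      qed measurable
      show "integrable \<nu> (\<lambda>x. \<bar>h x - c\<bar> + \<bar>h ((T ^^ ?n) x) - c\<bar>)"
        by (intro Bochner_Integration.integrable_add di)
      fix x
      have "h x * h ((T ^^ ?n) x) - c * c = (h x - c) * h ((T ^^ ?n) x) + c * (h ((T ^^ ?n) x) - c)"
        by (simp add: algebra_simps)
      also have "\<bar>\<dots>\<bar> \<le> \<bar>h x - c\<bar> * h ((T ^^ ?n) x) + c * \<bar>h ((T ^^ ?n) x) - c\<bar>"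
        using h01[of "(T ^^ ?n) x"] c01
        by (intro abs_triangle_ineq[THEN order_trans]) (simp add: abs_mult)
      also have "\<dots> \<le> \<bar>h x - c\<bar> + \<bar>h ((T ^^ ?n) x) - c\<bar>"
        using h01 c01 by (intro add_mono mult_left_le mult_left_le_one_le) auto
      finally show "\<bar>h x * h ((T ^^ ?n) x) - c * c\<bar> \<le> \<bar>h x - c\<bar> + \<bar>h ((T ^^ ?n) x) - c\<bar>" .
    qed
    also have "\<dots> = (\<integral>x. \<bar>h x - c\<bar> \<partial>\<nu>) + (\<integral>x. \<bar>h ((T ^^ ?n) x) - c\<bar> \<partial>\<nu>)"
      by (intro Bochner_Integration.integral_add di)
    finally have 1: "\<bar>measure \<Theta> (R \<inter> (?S -` R \<inter> space \<Theta>)) - c * c\<bar> \<le> 2 * \<epsilon>"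
      unfolding RR using hc hcT by linarith
    have "\<bar>c - measure \<Theta> (R \<inter> (?S -` R \<inter> space \<Theta>))\<bar> \<le>
        measure \<Theta> (sym_diff A (R \<inter> (?S -` R \<inter> space \<Theta>)))"
      unfolding c_def using A(1) Rs SRs by (intro \<Theta>.abs_measure_diff_le_sym_diff) auto
    also have "\<dots> \<le> measure \<Theta> (sym_diff A R \<union> (?S -` (sym_diff A R) \<inter> space \<Theta>))"
    proof (intro \<Theta>.finite_measure_mono)
      show "sym_diff A (R \<inter> (?S -` R \<inter> space \<Theta>)) \<subseteq> sym_diff A R \<union> (?S -` (sym_diff A R) \<inter> space \<Theta>)"
        using An[of _ ?n] Asub by blast
      show "sym_diff A R \<union> (?S -` (sym_diff A R) \<inter> space \<Theta>) \<in> sets \<Theta>"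
        using A(1) Rs by (intro sets.Un measurable_sets[OF skew_measurable]) auto
    qed
    also have "\<dots> \<le> measure \<Theta> (sym_diff A R) + measure \<Theta> (?S -` (sym_diff A R) \<inter> space \<Theta>)"
      using A(1) Rs by (intro measure_Un_le measurable_sets[OF skew_measurable]) auto
    also have "\<dots> \<le> 2 * \<epsilon>"
      using inv[of "sym_diff A R"] A(1) Rs R by simp
    finally show ?thesis using 1 by linarith
  qed
  have "\<bar>c - c * c\<bar> \<le> 0"
  proof (rule field_le_epsilon)
    fix e :: real assume "0 < e"
    then show "\<bar>c - c * c\<bar> \<le> 0 + e" using close[of "e / 4"] by simp
  qed
  then have "c * (1 - c) = 0" by (simp add: algebra_simps)
  then show ?thesis by (auto simp: c_def)
qed

end

section \<open>Conditional word probabilities, uniform noise and shifts\<close>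

text \<open>
  A regular conditional distribution of a finite partition, given \<open>\<pi>\<close>. Radon--Nikodym densities sum to 1
  almost everywhere only; on the exceptional set all the mass is put on the first cell.
\<close>

lemma fibre_densities:
  fixes M :: nat
  assumes "prob_space \<rho>" "prob_space \<nu>" and \<pi>[measurable]: "\<pi> \<in> \<rho> \<rightarrow>\<^sub>M \<nu>" and marg: "distr \<rho> \<nu> \<pi> = \<nu>"
    and D[measurable]: "\<And>k. k < M \<Longrightarrow> D k \<in> sets \<rho>"
    and disj: "disjoint_family_on D {..<M}" and cov: "(\<Union>k<M. D k) = space \<rho>"
  obtains g where "\<And>k. g k \<in> borel_measurable \<nu>" "\<And>k x. 0 \<le> g k x"
    "\<And>x. (\<Sum>k<M. g k x) = (1::real)"
    "\<And>k B. k < M \<Longrightarrow> B \<in> sets \<nu> \<Longrightarrow> (\<integral>x. indicator B x * g k x \<partial>\<nu>) = measure \<rho> (\<pi> -` B \<inter> D k)"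
proof -
  interpret R: prob_space \<rho> by fact
  interpret V: prob_space \<nu> by fact
  have M: "0 < M"
  proof (rule ccontr)
    assume "\<not> 0 < M"
    then have "space \<rho> = {}" using cov by simp
    then show False using R.not_empty by simp
  qed
  have Dsp: "D k \<subseteq> space \<rho>" if "k < M" for k using cov that by blast
  define N where "N k = distr (density \<rho> (indicator (D k))) \<nu> \<pi>" for k
  have N: "emeasure (N k) B = emeasure \<rho> (\<pi> -` B \<inter> D k)" if k: "k < M" and B: "B \<in> sets \<nu>" for k B
  proof -
    have "emeasure (N k) B = emeasure (density \<rho> (indicator (D k))) (\<pi> -` B \<inter> space \<rho>)"
      unfolding N_def using B by (subst emeasure_distr) auto
    also have "\<dots> = emeasure \<rho> (\<pi> -` B \<inter> space \<rho> \<inter> D k)"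
      using B D[OF k] by (subst emeasure_density) (auto simp: Int_ac simp flip: indicator_inter_arith)
    also have "\<pi> -` B \<inter> space \<rho> \<inter> D k = \<pi> -` B \<inter> D k" using Dsp[OF k] by blast
    finally show ?thesis .
  qed
  have sum_N: "(\<Sum>k<M. emeasure (N k) B) = emeasure \<nu> B" if B: "B \<in> sets \<nu>" for B
  proof -
    have "(\<Sum>k<M. emeasure (N k) B) = (\<Sum>k<M. emeasure \<rho> (\<pi> -` B \<inter> space \<rho> \<inter> D k))"
      using Dsp by (intro sum.cong refl) (auto simp: N B intro!: arg_cong[of _ _ "emeasure \<rho>"])
    also have "\<dots> = emeasure \<rho> (\<Union>k<M. \<pi> -` B \<inter> space \<rho> \<inter> D k)"
      using disj B by (intro sum_emeasure) (auto simp: disjoint_family_on_def)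
    also have "(\<Union>k<M. \<pi> -` B \<inter> space \<rho> \<inter> D k) = \<pi> -` B \<inter> space \<rho>" using cov by blast
    also have "emeasure \<rho> \<dots> = emeasure (distr \<rho> \<nu> \<pi>) B" using B by (simp add: emeasure_distr)
    finally show ?thesis by (simp add: marg)
  qed
  have le: "emeasure (N k) B \<le> emeasure \<nu> B" if "k < M" "B \<in> sets \<nu>" for k B
    unfolding sum_N[OF that(2), symmetric] using that(1) by (intro member_le_sum) auto
  have sN: "sets (N k) = sets \<nu>" for k by (simp add: N_def)
  have ac: "absolutely_continuous \<nu> (N k)" if "k < M" for k
    unfolding absolutely_continuous_def using le[OF that] sN by (auto simp: null_sets_def) (metis le_zero_eq)
  define r where "r k = RN_deriv \<nu> (N k)" for k
  have rm[measurable]: "r k \<in> borel_measurable \<nu>" for k by (simp add: r_def)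
  have dr: "density \<nu> (r k) = N k" if "k < M" for k
    unfolding r_def using V.density_RN_deriv[OF ac[OF that] sN] .
  have "density \<nu> (\<lambda>x. \<Sum>k<M. r k x) = density \<nu> (\<lambda>_. 1)"
  proof (rule measure_eqI)
    fix B assume "B \<in> sets (density \<nu> (\<lambda>x. \<Sum>k<M. r k x))"
    then have B[measurable]: "B \<in> sets \<nu>" by simp
    have "emeasure (density \<nu> (\<lambda>x. \<Sum>k<M. r k x)) B = (\<integral>\<^sup>+x. (\<Sum>k<M. r k x) * indicator B x \<partial>\<nu>)"
      by (rule emeasure_density) measurable
    also have "\<dots> = (\<integral>\<^sup>+x. (\<Sum>k<M. r k x * indicator B x) \<partial>\<nu>)" by (simp only: sum_distrib_right)
    also have "\<dots> = (\<Sum>k<M. \<integral>\<^sup>+x. r k x * indicator B x \<partial>\<nu>)" by (rule nn_integral_sum) measurable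
    also have "\<dots> = (\<Sum>k<M. emeasure (N k) B)"
      by (intro sum.cong refl) (auto simp: emeasure_density simp flip: dr)
    finally show "emeasure (density \<nu> (\<lambda>x. \<Sum>k<M. r k x)) B = emeasure (density \<nu> (\<lambda>_. 1)) B"
      by (simp add: sum_N emeasure_density)
  qed simp
  then have AE1: "AE x in \<nu>. (\<Sum>k<M. r k x) = 1"
    by (subst (asm) V.density_unique_iff) auto
  define g where "g k x = (if (\<Sum>k<M. r k x) = 1 then enn2real (r k x) else if k = 0 then 1 else 0)" for k x
  show ?thesis
  proof (rule that[of g])
    show "g k \<in> borel_measurable \<nu>" for k unfolding g_def by measurable
    show "0 \<le> g k x" for k x by (simp add: g_def)
    show "(\<Sum>k<M. g k x) = 1" for x
    proof (cases "(\<Sum>k<M. r k x) = 1")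
      case True
      have "r k x < \<top>" if "k < M" for k
      proof -
        have "r k x \<le> (\<Sum>k<M. r k x)" using that by (intro member_le_sum) auto
        then show ?thesis using True by (metis ennreal_one_less_top le_less_trans)
      qed
      then have "(\<Sum>k<M. enn2real (r k x)) = enn2real (\<Sum>k<M. r k x)"
        by (subst enn2real_sum) auto
      then show ?thesis using True by (simp add: g_def)
    next
      case False
      then show ?thesis using M by (simp add: g_def)
    qed
    fix k B assume k: "k < M" and B[measurable]: "B \<in> sets \<nu>"
    have "(\<integral>x. indicator B x * g k x \<partial>\<nu>) = enn2real (\<integral>\<^sup>+x. ennreal (indicator B x * g k x) \<partial>\<nu>)"
    proof (rule integral_eq_nn_integral)
      show "(\<lambda>x. indicator B x * g k x) \<in> borel_measurable \<nu>" unfolding g_def by measurable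
    qed (simp add: g_def)
    also have "(\<integral>\<^sup>+x. ennreal (indicator B x * g k x) \<partial>\<nu>) = (\<integral>\<^sup>+x. r k x * indicator B x \<partial>\<nu>)"
    proof (rule nn_integral_cong_AE)
      show "AE x in \<nu>. ennreal (indicator B x * g k x) = r k x * indicator B x"
        using AE1
      proof eventually_elim
        case (elim x)
        have "r k x \<le> (\<Sum>k<M. r k x)" using k by (intro member_le_sum) auto
        then have "r k x < \<top>" using elim by (metis ennreal_one_less_top le_less_trans)
        then show ?case using elim by (simp add: g_def indicator_def)
      qed
    qed
    also have "\<dots> = emeasure (N k) B" by (simp add: emeasure_density flip: dr[OF k])
    finally show "(\<integral>x. indicator B x * g k x \<partial>\<nu>) = measure \<rho> (\<pi> -` B \<inter> D k)"
      by (simp add: N[OF k B] measure_def)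
  qed
qed

definition unit_uniform :: "real measure" where
  "unit_uniform = uniform_measure lborel {0..1}"

lemma prob_space_unit_uniform: "prob_space unit_uniform"
  unfolding unit_uniform_def by (rule prob_space_uniform_measure) auto

lemma sets_unit_uniform[measurable_cong, simp]: "sets unit_uniform = sets borel"
  by (simp add: unit_uniform_def)

lemma space_unit_uniform[simp]: "space unit_uniform = UNIV"
  by (simp add: unit_uniform_def)

lemma measure_unit_uniform_atLeastLessThan:
  assumes "0 \<le> a" "a \<le> b" "b \<le> 1"
  shows "measure unit_uniform {a..<b} = b - a"
proof -
  have "{0..1} \<inter> {a..<b} = {a..<b}" using assms by auto
  then show ?thesis using assms by (simp add: unit_uniform_def)
qed

text \<open>
  Markers lie at negative positions too, which requires the inverse of the shift.
\<close>

definition bishift :: "int \<Rightarrow> binseq \<Rightarrow> binseq" where "bishift n x = (\<lambda>i. x (i + n))"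

lemma bishift_measurable[measurable]: "bishift n \<in> borel \<rightarrow>\<^sub>M borel"
proof (rule borel_measurable_continuous_onI)
  show "continuous_on UNIV (bishift n)"
    unfolding bishift_def by (intro continuous_on_coordinatewise_then_product continuous_on_coordinate)
qed

lemma bishift_mem:
  assumes "left_shift ` X = X" "x \<in> X"
  shows "bishift n x \<in> X"
proof (cases n)
  case (nonneg m)
  have "bishift (int m) x \<in> X"
  proof (induction m)
    case (Suc m)
    have "bishift (int (Suc m)) x = left_shift (bishift (int m) x)"
      by (auto simp: bishift_def left_shift_def fun_eq_iff algebra_simps)
    then show ?case using Suc assms(1) by blast
  qed (use assms in \<open>simp add: bishift_def\<close>)
  then show ?thesis using nonneg by simp
next
  case (neg m)
  have "bishift (- int m) x \<in> X" for m
  proof (induction m)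
    case (Suc m)
    then obtain z where z: "z \<in> X" "bishift (- int m) x = left_shift z" using assms(1) by blast
    have "bishift (- int (Suc m)) x = z"
    proof
      fix i
      have "bishift (- int m) x (i - 1) = z i" unfolding z(2) by (simp add: left_shift_def)
      then show "bishift (- int (Suc m)) x i = z i" by (simp add: bishift_def algebra_simps)
    qed
    then show ?case using z by simp
  qed (use assms in \<open>simp add: bishift_def\<close>)
  then show ?thesis using neg by blast
qed

lemma pred_coordinate_binseq[measurable]: "Measurable.pred borel (\<lambda>x::binseq. x i)"
  unfolding pred_def using clopen_coordinate(1)[of i True] by simp

lemma borel_measurable_binseqI:
  assumes "\<And>i. Measurable.pred M (\<lambda>z. f z i)"
  shows "f \<in> M \<rightarrow>\<^sub>M (borel :: binseq measure)"
proof -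
  have "f \<in> M \<rightarrow>\<^sub>M PiM UNIV (\<lambda>_. borel)"
  proof (rule measurable_PiM_single')
    show "(\<lambda>z. f z i) \<in> M \<rightarrow>\<^sub>M borel" for i
    proof (rule measurable_compose[OF assms[of i]])
      show "(\<lambda>b::bool. b) \<in> count_space UNIV \<rightarrow>\<^sub>M borel" by simp
    qed
  qed auto
  then show ?thesis using measurable_cong_sets[OF refl sets_PiM_equal_borel] by blast
qed

section \<open>Block coding\<close>

lemma invariant_measure_vimage_funpow:
  assumes "\<mu> \<in> invariant_measures T Y" "Y \<in> sets borel" "T \<in> borel \<rightarrow>\<^sub>M borel" "T ` Y \<subseteq> Y" "A \<in> sets \<mu>"
  shows "(T ^^ n) -` A \<inter> Y \<in> sets \<mu> \<and> measure \<mu> ((T ^^ n) -` A \<inter> Y) = measure \<mu> A"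
proof (induction n)
  case 0
  have "A \<subseteq> Y" using sets.sets_into_space[OF assms(5)] invariant_measuresD(3)[OF assms(1,2)] by simp
  then show ?case using assms(5) by (simp add: Int_absorb2)
next
  case (Suc n)
  have "(T ^^ Suc n) -` A \<inter> Y = T -` ((T ^^ n) -` A \<inter> Y) \<inter> Y"
    using assms(4) by (auto simp: funpow_swap1)
  moreover have "T -` ((T ^^ n) -` A \<inter> Y) \<inter> Y \<in> sets \<mu>"
    using measurable_sets[OF measurable_selfmap[OF invariant_measuresD(2)[OF assms(1,2)] assms(3,4)]] Suc
      invariant_measuresD(3)[OF assms(1,2)] by metis
  moreover have "measure \<mu> (T -` ((T ^^ n) -` A \<inter> Y) \<inter> Y) = measure \<mu> ((T ^^ n) -` A \<inter> Y)"
    using Suc by (intro invariant_measure_vimage[OF assms(1-4)]) blast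
  ultimately show ?case using Suc by (simp only:)
qed

text \<open>
  Data for random block coding: markers have density \<open>p\<close>; words have length \<open>N\<close> and the \<open>k\<close>-th word is
  \<open>e k\<close>; at a marker in position \<open>n\<close> the \<open>k\<close>-th word is sampled with probability \<open>g k\<close> at the \<open>n\<close>-th shift
  of \<open>x\<close>.
\<close>

locale block_coding =
  fixes X :: "binseq set" and \<nu> :: "binseq measure" and p :: real and N M :: nat
    and e :: "nat \<Rightarrow> int set" and g :: "nat \<Rightarrow> binseq \<Rightarrow> real"
  assumes X: "closed X" "left_shift ` X = X" and \<nu>: "\<nu> \<in> ergodic_measures left_shift X"
    and p: "0 < p" "p < 1"
    and g_measurable[measurable]: "\<And>k. g k \<in> borel_measurable \<nu>"
    and g_nonneg: "\<And>k x. 0 \<le> g k x" and sum_g: "\<And>x. (\<Sum>k<M. g k x) = 1"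
begin

lemma X_borel: "X \<in> sets borel" using X by simp

lemma shift_X: "left_shift ` X \<subseteq> X" using X by simp

lemma \<nu>_invariant: "\<nu> \<in> invariant_measures left_shift X"
  using \<nu> by (simp add: ergodic_measures_def)

lemmas \<nu>D = invariant_measuresD[OF \<nu>_invariant X_borel]

sublocale noise_extension \<nu> left_shift unit_uniform
proof (intro noise_extension.intro noise_extension_axioms.intro)
  show "prob_space \<nu>" "distr \<nu> \<nu> left_shift = \<nu>" by (fact \<nu>D)+
  show "left_shift \<in> \<nu> \<rightarrow>\<^sub>M \<nu>" by (rule measurable_selfmap[OF \<nu>D(2) left_shift_measurable shift_X])
  show "measure \<nu> A = 0 \<or> measure \<nu> A = 1" if "A \<in> sets \<nu>" "left_shift -` A \<inter> space \<nu> = A" for A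
    using \<nu> that by (simp add: ergodic_measures_def \<nu>D)
qed (rule prob_space_unit_uniform)

lemma sets_\<nu>: "B \<in> sets \<nu> \<longleftrightarrow> B \<in> sets borel \<and> B \<subseteq> X"
  unfolding \<nu>D(2) using X_borel by (auto simp: sets_restrict_space_iff)

lemma space_\<nu>: "space \<nu> = X" by (fact \<nu>D)

lemma ident_\<nu>_borel[measurable]: "(\<lambda>x. x) \<in> \<nu> \<rightarrow>\<^sub>M borel"
proof -
  have "(\<lambda>x::binseq. x) \<in> borel \<rightarrow>\<^sub>M borel" by simp
  from measurable_restrict_space1[OF this, of X] show ?thesis
    by (simp only: measurable_cong_sets[OF \<nu>D(2) refl])
qed

lemma bishift_\<nu>[measurable]: "bishift n \<in> \<nu> \<rightarrow>\<^sub>M \<nu>"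
  by (rule measurable_selfmap[OF \<nu>D(2) bishift_measurable]) (use bishift_mem[OF X(2)] in blast)

definition cumulative :: "nat \<Rightarrow> binseq \<Rightarrow> real" where
  "cumulative k x = (\<Sum>i<k. g i x)"

text \<open>
  One uniform variable per position decides whether there is a marker and which word it carries: it
  falls into \<open>[0, p)\<close> in the first case and into the \<open>k\<close>-th of the subintervals of lengths \<open>p * g k x\<close> in
  the second.
\<close>

definition slot :: "nat \<Rightarrow> binseq \<Rightarrow> real set" where
  "slot k x = {p * cumulative k x..<p * cumulative (Suc k) x}"

lemma cumulative_mono: "k \<le> k' \<Longrightarrow> cumulative k x \<le> cumulative k' x"
  unfolding cumulative_def by (intro sum_mono2) (auto simp: g_nonneg)

lemma cumulative_bounds: "0 \<le> cumulative k x" "k \<le> M \<Longrightarrow> cumulative k x \<le> 1"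
  using cumulative_mono[of k M x] by (auto simp: cumulative_def g_nonneg sum_g intro: sum_nonneg)

lemma cumulative_measurable[measurable]: "cumulative k \<in> borel_measurable \<nu>"
  unfolding cumulative_def by measurable

lemma slots_cover_aux: "(\<Union>k<m. slot k x) = {0..<p * cumulative m x}"
proof (induction m)
  case (Suc m)
  have "(\<Union>k<Suc m. slot k x) = {0..<p * cumulative m x} \<union> slot m x"
    by (simp add: lessThan_Suc Suc Un_commute)
  also have "\<dots> = {0..<p * cumulative (Suc m) x}"
    unfolding slot_def using p cumulative_bounds(1)[of m x] cumulative_mono[of m "Suc m" x]
    by (intro ivl_disj_un_two(3)) auto
  finally show ?case .
qed (simp add: cumulative_def)

lemma slots_cover: "(\<Union>k<M. slot k x) = {0..<p}"
  using slots_cover_aux[of x M] by (simp add: cumulative_def sum_g)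

lemma slot_subset: "k < M \<Longrightarrow> slot k x \<subseteq> {0..<p}"
  using slots_cover by blast

lemma slots_disjoint:
  assumes "u \<in> slot k x" "u \<in> slot k' x"
  shows "k = k'"
proof -
  have "False" if "k < k'" "u \<in> slot k x" "u \<in> slot k' x" for k k'
  proof -
    have "p * cumulative (Suc k) x \<le> p * cumulative k' x"
      using that(1) p by (intro mult_left_mono cumulative_mono) auto
    then show ?thesis using that(2,3) unfolding slot_def atLeastLessThan_iff by linarith
  qed
  then show ?thesis using assms by (metis nat_neq_iff)
qed

lemma measure_slot: "k < M \<Longrightarrow> measure unit_uniform (slot k x) = p * g k x"
proof -
  assume k: "k < M"
  have "p * cumulative (Suc k) x \<le> 1"
    using p cumulative_bounds[of "Suc k" x] k by (intro mult_le_one) auto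
  then have "measure unit_uniform (slot k x) = p * cumulative (Suc k) x - p * cumulative k x"
    unfolding slot_def using p cumulative_bounds[of k x] cumulative_mono[of k "Suc k" x]
    by (intro measure_unit_uniform_atLeastLessThan) auto
  then show ?thesis by (simp add: cumulative_def algebra_simps)
qed

text \<open>
  To find the symbol at position \<open>i\<close>, go back to the most recent marker and read off its word. The
  symbol is 0 if there is no marker among the last \<open>N\<close> positions; so it depends on finitely many values
  of the noise only.
\<close>

definition coded :: "binseq \<times> (int \<Rightarrow> real) \<Rightarrow> binseq" where
  "coded q i \<longleftrightarrow> (\<exists>j<N. (\<forall>j'<j. snd q (i - int j') \<notin> {0..<p}) \<and>
     (\<exists>k<M. snd q (i - int j) \<in> slot k (bishift (i - int j) (fst q)) \<and> int j \<in> e k))"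

definition code :: "binseq \<times> (int \<Rightarrow> real) \<Rightarrow> binseq \<times> binseq" where
  "code q = (fst q, coded q)"

lemma code_skew: "code (skew 1 q) = map_prod left_shift left_shift (code q)"
proof -
  have *: "i + 1 - int j = i - int j + 1" for i j by simp
  have "coded (skew 1 q) = left_shift (coded q)"
  proof
    fix i
    have "bishift n (left_shift x) = bishift (n + 1) x" for n x
      by (auto simp: bishift_def left_shift_def fun_eq_iff algebra_simps)
    then show "coded (skew 1 q) i = left_shift (coded q) i"
      unfolding left_shift_def[of "coded q"] coded_def * by (simp add: skew_def translate_def split_beta)
  qed
  then show ?thesis by (simp add: code_def skew_def split_beta)
qed

lemma noise_measurable[measurable]: "(\<lambda>q. snd q n) \<in> borel_measurable \<Theta>"
proof -
  have "(\<lambda>q. snd q n) \<in> \<Theta> \<rightarrow>\<^sub>M unit_uniform" unfolding \<Theta>_def by measurable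
  then show ?thesis using measurable_cong_sets[OF refl sets_unit_uniform] by blast
qed

lemma pred_slot[measurable]: "Measurable.pred \<Theta> (\<lambda>q. snd q n \<in> slot k (bishift n' (fst q)))"
proof -
  have "fst \<in> \<Theta> \<rightarrow>\<^sub>M \<nu>" unfolding \<Theta>_def by measurable
  then have [measurable]: "(\<lambda>q. cumulative k (bishift n' (fst q))) \<in> borel_measurable \<Theta>" for k
    by measurable
  show ?thesis unfolding slot_def atLeastLessThan_iff by measurable
qed

lemma pred_unmarked[measurable]: "Measurable.pred \<Theta> (\<lambda>q. snd q n \<notin> {0..<p})"
  unfolding atLeastLessThan_iff by measurable

lemma code_measurable: "code \<in> \<Theta> \<rightarrow>\<^sub>M restrict_space borel (X \<times> UNIV)"
proof (rule measurable_restrict_space2)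
  show "code \<in> space \<Theta> \<rightarrow> X \<times> UNIV" by (auto simp: code_def space_\<Theta> space_\<nu>)
  have "fst \<in> \<Theta> \<rightarrow>\<^sub>M borel" unfolding \<Theta>_def by (rule measurable_compose[OF measurable_fst ident_\<nu>_borel])
  moreover have "coded \<in> \<Theta> \<rightarrow>\<^sub>M borel"
    by (rule borel_measurable_binseqI) (unfold coded_def, measurable)
  ultimately show "code \<in> \<Theta> \<rightarrow>\<^sub>M borel"
    unfolding code_def borel_prod[symmetric] by (rule measurable_Pair)
qed

text \<open>
  Sequences distributed by \<open>\<nu>\<close> together with their random block codes.
\<close>

definition joining :: "(binseq \<times> binseq) measure" where
  "joining = distr \<Theta> (restrict_space borel (X \<times> UNIV)) code"

lemma XU_borel: "X \<times> (UNIV :: binseq set) \<in> sets borel"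
  using X by (intro borel_closed closed_Times) auto

lemma map_shift_measurable: "map_prod left_shift left_shift \<in> borel \<rightarrow>\<^sub>M borel"
  unfolding map_prod_def split_beta
  by (intro borel_measurable_continuous_onI continuous_intros continuous_on_compose2[OF shift_continuous, of UNIV]) auto

lemma map_shift_XU: "map_prod left_shift left_shift ` (X \<times> UNIV) \<subseteq> X \<times> UNIV"
  using shift_X by auto

lemma measure_joining:
  assumes "A \<in> sets (restrict_space borel (X \<times> UNIV))"
  shows "measure joining A = measure \<Theta> (code -` A \<inter> space \<Theta>)"
  unfolding joining_def by (rule measure_distr[OF code_measurable assms])

text \<open>
  A factor of the ergodic product with the noise.
\<close>

lemma joining_ergodic: "joining \<in> ergodic_measures (map_prod left_shift left_shift) (X \<times> UNIV)"
proof -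
  let ?S = "map_prod left_shift left_shift"
  have sets_j: "sets joining = sets (restrict_space borel (X \<times> UNIV))" by (simp add: joining_def)
  have SA: "?S -` A \<inter> (X \<times> UNIV) \<in> sets joining" if "A \<in> sets joining" for A
    using measurable_sets[OF measurable_selfmap[OF sets_j map_shift_measurable map_shift_XU] that]
      sets_eq_imp_space_eq[OF sets_j] XU_borel by simp
  have code_X: "fst (code q) \<in> X" if "q \<in> space \<Theta>" for q using that by (auto simp: code_def space_\<Theta> space_\<nu>)
  have pre: "code -` (?S -` A \<inter> (X \<times> UNIV)) \<inter> space \<Theta> = skew 1 -` (code -` A \<inter> space \<Theta>) \<inter> space \<Theta>" for A
  proof (rule set_eqI)
    fix q
    have "map_prod left_shift left_shift (code q) \<in> A \<longleftrightarrow> code (skew 1 q) \<in> A" by (simp only: code_skew)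
    moreover have "code q \<in> X \<times> UNIV \<and> skew 1 q \<in> space \<Theta>" if "q \<in> space \<Theta>"
      using code_X[OF that] measurable_space[OF skew_measurable that] by (simp add: mem_Times_iff)
    ultimately show "q \<in> code -` (?S -` A \<inter> (X \<times> UNIV)) \<inter> space \<Theta> \<longleftrightarrow>
        q \<in> skew 1 -` (code -` A \<inter> space \<Theta>) \<inter> space \<Theta>"
      by (simp only: vimage_eq Int_iff) (cases "q \<in> space \<Theta>", simp_all del: One_nat_def)
  qed
  have cA: "code -` A \<inter> space \<Theta> \<in> sets \<Theta>" if "A \<in> sets joining" for A
    using measurable_sets[OF code_measurable] that sets_j by simp
  have "joining \<in> invariant_measures ?S (X \<times> UNIV)"
  proof (rule invariant_measuresI[OF _ sets_j XU_borel map_shift_measurable map_shift_XU])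
    show "prob_space joining" unfolding joining_def by (rule \<Theta>.prob_space_distr[OF code_measurable])
    fix A assume A: "A \<in> sets joining"
    have "measure joining (?S -` A \<inter> (X \<times> UNIV)) = measure \<Theta> (skew 1 -` (code -` A \<inter> space \<Theta>) \<inter> space \<Theta>)"
      by (simp only: measure_joining[OF SA[OF A, unfolded sets_j]] pre)
    also have "\<dots> = measure (distr \<Theta> \<Theta> (skew 1)) (code -` A \<inter> space \<Theta>)"
      by (rule measure_distr[OF skew_measurable cA[OF A], symmetric])
    also have "\<dots> = measure joining A" using A sets_j by (simp add: distr_skew measure_joining)
    finally show "measure joining (?S -` A \<inter> (X \<times> UNIV)) = measure joining A" .
  qed
  moreover have "measure joining A = 0 \<or> measure joining A = 1"
    if A: "A \<in> sets joining" "?S -` A \<inter> (X \<times> UNIV) = A" for A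
    using skew_ergodic[OF cA[OF A(1)]] pre[of A] A sets_j by (simp add: measure_joining)
  ultimately show ?thesis by (auto simp: ergodic_measures_def)
qed

lemma joining_marginal: "distr joining (restrict_space borel X) fst = \<nu>"
proof (rule measure_eqI)
  show "sets (distr joining (restrict_space borel X) fst) = sets \<nu>" by (simp add: \<nu>D)
  have f: "fst \<in> restrict_space borel (X \<times> UNIV) \<rightarrow>\<^sub>M restrict_space borel X"
    by (rule measurable_restrict_space3) (auto intro!: borel_measurable_continuous_onI continuous_on_fst)
  fix B assume "B \<in> sets (distr joining (restrict_space borel X) fst)"
  then have B: "B \<in> sets (restrict_space borel X)" and B': "B \<in> sets \<nu>" by (simp_all add: \<nu>D)
  have "emeasure (distr joining (restrict_space borel X) fst) B =
      emeasure (distr \<Theta> (restrict_space borel X) (fst \<circ> code)) B"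
    unfolding joining_def by (subst distr_distr[OF f code_measurable]) simp
  also have "\<dots> = emeasure \<Theta> ((fst \<circ> code) -` B \<inter> space \<Theta>)"
    by (rule emeasure_distr[OF measurable_comp[OF code_measurable f] B])
  also have "(fst \<circ> code) -` B \<inter> space \<Theta> = B \<times> space \<Omega>"
    using sets.sets_into_space[OF B'] by (auto simp: code_def space_\<Theta>)
  also have "emeasure \<Theta> (B \<times> space \<Omega>) = emeasure \<nu> B"
    unfolding \<Theta>_def using B' by (subst \<Omega>.emeasure_pair_measure_Times) (auto simp: \<Omega>.emeasure_space_1)
  finally show "emeasure (distr joining (restrict_space borel X) fst) B = emeasure \<nu> B" .
qed

end

section \<open>Ergodic approximation of joinings\<close>

lemma funpow_map_prod:
  fixes f :: "'a \<Rightarrow> 'a" and g :: "'b \<Rightarrow> 'b"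
  shows "(map_prod f g ^^ n) (x, y) = ((f ^^ n) x, (g ^^ n) y)"
  by (induction n) auto

lemma measure_noise_pattern:
  fixes J :: "int set"
  assumes "product_prob_space (\<lambda>_::int. H)" "finite J" "\<And>i. i \<in> J \<Longrightarrow> A i \<in> sets H"
  shows "measure (PiM UNIV (\<lambda>_. H)) {\<omega>\<in>space (PiM UNIV (\<lambda>_. H)). \<forall>i\<in>J. \<omega> i \<in> A i} = (\<Prod>i\<in>J. measure H (A i))"
proof -
  interpret product_prob_space "\<lambda>_::int. H" UNIV by fact
  have "emeasure (PiM UNIV (\<lambda>_. H)) {\<omega>\<in>space (PiM UNIV (\<lambda>_. H)). \<forall>i\<in>J. \<omega> i \<in> A i} = (\<Prod>i\<in>J. emeasure H (A i))"
    using assms by (intro emeasure_PiM_Collect) auto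
  also have "\<dots> = ennreal (\<Prod>i\<in>J. measure H (A i))"
    by (simp only: M.emeasure_eq_measure) (rule prod_ennreal, simp)
  finally show ?thesis
    by (rule measure_eq_emeasure_eq_ennreal[rotated]) (simp add: prod_nonneg)
qed

lemma measure_unit_uniform_Compl:
  assumes "0 \<le> p" "p \<le> 1"
  shows "measure unit_uniform (- {0..<p}) = 1 - p"
proof -
  interpret prob_space unit_uniform by (rule prob_space_unit_uniform)
  show ?thesis
    using prob_compl[of "{0..<p}"] measure_unit_uniform_atLeastLessThan[of 0 p] assms
    by (simp add: Compl_eq_Diff_UNIV)
qed

context block_coding
begin

text \<open>
  If \<open>n0\<close> is the last marker up to position \<open>L\<close>, then its word is spelled out from \<open>n0\<close> to \<open>L\<close>, as far as it
  reaches.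
\<close>

lemma coded_eq_word:
  assumes unmarked: "\<And>n. n \<in> {n0 + 1..int L} \<Longrightarrow> snd q n \<notin> {0..<p}"
    and k: "k < M" "snd q n0 \<in> slot k (bishift n0 (fst q))"
    and i: "n0 \<le> i" "i \<le> int L" "i - n0 < int N"
  shows "coded q i \<longleftrightarrow> i - n0 \<in> e k"
proof
  have marked: "snd q n0 \<in> {0..<p}" using k slot_subset by blast
  assume "coded q i"
  then obtain j k' where j: "\<And>j'. j' < j \<Longrightarrow> snd q (i - int j') \<notin> {0..<p}" "k' < M"
    "snd q (i - int j) \<in> slot k' (bishift (i - int j) (fst q))" "int j \<in> e k'"
    unfolding coded_def by blast
  have "\<not> n0 < i - int j"
  proof
    assume "n0 < i - int j"
    then have "snd q (i - int j) \<notin> {0..<p}" using i by (intro unmarked) auto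
    then show False using j(2,3) slot_subset by blast
  qed
  moreover have "\<not> i - int j < n0"
  proof
    assume "i - int j < n0"
    then have "nat (i - n0) < j" using i by linarith
    from j(1)[OF this] show False using i marked by simp
  qed
  ultimately have eq: "i - int j = n0" by linarith
  have "k' = k" using slots_disjoint[of _ k' _ k] j(3) k(2) unfolding eq by blast
  then show "i - n0 \<in> e k" using j(4) eq by (metis add_diff_cancel_left' diff_add_cancel diff_diff_eq2)
next
  assume e: "i - n0 \<in> e k"
  show "coded q i"
    unfolding coded_def
  proof (rule exI[of _ "nat (i - n0)"], intro conjI allI impI)
    show "\<exists>k<M. snd q (i - int (nat (i - n0))) \<in> slot k (bishift (i - int (nat (i - n0))) (fst q)) \<and>
        int (nat (i - n0)) \<in> e k"
      using i k e by (intro exI[of _ k]) auto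
    fix j' assume "j' < nat (i - n0)"
    then show "snd q (i - int j') \<notin> {0..<p}" using i by (intro unmarked) auto
  qed (use i in auto)
qed

text \<open>
  The event that the last marker up to position \<open>L\<close> is at \<open>-L - j\<close> and carries the \<open>k\<close>-th word. For
  \<open>j \<ge> 0\<close> and long words this word covers the whole window.
\<close>

definition last_marker :: "nat \<Rightarrow> nat \<Rightarrow> nat \<Rightarrow> binseq set \<Rightarrow> (binseq \<times> (int \<Rightarrow> real)) set" where
  "last_marker L j k B = {q \<in> space \<Theta>. fst q \<in> B \<and>
     snd q (- int (L + j)) \<in> slot k (bishift (- int (L + j)) (fst q)) \<and>
     (\<forall>n\<in>{- int (L + j) + 1..int L}. snd q n \<notin> {0..<p})}"

lemma last_marker_sets[measurable]: "B \<in> sets \<nu> \<Longrightarrow> last_marker L j k B \<in> sets \<Theta>"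
proof -
  assume [measurable]: "B \<in> sets \<nu>"
  have "fst \<in> \<Theta> \<rightarrow>\<^sub>M \<nu>" unfolding \<Theta>_def by measurable
  then have [measurable]: "Measurable.pred \<Theta> (\<lambda>q. fst q \<in> B)" by measurable
  show ?thesis unfolding last_marker_def by measurable
qed

text \<open>
  Given \<open>x\<close>, one position carries the marker and \<open>2 * L + j\<close> positions carry none. Invariance of \<open>\<nu>\<close> moves
  the position of the marker to the origin.
\<close>

lemma measure_last_marker:
  assumes B: "B \<in> sets \<nu>" and k: "k < M"
  shows "measure \<Theta> (last_marker L j k B) = p * (1 - p) ^ (2 * L + j) *
    (\<integral>x. indicator ((left_shift ^^ (L + j)) -` B \<inter> X) x * g k x \<partial>\<nu>)"
proof -
  let ?n = "- int (L + j)"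
  note P = base.prob_space_axioms \<Omega>.prob_space_axioms
  have "measure \<Omega> (Pair x -` last_marker L j k B) =
      p * (1 - p) ^ (2 * L + j) * (indicator B x * g k (bishift ?n x))" if x: "x \<in> space \<nu>" for x
  proof (cases "x \<in> B")
    case True
    let ?A = "\<lambda>n. if n = ?n then slot k (bishift ?n x) else - {0..<p}"
    have fin: "finite {?n..int L}" by simp
    have A: "?A n \<in> sets unit_uniform" for n by (simp add: slot_def)
    have I: "{?n..int L} = insert ?n {?n + 1..int L}" by auto
    have "Pair x -` last_marker L j k B =
        {\<omega>\<in>space (PiM UNIV (\<lambda>_. unit_uniform)). \<forall>n\<in>{?n..int L}. \<omega> n \<in> ?A n}"
      unfolding I using True x by (auto simp: last_marker_def space_\<Theta> \<Omega>_def)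
    then have "measure \<Omega> (Pair x -` last_marker L j k B) = (\<Prod>n\<in>{?n..int L}. measure unit_uniform (?A n))"
      using measure_noise_pattern[OF \<Omega>.product_prob_space_axioms fin A] by (simp only: \<Omega>_def)
    also have "\<dots> = measure unit_uniform (slot k (bishift ?n x)) *
        (\<Prod>n\<in>{?n + 1..int L}. measure unit_uniform (?A n))"
      unfolding I by (subst prod.insert) auto
    also have "(\<Prod>n\<in>{?n + 1..int L}. measure unit_uniform (?A n)) = (\<Prod>n\<in>{?n + 1..int L}. 1 - p)"
      using p by (intro prod.cong) (auto simp: measure_unit_uniform_Compl)
    also have "\<dots> = (1 - p) ^ (2 * L + j)"
    proof -
      have "card {?n + 1..int L} = 2 * L + j" by simp
      then show ?thesis by simp
    qed
    finally show ?thesis using True by (simp add: measure_slot[OF k])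
  next
    case False
    then have "Pair x -` last_marker L j k B = {}" by (auto simp: last_marker_def)
    then show ?thesis using False by simp
  qed
  then have "measure \<Theta> (last_marker L j k B) =
      (\<integral>x. p * (1 - p) ^ (2 * L + j) * (indicator B x * g k (bishift ?n x)) \<partial>\<nu>)"
    using measure_pair_measure_integral(2)[OF P, of "last_marker L j k B"] last_marker_sets[OF B]
    unfolding \<Theta>_def by (simp cong: Bochner_Integration.integral_cong)
  also have "\<dots> = p * (1 - p) ^ (2 * L + j) * (\<integral>x. indicator B x * g k (bishift ?n x) \<partial>\<nu>)"
    by (rule integral_mult_right_zero)
  also have "(\<integral>x. indicator B x * g k (bishift ?n x) \<partial>\<nu>) =
      (\<integral>x. indicator B x * g k (bishift ?n x) \<partial>distr \<nu> \<nu> (left_shift ^^ (L + j)))"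
    by (simp only: distr_funpow_T)
  also have "\<dots> = (\<integral>x. indicator B ((left_shift ^^ (L + j)) x) * g k (bishift ?n ((left_shift ^^ (L + j)) x)) \<partial>\<nu>)"
    using B by (intro integral_distr funpow_T_measurable borel_measurable_times borel_measurable_indicator
        measurable_compose[OF bishift_\<nu> g_measurable])
  also have "\<dots> = (\<integral>x. indicator ((left_shift ^^ (L + j)) -` B \<inter> X) x * g k x \<partial>\<nu>)"
  proof (intro Bochner_Integration.integral_cong refl)
    fix x assume "x \<in> space \<nu>"
    moreover have "bishift ?n ((left_shift ^^ (L + j)) x) = x"
      by (auto simp: bishift_def funpow_left_shift)
    ultimately show "indicator B ((left_shift ^^ (L + j)) x) * g k (bishift ?n ((left_shift ^^ (L + j)) x)) =
        indicator ((left_shift ^^ (L + j)) -` B \<inter> X) x * g k x"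
      by (simp add: indicator_def space_\<nu>)
  qed
  finally show ?thesis .
qed

lemma last_marker_disjoint:
  assumes "q \<in> last_marker L j k B" "q \<in> last_marker L j' k' B'" "k < M" "k' < M"
  shows "j = j' \<and> k = k'"
proof -
  have "False" if "j < j'" "q \<in> last_marker L j k B" "q \<in> last_marker L j' k' B'" "k < M" for j j' k k' B B'
  proof -
    have "snd q (- int (L + j)) \<in> slot k (bishift (- int (L + j)) (fst q))"
      using that(2) unfolding last_marker_def by blast
    then have "snd q (- int (L + j)) \<in> {0..<p}" using slot_subset[OF that(4)] by blast
    moreover have "- int (L + j) \<in> {- int (L + j') + 1..int L}" using that(1) by auto
    ultimately show False using that(3) unfolding last_marker_def by blast
  qed
  then have "j = j'" using assms by (metis nat_neq_iff)
  moreover then have "k = k'" using assms slots_disjoint by (auto simp: last_marker_def)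
  ultimately show ?thesis by simp
qed

text \<open>
  For fixed \<open>j\<close>, summing over the words that show \<open>a\<close> in the window reassembles \<open>\<rho>\<close> of a translate of the
  given set, which has the same measure by invariance. The sum over \<open>j < K\<close> is a geometric series; its
  value is the probability that the window contains no marker after its first position while there is
  one among the \<open>K\<close> positions up to there.
\<close>

lemma joining_lower_bound:
  assumes \<rho>: "\<rho> \<in> invariant_measures (map_prod left_shift left_shift) (X \<times> UNIV)"
    and e: "bij_betw e {..<M} (Pow {0..<int N})"
    and dens: "\<And>k B. k < M \<Longrightarrow> B \<in> sets \<nu> \<Longrightarrow>
      (\<integral>x. indicator B x * g k x \<partial>\<nu>) = measure \<rho> (B \<times> cylinder {0..<int N} (e k))"
    and N: "2 * L + K \<le> N" and a: "a \<subseteq> window L" and B: "B \<in> sets \<nu>"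
  shows "(1 - p) ^ (2 * L) * (1 - (1 - p) ^ K) * measure \<rho> (B \<times> cylinder (window L) a) \<le>
    measure joining (B \<times> cylinder (window L) a)"
proof -
  let ?C = "B \<times> cylinder (window L) a"
  note R = invariant_measuresD[OF \<rho> XU_borel]
  interpret R: prob_space \<rho> by (rule R)
  have prod_sets: "A \<times> cylinder W b \<in> sets (restrict_space borel (X \<times> UNIV))" if "A \<in> sets \<nu>" "finite W" for A W b
  proof -
    have "A \<times> cylinder W b \<in> sets borel"
      using that clopen_cylinder[of W b] by (intro borel_Times) (auto simp: sets_\<nu>)
    then show ?thesis using that XU_borel by (auto simp: sets_restrict_space_iff sets_\<nu>)
  qed
  define I where "I j = {k \<in> {..<M}. {i \<in> window L. i + int (L + j) \<in> e k} = a}" for j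
  define B' where "B' j = (left_shift ^^ (L + j)) -` B \<inter> X" for j
  have B's: "B' j \<in> sets \<nu>" for j
    using measurable_sets[OF funpow_T_measurable B] by (simp add: B'_def space_\<nu>)
  have word: "(\<Sum>k\<in>I j. measure \<rho> (B' j \<times> cylinder {0..<int N} (e k))) = measure \<rho> ?C" if j: "j < K" for j
  proof -
    have eP: "e k \<in> Pow {0..<int N}" if "k < M" for k using e that by (auto simp: bij_betw_def)
    have inj: "k = k'" if "k < M" "k' < M" "e k = e k'" for k k'
      using e that by (auto simp: bij_betw_def inj_on_def)
    have "(\<Sum>k\<in>I j. measure \<rho> (B' j \<times> cylinder {0..<int N} (e k))) =
        measure \<rho> (\<Union>k\<in>I j. B' j \<times> cylinder {0..<int N} (e k))"
    proof (intro R.finite_measure_finite_Union[symmetric])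
      show "(\<lambda>k. B' j \<times> cylinder {0..<int N} (e k)) ` I j \<subseteq> R.events"
        using prod_sets[OF B's] R(2) by auto
      show "disjoint_family_on (\<lambda>k. B' j \<times> cylinder {0..<int N} (e k)) (I j)"
        unfolding disjoint_family_on_def
      proof (intro ballI impI)
        fix k k' assume k: "k \<in> I j" "k' \<in> I j" "k \<noteq> k'"
        then have "k < M" "k' < M" by (auto simp: I_def)
        then have "e k \<noteq> e k'" "e k \<subseteq> {0..<int N}" "e k' \<subseteq> {0..<int N}" using inj k(3) eP by blast+
        then have "cylinder {0..<int N} (e k) \<inter> cylinder {0..<int N} (e k') = {}"
          by (auto simp: mem_cylinder_iff)
        then show "B' j \<times> cylinder {0..<int N} (e k) \<inter> B' j \<times> cylinder {0..<int N} (e k') = {}" by blast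
      qed
    qed (simp add: I_def)
    also have "(\<Union>k\<in>I j. B' j \<times> cylinder {0..<int N} (e k)) =
        (map_prod left_shift left_shift ^^ (L + j)) -` ?C \<inter> (X \<times> UNIV)"
    proof (intro set_eqI)
      fix q :: "binseq \<times> binseq"
      obtain x y where q: "q = (x, y)" by (cases q)
      let ?w = "Collect y \<inter> {0..<int N}"
      have w: "y \<in> cylinder {0..<int N} (e k) \<longleftrightarrow> e k = ?w" if "k < M" for k
        using eP[OF that] by (subst mem_cylinder_iff) auto
      have "?w \<in> e ` {..<M}" using e by (simp add: bij_betw_def)
      then obtain k0 where k0: "k0 < M" "e k0 = ?w" by auto
      have "(\<exists>k\<in>I j. y \<in> cylinder {0..<int N} (e k)) \<longleftrightarrow> k0 \<in> I j"
        using w inj k0 unfolding I_def by (metis (no_types, lifting) lessThan_iff mem_Collect_eq)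
      also have "\<dots> \<longleftrightarrow> {i \<in> window L. i + int (L + j) \<in> ?w} = a"
        using k0 by (simp add: I_def)
      also have "{i \<in> window L. i + int (L + j) \<in> ?w} = Collect ((left_shift ^^ (L + j)) y) \<inter> window L"
        using N j by (auto simp: funpow_left_shift)
      also have "\<dots> = a \<longleftrightarrow> (left_shift ^^ (L + j)) y \<in> cylinder (window L) a"
        using a by (subst mem_cylinder_iff) auto
      finally show "q \<in> (\<Union>k\<in>I j. B' j \<times> cylinder {0..<int N} (e k)) \<longleftrightarrow>
          q \<in> (map_prod left_shift left_shift ^^ (L + j)) -` ?C \<inter> (X \<times> UNIV)"
        by (auto simp: q funpow_map_prod B'_def)
    qed
    also have "measure \<rho> \<dots> = measure \<rho> ?C"
      using invariant_measure_vimage_funpow[OF \<rho> XU_borel map_shift_measurable map_shift_XU]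
        prod_sets[OF B] R(2) by simp
    finally show ?thesis .
  qed
  let ?J = "SIGMA j:{..<K}. I j"
  have "(1 - p) ^ (2 * L) * (1 - (1 - p) ^ K) * measure \<rho> ?C =
      (\<Sum>j<K. p * (1 - p) ^ (2 * L + j) * measure \<rho> ?C)"
  proof -
    have "1 - (1 - p) ^ K = (\<Sum>j<K. p * (1 - p) ^ j)"
      using one_diff_power_eq[of "1 - p" K] by (simp add: sum_distrib_left)
    then show ?thesis
      by (simp only: sum_distrib_left sum_distrib_right power_add mult_ac)
  qed
  also have "\<dots> = (\<Sum>j<K. \<Sum>k\<in>I j. p * (1 - p) ^ (2 * L + j) * measure \<rho> (B' j \<times> cylinder {0..<int N} (e k)))"
    by (intro sum.cong refl) (simp add: sum_distrib_left[symmetric] word)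
  also have "\<dots> = (\<Sum>j<K. \<Sum>k\<in>I j. measure \<Theta> (last_marker L j k B))"
    using B's by (intro sum.cong refl)
      (simp add: measure_last_marker[OF B] dens B'_def[symmetric] I_def)
  also have "\<dots> = (\<Sum>(j, k)\<in>?J. measure \<Theta> (last_marker L j k B))"
    by (rule sum.Sigma) (auto simp: I_def)
  also have "\<dots> = measure \<Theta> (\<Union>(j, k)\<in>?J. last_marker L j k B)"
    unfolding case_prod_unfold
  proof (intro \<Theta>.finite_measure_finite_Union[symmetric])
    show "finite ?J" by (intro finite_SigmaI) (auto simp: I_def)
    show "(\<lambda>z. last_marker L (fst z) (snd z) B) ` ?J \<subseteq> \<Theta>.events" using B by auto
    show "disjoint_family_on (\<lambda>z. last_marker L (fst z) (snd z) B) ?J"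
      unfolding disjoint_family_on_def
    proof (intro ballI impI)
      fix z z' assume "z \<in> ?J" "z' \<in> ?J" "z \<noteq> z'"
      then show "last_marker L (fst z) (snd z) B \<inter> last_marker L (fst z') (snd z') B = {}"
        using last_marker_disjoint by (auto simp: I_def)
    qed
  qed
  also have "\<dots> \<le> measure \<Theta> (code -` ?C \<inter> space \<Theta>)"
  proof (intro \<Theta>.finite_measure_mono measurable_sets[OF code_measurable] prod_sets B)
    show "(\<Union>(j, k)\<in>?J. last_marker L j k B) \<subseteq> code -` ?C \<inter> space \<Theta>"
    proof (rule subsetI)
      fix q assume "q \<in> (\<Union>(j, k)\<in>?J. last_marker L j k B)"
      then obtain j k where j: "j \<in> {..<K}" and k: "k \<in> I j" and q: "q \<in> last_marker L j k B" by auto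
      let ?n = "- int (L + j)"
      have "coded q i \<longleftrightarrow> i \<in> a" if i: "i \<in> window L" for i
      proof -
        have "coded q i \<longleftrightarrow> i - ?n \<in> e k"
        proof (rule coded_eq_word)
          show "n \<in> {?n + 1..int L} \<Longrightarrow> snd q n \<notin> {0..<p}" for n using q by (auto simp: last_marker_def)
          show "snd q ?n \<in> slot k (bishift ?n (fst q))" using q by (simp add: last_marker_def)
        qed (use i j k N in \<open>auto simp: I_def\<close>)
        also have "\<dots> \<longleftrightarrow> i \<in> a"
        proof -
          have "{i \<in> window L. i + int (L + j) \<in> e k} = a" using k by (simp add: I_def)
          moreover have "i - ?n = i + int (L + j)" by simp
          ultimately show ?thesis using i by (simp only:) blast
        qed
        finally show ?thesis .
      qed
      then show "q \<in> code -` ?C \<inter> space \<Theta>"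
        using q by (auto simp: last_marker_def code_def cylinder_def)
    qed
  qed simp
  also have "\<dots> = measure joining ?C"
    by (rule measure_joining[symmetric, OF prod_sets[OF B]]) simp
  finally show ?thesis .
qed

end

text \<open>
  Choose \<open>p\<close> so small that the window is unlikely to contain a marker, then the words so long that a
  marker shortly before the window is likely. A lower bound suffices, since the cells of a window
  partition have total mass 1 for both measures.
\<close>

lemma ergodic_joining_approximation:
  assumes X: "closed X" "left_shift ` X = X" and \<nu>: "\<nu> \<in> ergodic_measures left_shift X"
    and \<rho>: "\<rho> \<in> invariant_measures (map_prod left_shift left_shift) (X \<times> UNIV)"
    and marg: "distr \<rho> (restrict_space borel X) fst = \<nu>" and \<delta>: "0 < \<delta>"
  shows "\<exists>\<rho>'\<in>ergodic_measures (map_prod left_shift left_shift) (X \<times> UNIV).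
    distr \<rho>' (restrict_space borel X) fst = \<nu> \<and>
    (\<forall>a\<subseteq>window L. \<forall>B\<in>sets \<nu>.
      (1 - \<delta>) * measure \<rho> (B \<times> cylinder (window L) a) \<le> measure \<rho>' (B \<times> cylinder (window L) a))"
proof -
  have Xb: "X \<in> sets borel" using X by simp
  have XU: "X \<times> (UNIV :: binseq set) \<in> sets borel" using X by (intro borel_closed closed_Times) auto
  have "\<nu> \<in> invariant_measures left_shift X" using \<nu> by (simp add: ergodic_measures_def)
  note V = invariant_measuresD[OF this Xb]
  note R = invariant_measuresD[OF \<rho> XU]
  interpret R: prob_space \<rho> by (rule R)
  \<comment> \<open>by Bernoulli's inequality, the \<open>2 * L\<close> positions after the first one of the window carry no marker with probability at least \<open>1 - \<delta> / 2\<close>\<close>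
  define p where "p = min (1 / 2) (\<delta> / (4 * L + 4))"
  have p: "0 < p" "p < 1" using \<delta> by (auto simp: p_def)
  have pL: "1 - \<delta> / 2 \<le> (1 - p) ^ (2 * L)"
  proof -
    have "real (2 * L) * p \<le> real (2 * L) * (\<delta> / (4 * L + 4))"
      by (intro mult_left_mono) (auto simp: p_def)
    also have "\<dots> \<le> \<delta> / 2" using \<delta> by (simp add: field_simps)
    finally have "1 - \<delta> / 2 \<le> 1 + real (2 * L) * (- p)" by simp
    also have "\<dots> \<le> (1 + (- p)) ^ (2 * L)" using p by (intro Bernoulli_inequality) auto
    finally show ?thesis by simp
  qed
  \<comment> \<open>\<open>K\<close> positions carry no marker with probability less than \<open>\<delta> / 2\<close>\<close>
  obtain K where K: "(1 - p) ^ K < \<delta> / 2"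
    using real_arch_pow_inv[of "\<delta> / 2" "1 - p"] p \<delta> by auto
  \<comment> \<open>a word that starts at most \<open>K\<close> positions before the window then reaches its end\<close>
  define N where "N = 2 * L + K"
  define M where "M = card (Pow {0..<int N})"
  obtain e where e: "bij_betw e {..<M} (Pow {0..<int N})"
    using ex_bij_betw_nat_finite[of "Pow {0..<int N}"] by (auto simp: M_def atLeast0LessThan)
  have eP: "e k \<subseteq> {0..<int N}" if "k < M" for k using e that by (auto simp: bij_betw_def)
  define D where "D k = X \<times> cylinder {0..<int N} (e k)" for k
  have fst: "fst \<in> \<rho> \<rightarrow>\<^sub>M \<nu>"
  proof -
    have "fst \<in> restrict_space borel (X \<times> UNIV) \<rightarrow>\<^sub>M restrict_space borel X"
      by (rule measurable_restrict_space3) (auto intro!: borel_measurable_continuous_onI continuous_on_fst)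
    then show ?thesis using measurable_cong_sets[OF R(2) V(2)] by blast
  qed
  have marg': "distr \<rho> \<nu> fst = \<nu>"
    using distr_cong[OF refl V(2), of \<rho> fst fst] marg by simp
  obtain g where g: "\<And>k. g k \<in> borel_measurable \<nu>" "\<And>k x. 0 \<le> g k x"
    "\<And>x. (\<Sum>k<M. g k x) = (1::real)"
    "\<And>k B. k < M \<Longrightarrow> B \<in> sets \<nu> \<Longrightarrow> (\<integral>x. indicator B x * g k x \<partial>\<nu>) = measure \<rho> (fst -` B \<inter> D k)"
  proof (rule fibre_densities[OF R(1) V(1) fst marg', of M D])
    fix k
    have "D k \<in> sets borel" unfolding D_def
      using clopen_cylinder[of "{0..<int N}" "e k"] Xb by (intro borel_Times) auto
    then show "D k \<in> sets \<rho>" using R(2) XU by (auto simp: sets_restrict_space_iff D_def)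
  next
    show "disjoint_family_on D {..<M}"
      unfolding disjoint_family_on_def
    proof (intro ballI impI)
      fix k k' assume k: "k \<in> {..<M}" "k' \<in> {..<M}" "k \<noteq> k'"
      then have "e k \<noteq> e k'" using e by (auto simp: bij_betw_def inj_on_def)
      then have "cylinder {0..<int N} (e k) \<inter> cylinder {0..<int N} (e k') = {}"
        using eP k by (auto simp: mem_cylinder_iff)
      then show "D k \<inter> D k' = {}" by (auto simp: D_def)
    qed
    show "(\<Union>k<M. D k) = space \<rho>"
      unfolding R(3)
    proof (intro equalityI subsetI)
      fix q assume "q \<in> X \<times> (UNIV :: binseq set)"
      then obtain x y where q: "q = (x, y)" "x \<in> X" by auto
      have "Collect y \<inter> {0..<int N} \<in> e ` {..<M}" using e by (simp add: bij_betw_def)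
      then obtain k where "k < M" "e k = Collect y \<inter> {0..<int N}" by auto
      then show "q \<in> (\<Union>k<M. D k)" using q by (auto simp: D_def cylinder_def)
    qed (auto simp: D_def)
  qed blast
  interpret block_coding X \<nu> p N M e g
    by unfold_locales (use X \<nu> p g in auto)
  have dens: "(\<integral>x. indicator B x * g k x \<partial>\<nu>) = measure \<rho> (B \<times> cylinder {0..<int N} (e k))"
    if "k < M" "B \<in> sets \<nu>" for k B
  proof -
    have "fst -` B \<inter> D k = B \<times> cylinder {0..<int N} (e k)"
      using that(2) by (auto simp: D_def sets_\<nu>)
    then show ?thesis using g(4)[OF that] by simp
  qed
  have "(1 - \<delta>) * measure \<rho> (B \<times> cylinder (window L) a) \<le> measure joining (B \<times> cylinder (window L) a)"
    if "a \<subseteq> window L" "B \<in> sets \<nu>" for a B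
  proof -
    have "1 - \<delta> \<le> (1 - p) ^ (2 * L) * (1 - (1 - p) ^ K)"
    proof (cases "\<delta> \<le> 2")
      case True
      have "1 - \<delta> \<le> (1 - \<delta> / 2) * (1 - \<delta> / 2)" by (simp add: algebra_simps)
      also have "\<dots> \<le> (1 - p) ^ (2 * L) * (1 - (1 - p) ^ K)"
        using pL K True p by (intro mult_mono) auto
      finally show ?thesis .
    next
      case False
      have "0 \<le> (1 - p) ^ (2 * L) * (1 - (1 - p) ^ K)"
        using p by (intro mult_nonneg_nonneg) (auto simp: power_le_one)
      then show ?thesis using False by linarith
    qed
    then have "(1 - \<delta>) * measure \<rho> (B \<times> cylinder (window L) a) \<le>
        (1 - p) ^ (2 * L) * (1 - (1 - p) ^ K) * measure \<rho> (B \<times> cylinder (window L) a)"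
      by (rule mult_right_mono) simp
    also have "\<dots> \<le> measure joining (B \<times> cylinder (window L) a)"
      by (rule joining_lower_bound[OF \<rho> e dens _ that]) (auto simp: N_def)
    finally show ?thesis .
  qed
  then show ?thesis using joining_ergodic joining_marginal by blast
qed

section \<open>Density of ergodic measures in the weak topology\<close>

lemma invariant_mixture:
  assumes Y: "Y \<in> sets borel" "T \<in> borel \<rightarrow>\<^sub>M borel" "T ` Y \<subseteq> Y"
    and \<mu>: "\<mu>1 \<in> invariant_measures T Y" "\<mu>2 \<in> invariant_measures T Y" and t: "0 \<le> t" "t \<le> 1"
  obtains \<mu> where "\<mu> \<in> invariant_measures T Y"
    "\<And>A. A \<in> sets (restrict_space borel Y) \<Longrightarrow> measure \<mu> A = t * measure \<mu>1 A + (1 - t) * measure \<mu>2 A"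
proof -
  note D1 = invariant_measuresD[OF \<mu>(1) Y(1)] and D2 = invariant_measuresD[OF \<mu>(2) Y(1)]
  interpret P1: prob_space \<mu>1 by (rule D1)
  interpret P2: prob_space \<mu>2 by (rule D2)
  let ?R = "restrict_space borel Y"
  let ?m = "\<lambda>A. ennreal t * emeasure \<mu>1 A + ennreal (1 - t) * emeasure \<mu>2 A"
  define \<mu> where "\<mu> = measure_of (space ?R) (sets ?R) ?m"
  have sets_\<mu>: "sets \<mu> = sets ?R" by (simp add: \<mu>_def sets.space_closed)
  have "emeasure \<mu> A = ?m A" if "A \<in> sets ?R" for A
    unfolding \<mu>_def
  proof (rule emeasure_measure_of_sigma)
    show "sigma_algebra (space ?R) (sets ?R)" by (rule sets.sigma_algebra_axioms)
    show "positive (sets ?R) ?m" by (simp add: positive_def)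
    show "countably_additive (sets ?R) ?m"
    proof (rule countably_additiveI)
      fix A :: "nat \<Rightarrow> _" assume A: "range A \<subseteq> sets ?R" "disjoint_family A"
      have "(\<Sum>i. ?m (A i)) = ennreal t * (\<Sum>i. emeasure \<mu>1 (A i)) + ennreal (1 - t) * (\<Sum>i. emeasure \<mu>2 (A i))"
        by (simp add: suminf_add[symmetric] summableI ennreal_suminf_cmult)
      then show "(\<Sum>i. ?m (A i)) = ?m (\<Union>i. A i)"
        using A D1(2) D2(2) by (simp add: suminf_emeasure)
    qed
  qed (fact that)
  note em = this
  have m: "measure \<mu> A = t * measure \<mu>1 A + (1 - t) * measure \<mu>2 A" if "A \<in> sets ?R" for A
  proof (rule measure_eq_emeasure_eq_ennreal)
    show "0 \<le> t * measure \<mu>1 A + (1 - t) * measure \<mu>2 A" using t by simp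
    have "emeasure \<mu> A = ?m A" by (rule em[OF that])
    also have "?m A = ennreal (t * measure \<mu>1 A) + ennreal ((1 - t) * measure \<mu>2 A)"
      using t unfolding P1.emeasure_eq_measure P2.emeasure_eq_measure
      by (subst (1 2) ennreal_mult) auto
    also have "\<dots> = ennreal (t * measure \<mu>1 A + (1 - t) * measure \<mu>2 A)"
      using t by (intro ennreal_plus[symmetric]) auto
    finally show "emeasure \<mu> A = ennreal (t * measure \<mu>1 A + (1 - t) * measure \<mu>2 A)" .
  qed
  have "emeasure \<mu> (space \<mu>) = 1"
  proof -
    have sp: "space \<mu> = Y" using sets_eq_imp_space_eq[OF sets_\<mu>] Y(1) by (simp add: space_restrict_space)
    have "Y \<in> sets ?R" using Y(1) by (simp add: sets_restrict_space_iff)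
    then have "emeasure \<mu> Y = ?m Y" by (rule em)
    also have "\<dots> = ennreal t + ennreal (1 - t)"
      using P1.emeasure_space_1 P2.emeasure_space_1 by (simp add: D1 D2)
    also have "\<dots> = 1" using t by (simp flip: ennreal_plus)
    finally show ?thesis by (simp add: sp)
  qed
  then have "\<mu> \<in> invariant_measures T Y"
  proof (intro invariant_measuresI[OF _ sets_\<mu> Y] prob_spaceI)
    fix A assume "A \<in> sets \<mu>"
    then have A: "A \<in> sets ?R" by (simp add: sets_\<mu>)
    have "T -` A \<inter> Y \<in> sets ?R"
      using measurable_sets[OF measurable_selfmap[OF D1(2) Y(2,3)], of A] A D1 by simp
    then show "measure \<mu> (T -` A \<inter> Y) = measure \<mu> A"
      using invariant_measure_vimage[OF \<mu>(1) Y, of A] invariant_measure_vimage[OF \<mu>(2) Y, of A] A D1(2) D2(2)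
      by (simp add: m)
  qed
  then show ?thesis using m by (rule that)
qed

lemma sum_measure_cylinders:
  assumes Y: "closed Y" and \<mu>: "prob_space \<mu>" "sets \<mu> = sets (restrict_space borel Y)" "space \<mu> = Y" and W: "finite W"
  shows "(\<Sum>A\<in>Pow W. measure \<mu> (cylinder W A \<inter> Y)) = 1"
proof -
  interpret prob_space \<mu> by fact
  have "(\<Sum>A\<in>Pow W. measure \<mu> (cylinder W A \<inter> Y)) = measure \<mu> (\<Union>A\<in>Pow W. cylinder W A \<inter> Y)"
    using W clopens_sets[OF Y \<mu>(2) clopens_cylinder[OF W]]
    by (intro finite_measure_finite_Union[symmetric] disjoint_cylinders) auto
  also have "(\<Union>A\<in>Pow W. cylinder W A \<inter> Y) = Y"
  proof (intro equalityI subsetI)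
    fix x assume "x \<in> Y"
    moreover have "x \<in> cylinder W (Collect x \<inter> W)" by (simp add: cylinder_def)
    ultimately show "x \<in> (\<Union>A\<in>Pow W. cylinder W A \<inter> Y)"
      by (intro UN_I[of "Collect x \<inter> W"]) auto
  qed blast
  finally show ?thesis using prob_space \<mu>(3) by simp
qed

text \<open>
  If one probability vector almost dominates another, then they are close.
\<close>

lemma l1_le_of_lower_bound:
  fixes u v :: "'a \<Rightarrow> real"
  assumes "\<And>a. a \<in> I \<Longrightarrow> (1 - \<delta>) * v a \<le> u a" "\<And>a. a \<in> I \<Longrightarrow> 0 \<le> v a" "0 \<le> \<delta>"
    and "sum u I = 1" "sum v I = 1"
  shows "(\<Sum>a\<in>I. \<bar>u a - v a\<bar>) \<le> 2 * \<delta>"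
proof -
  have "\<bar>u a - v a\<bar> \<le> (u a - v a) + 2 * \<delta> * v a" if "a \<in> I" for a
  proof -
    have "v a - u a \<le> \<delta> * v a" using assms(1)[OF that] by (simp add: algebra_simps)
    moreover have "0 \<le> \<delta> * v a" using assms(2)[OF that] assms(3) by simp
    ultimately show ?thesis by linarith
  qed
  then have "(\<Sum>a\<in>I. \<bar>u a - v a\<bar>) \<le> (\<Sum>a\<in>I. (u a - v a) + 2 * \<delta> * v a)" by (rule sum_mono)
  also have "\<dots> = 2 * \<delta>"
    using assms(4,5) by (simp add: sum.distrib sum_subtractf sum_distrib_left[symmetric])
  finally show ?thesis .
qed

text \<open>
  The variation distance of two charges as seen in a window.
\<close>

definition charge_dist :: "binseq set \<Rightarrow> nat \<Rightarrow> (binseq set \<Rightarrow> real) \<Rightarrow> (binseq set \<Rightarrow> real) \<Rightarrow> real" where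
  "charge_dist Y L m m' = (\<Sum>A\<in>Pow (window L). \<bar>m (cylinder (window L) A \<inter> Y) - m' (cylinder (window L) A \<inter> Y)\<bar>)"

lemma charge_dist_nonneg: "0 \<le> charge_dist Y L m m'"
  by (simp add: charge_dist_def sum_nonneg)

lemma charge_dist_triangle: "charge_dist Y L m m'' \<le> charge_dist Y L m m' + charge_dist Y L m' m''"
  unfolding charge_dist_def sum.distrib[symmetric] by (intro sum_mono) linarith

lemma charge_dist_sym: "charge_dist Y L m m' = charge_dist Y L m' m"
  by (simp add: charge_dist_def abs_minus_commute)

lemma charge_dist_convex:
  assumes "0 \<le> t" "t \<le> 1"
  shows "charge_dist Y L (\<lambda>A. t * m1 A + (1 - t) * m2 A) (\<lambda>A. t * n1 A + (1 - t) * n2 A) \<le>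
    t * charge_dist Y L m1 n1 + (1 - t) * charge_dist Y L m2 n2"
  unfolding charge_dist_def sum_distrib_left sum.distrib[symmetric]
proof (rule sum_mono)
  fix A
  let ?C = "cylinder (window L) A \<inter> Y"
  have "t * m1 ?C + (1 - t) * m2 ?C - (t * n1 ?C + (1 - t) * n2 ?C) =
      t * (m1 ?C - n1 ?C) + (1 - t) * (m2 ?C - n2 ?C)" by (simp add: algebra_simps)
  also have "\<bar>\<dots>\<bar> \<le> \<bar>t * (m1 ?C - n1 ?C)\<bar> + \<bar>(1 - t) * (m2 ?C - n2 ?C)\<bar>" by (rule abs_triangle_ineq)
  finally show "\<bar>t * m1 ?C + (1 - t) * m2 ?C - (t * n1 ?C + (1 - t) * n2 ?C)\<bar> \<le>
      t * \<bar>m1 ?C - n1 ?C\<bar> + (1 - t) * \<bar>m2 ?C - n2 ?C\<bar>"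
    using assms by (simp add: abs_mult)
qed

text \<open>
  The distance to the ergodic measures is a continuous function of the charge, and it is convex since
  convex combinations of ergodic measures are, by assumption, limits of ergodic measures. Its supremum is approached at
  ergodic measures, where it is 0.
\<close>

lemma ergodic_dense_if_almost_convex:
  assumes Y: "closed Y" "left_shift ` Y = Y"
    and mix: "\<And>e1 e2 t \<epsilon>. e1 \<in> ergodic_measures left_shift Y \<Longrightarrow> e2 \<in> ergodic_measures left_shift Y \<Longrightarrow>
      0 < t \<Longrightarrow> t < 1 \<Longrightarrow> 0 < \<epsilon> \<Longrightarrow> \<exists>e\<in>ergodic_measures left_shift Y.
        charge_dist Y L (\<lambda>A. t * charge_of Y e1 A + (1 - t) * charge_of Y e2 A) (charge_of Y e) \<le> \<epsilon>"
    and m: "m \<in> charges Y" and \<epsilon>: "0 < (\<epsilon>::real)"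
  shows "\<exists>e\<in>ergodic_measures left_shift Y. charge_dist Y L m (charge_of Y e) < \<epsilon>"
proof -
  let ?E = "ergodic_measures left_shift Y"
  have ne: "charges Y \<noteq> {}" using m by blast
  have "\<exists>\<mu>\<in>?E. \<forall>m\<in>charges Y. (0::real) \<le> 0 + 1"
    by (rule ergodic_almost_maximiser[OF Y ne]) auto
  then have E: "?E \<noteq> {}" by blast
  define D where "D m = (INF e\<in>?E. charge_dist Y L m (charge_of Y e))" for m
  have bdd: "bdd_below ((\<lambda>e. charge_dist Y L m (charge_of Y e)) ` ?E)" for m
    by (rule bdd_belowI[of _ 0]) (auto simp: charge_dist_nonneg)
  have D_le: "D m \<le> charge_dist Y L m (charge_of Y e)" if "e \<in> ?E" for m e
    unfolding D_def by (rule cINF_lower[OF bdd that])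
  have D_near: "\<exists>e\<in>?E. charge_dist Y L m (charge_of Y e) < D m + \<epsilon>" if "0 < \<epsilon>" for m \<epsilon>
    using cINF_less_iff[OF E bdd, of m "D m + \<epsilon>"] that by (simp add: D_def)
  have lip: "D m \<le> D m' + charge_dist Y L m m'" for m m'
  proof (rule field_le_epsilon)
    fix \<epsilon> :: real assume "0 < \<epsilon>"
    then obtain e where "e \<in> ?E" "charge_dist Y L m' (charge_of Y e) < D m' + \<epsilon>" using D_near by blast
    then show "D m \<le> D m' + charge_dist Y L m m' + \<epsilon>"
      using D_le[of e m] charge_dist_triangle[of Y L m "charge_of Y e" m'] by linarith
  qed
  have "continuous_on (charges Y) D"
    unfolding continuous_on_def
  proof
    fix m0
    have "continuous_on (charges Y) (\<lambda>m. charge_dist Y L m m0)"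
      unfolding charge_dist_def
      by (intro continuous_on_sum continuous_on_rabs continuous_on_diff continuous_on_eval continuous_on_const)
    moreover assume "m0 \<in> charges Y"
    ultimately have "((\<lambda>m. charge_dist Y L m m0) \<longlongrightarrow> charge_dist Y L m0 m0) (at m0 within charges Y)"
      by (simp add: continuous_on_def)
    then have "((\<lambda>m. charge_dist Y L m m0) \<longlongrightarrow> 0) (at m0 within charges Y)"
      by (simp add: charge_dist_def)
    then have "((\<lambda>m. D m - D m0) \<longlongrightarrow> 0) (at m0 within charges Y)"
    proof (rule Lim_null_comparison[rotated])
      have "\<bar>D m - D m0\<bar> \<le> charge_dist Y L m m0" for m
        using lip[of m m0] lip[of m0 m] charge_dist_sym[of Y L m m0] by linarith
      then show "\<forall>\<^sub>F m in at m0 within charges Y. norm (D m - D m0) \<le> charge_dist Y L m m0" by simp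
    qed
    then show "(D \<longlongrightarrow> D m0) (at m0 within charges Y)" by (simp add: LIM_zero_iff)
  qed
  moreover have "D (\<lambda>A. t * m1 A + (1 - t) * m2 A) \<le> t * D m1 + (1 - t) * D m2" if t: "0 < t" "t < 1" for m1 m2 t
  proof (rule field_le_epsilon)
    fix \<epsilon> :: real assume \<epsilon>: "0 < \<epsilon>"
    obtain e1 where e1: "e1 \<in> ?E" "charge_dist Y L m1 (charge_of Y e1) < D m1 + \<epsilon> / 2" using D_near \<epsilon> by (meson half_gt_zero)
    obtain e2 where e2: "e2 \<in> ?E" "charge_dist Y L m2 (charge_of Y e2) < D m2 + \<epsilon> / 2" using D_near \<epsilon> by (meson half_gt_zero)
    let ?e = "\<lambda>A. t * charge_of Y e1 A + (1 - t) * charge_of Y e2 A"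
    obtain e where e: "e \<in> ?E" "charge_dist Y L ?e (charge_of Y e) \<le> \<epsilon> / 2"
      using mix[OF e1(1) e2(1) t] \<epsilon> by (meson half_gt_zero)
    have "D (\<lambda>A. t * m1 A + (1 - t) * m2 A) \<le>
        charge_dist Y L (\<lambda>A. t * m1 A + (1 - t) * m2 A) ?e + \<epsilon> / 2"
      using D_le[OF e(1)] charge_dist_triangle[of Y L _ "charge_of Y e" ?e] e(2) by (smt (verit))
    also have "\<dots> \<le> t * charge_dist Y L m1 (charge_of Y e1) + (1 - t) * charge_dist Y L m2 (charge_of Y e2) + \<epsilon> / 2"
      using charge_dist_convex[of t Y L m1 m2] t by simp
    also have "\<dots> \<le> t * (D m1 + \<epsilon> / 2) + (1 - t) * (D m2 + \<epsilon> / 2) + \<epsilon> / 2"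
      using e1(2) e2(2) t by (intro add_mono mult_left_mono) auto
    also have "\<dots> = t * D m1 + (1 - t) * D m2 + \<epsilon>" by (simp add: field_simps)
    finally show "D (\<lambda>A. t * m1 A + (1 - t) * m2 A) \<le> t * D m1 + (1 - t) * D m2 + \<epsilon>" .
  qed
  ultimately have "\<exists>\<mu>\<in>?E. \<forall>m\<in>charges Y. D m \<le> D (charge_of Y \<mu>) + \<epsilon> / 2"
    using \<epsilon> by (intro ergodic_almost_maximiser[OF Y ne]) auto
  then obtain \<mu> where "\<mu> \<in> ?E" "D m \<le> D (charge_of Y \<mu>) + \<epsilon> / 2" using m by blast
  moreover then have "D (charge_of Y \<mu>) \<le> 0" using D_le[of \<mu> "charge_of Y \<mu>"] by (simp add: charge_dist_def)
  ultimately have "D m < \<epsilon>" using \<epsilon> by linarith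
  then show ?thesis
    unfolding D_def by (subst (asm) cINF_less_iff[OF E bdd])
qed

text \<open>
  The integral of a function that oscillates by at most \<open>\<kappa>\<close> on the cells of a window differs from the
  integral of a step function by at most \<open>\<kappa>\<close>.
\<close>

lemma integral_cell_approximation:
  assumes Y: "closed Y" and \<mu>: "prob_space \<mu>" "sets \<mu> = sets (restrict_space borel Y)" "space \<mu> = Y"
    and f: "continuous_on Y f" and bound: "\<And>y. y \<in> Y \<Longrightarrow> \<bar>f y\<bar> \<le> (C::real)"
    and s: "\<And>y. y \<in> Y \<Longrightarrow> \<bar>f y - s (Collect y \<inter> window n)\<bar> \<le> \<kappa>"
  shows "\<bar>(\<integral>y. f y \<partial>\<mu>) - (\<Sum>A\<in>Pow (window n). s A * measure \<mu> (cylinder (window n) A \<inter> Y))\<bar> \<le> \<kappa>"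
proof -
  interpret prob_space \<mu> by fact
  let ?W = "window n"
  have cs: "cylinder ?W A \<inter> Y \<in> sets \<mu>" for A
    by (rule clopens_sets[OF Y \<mu>(2) clopens_cylinder]) simp
  have "f \<in> borel_measurable (restrict_space borel Y)"
    by (rule borel_measurable_continuous_on_restrict[OF f])
  then have fm: "f \<in> borel_measurable \<mu>" using measurable_cong_sets[OF \<mu>(2) refl] by blast
  have fi: "integrable \<mu> f"
    by (rule integrable_const_bound[where B = C, OF AE_I2 fm]) (use bound \<mu>(3) in simp)
  let ?g = "\<lambda>y. \<Sum>A\<in>Pow ?W. s A * indicator (cylinder ?W A \<inter> Y) y"
  have gi: "integrable \<mu> ?g"
    using cs by (intro Bochner_Integration.integrable_sum integrable_mult_right integrable_real_indicator)
      (auto simp: emeasure_eq_measure)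
  have g: "?g y = s (Collect y \<inter> ?W)" if "y \<in> Y" for y
  proof -
    have "?g y = (\<Sum>A\<in>Pow ?W. if A = Collect y \<inter> ?W then s A else 0)"
      using that by (intro sum.cong refl) (auto simp: indicator_def mem_cylinder_iff)
    then show ?thesis by simp
  qed
  have "(\<integral>y. ?g y \<partial>\<mu>) = (\<Sum>A\<in>Pow ?W. s A * measure \<mu> (cylinder ?W A \<inter> Y))"
  proof (subst Bochner_Integration.integral_sum)
    show "integrable \<mu> (\<lambda>y. s A * indicator (cylinder ?W A \<inter> Y) y)" for A
      using cs by (intro integrable_mult_right integrable_real_indicator) (auto simp: emeasure_eq_measure)
  qed (use cs \<mu>(3) in \<open>auto simp: Int_absorb2\<close>)
  moreover have "\<bar>(\<integral>y. f y \<partial>\<mu>) - (\<integral>y. ?g y \<partial>\<mu>)\<bar> \<le> \<kappa>"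
  proof -
    have "(\<integral>y. f y \<partial>\<mu>) - (\<integral>y. ?g y \<partial>\<mu>) = (\<integral>y. f y - ?g y \<partial>\<mu>)"
      by (rule Bochner_Integration.integral_diff[OF fi gi, symmetric])
    also have "\<bar>\<dots>\<bar> \<le> (\<integral>y. \<bar>f y - ?g y\<bar> \<partial>\<mu>)" by (rule integral_abs_bound)
    also have "\<dots> \<le> (\<integral>y. \<kappa> \<partial>\<mu>)"
      using s g \<mu>(3) fi gi by (intro integral_mono Bochner_Integration.integrable_abs Bochner_Integration.integrable_diff) auto
    finally show ?thesis using prob_space by simp
  qed
  ultimately show ?thesis by simp
qed

text \<open>
  Measures that agree better and better on larger and larger windows converge weakly, because a
  continuous function is uniformly close to a function of a window.
\<close>

lemma integral_convergence:
  assumes Y: "closed Y" and \<mu>: "prob_space \<mu>" "sets \<mu> = sets (restrict_space borel Y)" "space \<mu> = Y"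
    and e: "\<And>n. prob_space (e n)" "\<And>n. sets (e n) = sets (restrict_space borel Y)" "\<And>n. space (e n) = Y"
    and close: "\<And>n. charge_dist Y n (charge_of Y \<mu>) (charge_of Y (e n)) < 1 / Suc n"
    and f: "continuous_on Y (f :: binseq \<Rightarrow> real)"
  shows "(\<lambda>n. \<integral>y. f y \<partial>e n) \<longlonglongrightarrow> (\<integral>y. f y \<partial>\<mu>)"
proof (rule LIMSEQ_I)
  fix r :: real assume r: "0 < r"
  define \<kappa> where "\<kappa> = r / 4"
  have cY: "compact Y" using compact_Int_closed[OF compact_UNIV_binseq Y] by simp
  have "bounded (f ` Y)" by (rule compact_imp_bounded[OF compact_continuous_image[OF f cY]])
  then obtain C where C: "0 < C" "\<And>y. y \<in> Y \<Longrightarrow> \<bar>f y\<bar> \<le> C" by (auto simp: bounded_pos)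
  let ?\<U> = "(\<lambda>c. Y \<inter> f -` {c - \<kappa> / 2<..<c + \<kappa> / 2}) ` UNIV"
  have op: "openin (top_of_set Y) U" if "U \<in> ?\<U>" for U
    using that continuous_openin_preimage_gen[OF f open_greaterThanLessThan] by blast
  have cov: "Y \<subseteq> \<Union>?\<U>"
  proof
    fix y assume "y \<in> Y"
    then have "y \<in> Y \<inter> f -` {f y - \<kappa> / 2<..<f y + \<kappa> / 2}" using r by (simp add: \<kappa>_def)
    then show "y \<in> \<Union>?\<U>" by blast
  qed
  from cylinder_Lebesgue_number[OF Y op cov]
  obtain L where "\<forall>x\<in>Y. \<exists>U\<in>?\<U>. cylinder (window L) (Collect x) \<inter> Y \<subseteq> U" ..
  then have L: "\<And>x. x \<in> Y \<Longrightarrow> \<exists>U\<in>?\<U>. cylinder (window L) (Collect x) \<inter> Y \<subseteq> U" by (rule bspec)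
  have osc: "\<bar>f y - f z\<bar> \<le> \<kappa>" if yz: "y \<in> Y" "z \<in> Y" "z \<in> cylinder (window L) (Collect y)" for y z
  proof -
    obtain c where c: "cylinder (window L) (Collect y) \<inter> Y \<subseteq> f -` {c - \<kappa> / 2<..<c + \<kappa> / 2}"
      using L[OF yz(1)] by blast
    have "y \<in> cylinder (window L) (Collect y)" by (rule mem_cylinder_self)
    with c yz have "f y \<in> {c - \<kappa> / 2<..<c + \<kappa> / 2}" "f z \<in> {c - \<kappa> / 2<..<c + \<kappa> / 2}" by blast+
    then show ?thesis by (auto simp: abs_le_iff)
  qed
  obtain n0 where n0: "C / (r / 4) < real n0" using reals_Archimedean2 by blast
  show "\<exists>no. \<forall>n\<ge>no. norm ((\<integral>y. f y \<partial>e n) - (\<integral>y. f y \<partial>\<mu>)) < r"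
  proof (intro exI[of _ "max L n0"] allI impI)
    fix n assume n: "max L n0 \<le> n"
    let ?W = "window n"
    define s where "s A = (if cylinder ?W A \<inter> Y = {} then 0 else f (SOME y. y \<in> cylinder ?W A \<inter> Y))" for A
    have some: "(SOME y. y \<in> cylinder ?W A \<inter> Y) \<in> cylinder ?W A \<inter> Y" if "cylinder ?W A \<inter> Y \<noteq> {}" for A
      by (rule some_in_eq[THEN iffD2, OF that])
    have sC: "\<bar>s A\<bar> \<le> C" for A
      using some[of A] C by (auto simp: s_def)
    have s: "\<bar>f y - s (Collect y \<inter> ?W)\<bar> \<le> \<kappa>" if y: "y \<in> Y" for y
    proof -
      have c: "cylinder ?W (Collect y \<inter> ?W) = cylinder ?W (Collect y)" by (rule cylinder_Int[symmetric])
      have ne: "cylinder ?W (Collect y) \<inter> Y \<noteq> {}" using y mem_cylinder_self[of y ?W] by blast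
      let ?z = "SOME z. z \<in> cylinder ?W (Collect y) \<inter> Y"
      have z: "?z \<in> cylinder ?W (Collect y) \<inter> Y" by (rule some_in_eq[THEN iffD2, OF ne])
      have "window L \<subseteq> ?W" using n by (intro window_mono) simp
      then have "cylinder ?W (Collect y) \<subseteq> cylinder (window L) (Collect y)" by (rule cylinder_antimono)
      then have "\<bar>f y - f ?z\<bar> \<le> \<kappa>" using z y by (intro osc) blast+
      then show ?thesis using ne by (simp add: s_def c)
    qed
    let ?S = "\<lambda>\<mu>. \<Sum>A\<in>Pow ?W. s A * measure \<mu> (cylinder ?W A \<inter> Y)"
    have 1: "\<bar>(\<integral>y. f y \<partial>\<mu>) - ?S \<mu>\<bar> \<le> \<kappa>"
      by (rule integral_cell_approximation[OF Y \<mu> f C(2) s])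
    have 2: "\<bar>(\<integral>y. f y \<partial>e n) - ?S (e n)\<bar> \<le> \<kappa>"
      by (rule integral_cell_approximation[OF Y e f C(2) s])
    have "?S \<mu> - ?S (e n) = (\<Sum>A\<in>Pow ?W. s A * (measure \<mu> (cylinder ?W A \<inter> Y) - measure (e n) (cylinder ?W A \<inter> Y)))"
      by (simp add: sum_subtractf algebra_simps)
    also have "\<bar>\<dots>\<bar> \<le> (\<Sum>A\<in>Pow ?W. \<bar>s A * (measure \<mu> (cylinder ?W A \<inter> Y) - measure (e n) (cylinder ?W A \<inter> Y))\<bar>)"
      by (rule sum_abs)
    also have "\<dots> \<le> (\<Sum>A\<in>Pow ?W. C * \<bar>measure \<mu> (cylinder ?W A \<inter> Y) - measure (e n) (cylinder ?W A \<inter> Y)\<bar>)"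
      unfolding abs_mult by (intro sum_mono mult_right_mono sC) simp
    also have "\<dots> = C * charge_dist Y n (charge_of Y \<mu>) (charge_of Y (e n))"
      by (simp add: charge_dist_def charge_of_def clopens_cylinder sum_distrib_left)
    also have "\<dots> \<le> C * (1 / Suc n)"
      using C close[of n] by (intro mult_left_mono) auto
    also have "\<dots> < \<kappa>"
    proof -
      have "C / \<kappa> < real (Suc n)" using n0 n unfolding \<kappa>_def by linarith
      then show ?thesis using r by (simp add: \<kappa>_def field_simps)
    qed
    finally have 3: "\<bar>?S \<mu> - ?S (e n)\<bar> < \<kappa>" .
    have "r = 4 * \<kappa>" "0 < \<kappa>" using r by (simp_all add: \<kappa>_def)
    with 1 2 3 show "norm ((\<integral>y. f y \<partial>e n) - (\<integral>y. f y \<partial>\<mu>)) < r"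
      unfolding real_norm_def by linarith
  qed
qed

lemma weak_closure_eq:
  assumes Y: "closed Y" and K: "\<And>\<mu>. \<mu> \<in> K \<Longrightarrow> prob_space \<mu> \<and> sets \<mu> = sets (restrict_space borel Y)"
    and E: "E \<subseteq> K"
    and dense: "\<And>\<mu> L \<epsilon>. \<mu> \<in> K \<Longrightarrow> 0 < \<epsilon> \<Longrightarrow> \<exists>e\<in>E. charge_dist Y L (charge_of Y \<mu>) (charge_of Y e) < \<epsilon>"
  shows "weak_topology Y K closure_of E = K"
proof -
  let ?F = "{f :: binseq \<Rightarrow> real. continuous_on Y f}"
  let ?\<Phi> = "\<lambda>\<mu>. \<lambda>f\<in>?F. integral\<^sup>L \<mu> f"
  let ?P = "product_topology (\<lambda>_. euclideanreal) ?F"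
  have top: "topspace (weak_topology Y K) = K"
    unfolding weak_topology_def topspace_pullback_topology by auto
  have sp: "space \<mu> = Y" if "\<mu> \<in> K" for \<mu>
  proof -
    have "sets \<mu> = sets (restrict_space borel Y)" using K[OF that] by blast
    from sets_eq_imp_space_eq[OF this] show ?thesis using Y by (simp add: space_restrict_space)
  qed
  have "\<mu> \<in> weak_topology Y K closure_of E" if \<mu>: "\<mu> \<in> K" for \<mu>
    unfolding in_closure_of top
  proof (intro conjI allI impI \<mu>)
    fix T assume "\<mu> \<in> T \<and> openin (weak_topology Y K) T"
    then obtain U where U: "openin ?P U" "T = ?\<Phi> -` U \<inter> K" "?\<Phi> \<mu> \<in> U"
      unfolding weak_topology_def openin_pullback_topology by blast
    have "\<exists>e. \<forall>n. e n \<in> E \<and> charge_dist Y n (charge_of Y \<mu>) (charge_of Y (e n)) < 1 / Suc n"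
      using dense[OF \<mu>] by (intro choice) (metis zero_less_divide_1_iff of_nat_0_less_iff zero_less_Suc)
    then obtain e where e: "\<And>n. e n \<in> E" "\<And>n. charge_dist Y n (charge_of Y \<mu>) (charge_of Y (e n)) < 1 / Suc n"
      by blast
    have eK: "e n \<in> K" for n using e(1) E by blast
    have "(\<lambda>n. integral\<^sup>L (e n) f) \<longlonglongrightarrow> integral\<^sup>L \<mu> f" if "f \<in> ?F" for f
      using that K[OF \<mu>] sp[OF \<mu>] K[OF eK] sp[OF eK] e(2)
      by (intro integral_convergence[OF Y]) auto
    then have "limitin ?P (\<lambda>n. ?\<Phi> (e n)) (?\<Phi> \<mu>) sequentially"
      unfolding limitin_componentwise by auto
    then have "\<forall>\<^sub>F n in sequentially. ?\<Phi> (e n) \<in> U"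
      using U unfolding limitin_def by blast
    then obtain n where "?\<Phi> (e n) \<in> U" by (auto simp: eventually_sequentially)
    then show "\<exists>y. y \<in> E \<and> y \<in> T" using U(2) e(1) eK by blast
  qed
  then show ?thesis using closure_of_subset_topspace[of "weak_topology Y K" E] top by blast
qed

section \<open>Hereditary hulls\<close>

text \<open>
  The preimage under coordinatewise multiplication of a window cylinder is a finite disjoint union of
  products of a set in \<open>X\<close> and a window cylinder, and the bounds for these products add up.
\<close>

lemma coord_mult_joining_approximation:
  fixes X :: "binseq set"
  defines "Y \<equiv> hereditary_hull X" and "T \<equiv> map_prod left_shift left_shift"
  assumes X: "subshift X" and \<nu>: "\<nu> \<in> ergodic_measures left_shift X"
    and \<rho>: "\<rho> \<in> invariant_measures T (X \<times> UNIV)"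
    and marg: "distr \<rho> (restrict_space borel X) fst = \<nu>" and \<delta>: "0 < \<delta>"
  shows "\<exists>\<rho>'\<in>ergodic_measures T (X \<times> UNIV). distr \<rho>' (restrict_space borel X) fst = \<nu> \<and>
    (\<forall>A\<subseteq>window L. (1 - \<delta>) * measure (distr \<rho> (restrict_space borel Y) coord_mult) (cylinder (window L) A \<inter> Y)
      \<le> measure (distr \<rho>' (restrict_space borel Y) coord_mult) (cylinder (window L) A \<inter> Y))"
proof -
  let ?W = "window L"
  have Xc: "closed X" "left_shift ` X = X" using X by (auto simp: subshift_def)
  have Yc: "closed Y" using subshift_hereditary_hull[OF X] by (simp add: subshift_def Y_def)
  have Xb: "X \<in> sets borel" using Xc by simp
  have XU: "X \<times> (UNIV :: binseq set) \<in> sets borel" using Xc by (intro borel_closed closed_Times) auto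
  have "\<nu> \<in> invariant_measures left_shift X" using \<nu> by (simp add: ergodic_measures_def)
  note V = invariant_measuresD[OF this Xb]
  define B where "B A a = {x \<in> X. {i \<in> ?W. x i \<and> i \<in> a} = A}" for A a
  have Bs: "B A a \<in> sets \<nu>" if "A \<subseteq> ?W" for A a
  proof (cases "A \<subseteq> a")
    case True
    then have "B A a = cylinder (?W \<inter> a) A \<inter> X" using that by (auto simp: B_def cylinder_def)
    then show ?thesis using clopens_sets[OF Xc(1) V(2) clopens_cylinder[of "?W \<inter> a" A]] by simp
  next
    case False
    then have "B A a = {}" by (auto simp: B_def)
    then show ?thesis by simp
  qed
  have image: "measure (distr r (restrict_space borel Y) coord_mult) (cylinder ?W A \<inter> Y) =
      (\<Sum>a\<in>Pow ?W. measure r (B A a \<times> cylinder ?W a))"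
    if r: "r \<in> invariant_measures T (X \<times> UNIV)" and A: "A \<subseteq> ?W" for r A
  proof -
    note R = invariant_measuresD[OF r XU]
    interpret R: prob_space r by (rule R)
    have "coord_mult \<in> restrict_space borel (X \<times> UNIV) \<rightarrow>\<^sub>M restrict_space borel Y"
      by (rule measurable_restrict_space3)
         (auto simp: Y_def hereditary_hull_eq_image intro: borel_measurable_continuous_onI continuous_on_coord_mult)
    then have cm: "coord_mult \<in> r \<rightarrow>\<^sub>M restrict_space borel Y" using measurable_cong_sets[OF R(2) refl] by blast
    have "measure (distr r (restrict_space borel Y) coord_mult) (cylinder ?W A \<inter> Y) =
        measure r (coord_mult -` (cylinder ?W A \<inter> Y) \<inter> X \<times> UNIV)"
      using measure_distr[OF cm clopens_sets[OF Yc refl clopens_cylinder]] R(3) by simp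
    also have "coord_mult -` (cylinder ?W A \<inter> Y) \<inter> X \<times> UNIV = (\<Union>a\<in>Pow ?W. B A a \<times> cylinder ?W a)"
    proof (rule set_eqI)
      fix q :: "binseq \<times> binseq"
      obtain x y where q: "q = (x, y)" by (cases q)
      have "q \<in> (\<Union>a\<in>Pow ?W. B A a \<times> cylinder ?W a) \<longleftrightarrow> x \<in> B A (Collect y \<inter> ?W)"
      proof
        assume "q \<in> (\<Union>a\<in>Pow ?W. B A a \<times> cylinder ?W a)"
        then obtain a where "a \<subseteq> ?W" "x \<in> B A a" "y \<in> cylinder ?W a" by (auto simp: q)
        then show "x \<in> B A (Collect y \<inter> ?W)" using mem_cylinder_iff[of a ?W y] by simp
      next
        assume "x \<in> B A (Collect y \<inter> ?W)"
        then show "q \<in> (\<Union>a\<in>Pow ?W. B A a \<times> cylinder ?W a)"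
          by (intro UN_I[of "Collect y \<inter> ?W"]) (auto simp: q cylinder_def)
      qed
      also have "\<dots> \<longleftrightarrow> x \<in> X \<and> A = Collect (coord_mult q) \<inter> ?W"
        by (auto simp: B_def coord_mult_def q)
      also have "\<dots> \<longleftrightarrow> x \<in> X \<and> coord_mult q \<in> cylinder ?W A" by (simp only: mem_cylinder_iff[OF A])
      also have "\<dots> \<longleftrightarrow> q \<in> coord_mult -` (cylinder ?W A \<inter> Y) \<inter> X \<times> UNIV"
        by (auto simp: q Y_def hereditary_hull_eq_image)
      finally show "q \<in> coord_mult -` (cylinder ?W A \<inter> Y) \<inter> X \<times> UNIV \<longleftrightarrow>
          q \<in> (\<Union>a\<in>Pow ?W. B A a \<times> cylinder ?W a)" by simp
    qed
    also have "measure r \<dots> = (\<Sum>a\<in>Pow ?W. measure r (B A a \<times> cylinder ?W a))"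
    proof (rule R.finite_measure_finite_Union)
      have "B A a \<times> cylinder ?W a \<in> sets r" for a
      proof -
        have "B A a \<in> sets borel" "B A a \<subseteq> X"
          using Bs[OF A, of a] V(2) Xb by (auto simp: sets_restrict_space_iff)
        moreover then have "B A a \<times> cylinder ?W a \<in> sets borel"
          using clopen_cylinder[of ?W a] by (intro borel_Times) auto
        ultimately show ?thesis using R(2) XU by (auto simp: sets_restrict_space_iff)
      qed
      then show "(\<lambda>a. B A a \<times> cylinder ?W a) ` Pow ?W \<subseteq> R.events" by blast
      show "disjoint_family_on (\<lambda>a. B A a \<times> cylinder ?W a) (Pow ?W)"
        by (auto simp: disjoint_family_on_def mem_cylinder_iff)
    qed simp
    finally show ?thesis .
  qed
  obtain \<rho>' where \<rho>': "\<rho>' \<in> ergodic_measures T (X \<times> UNIV)" "distr \<rho>' (restrict_space borel X) fst = \<nu>"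
    "\<And>a B. a \<subseteq> ?W \<Longrightarrow> B \<in> sets \<nu> \<Longrightarrow>
      (1 - \<delta>) * measure \<rho> (B \<times> cylinder ?W a) \<le> measure \<rho>' (B \<times> cylinder ?W a)"
    using ergodic_joining_approximation[OF Xc \<nu> \<rho>[unfolded T_def] marg \<delta>, of L] unfolding T_def by blast
  have \<rho>'i: "\<rho>' \<in> invariant_measures T (X \<times> UNIV)" using \<rho>'(1) by (simp add: ergodic_measures_def)
  have "(1 - \<delta>) * measure (distr \<rho> (restrict_space borel Y) coord_mult) (cylinder ?W A \<inter> Y)
      \<le> measure (distr \<rho>' (restrict_space borel Y) coord_mult) (cylinder ?W A \<inter> Y)" if A: "A \<subseteq> ?W" for A
    unfolding image[OF \<rho> A] image[OF \<rho>'i A] sum_distrib_left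
    by (intro sum_mono \<rho>'(3) Bs A) auto
  then show ?thesis using \<rho>'(1,2) by blast
qed

text \<open>
  Two ergodic measures lift to joinings with the same marginal \<open>\<nu>\<close>. So does their convex combination, and
  the ergodic joinings that approximate it project to ergodic measures.
\<close>

lemma ergodic_almost_convex:
  fixes X :: "binseq set"
  defines "Y \<equiv> hereditary_hull X" and "T \<equiv> map_prod left_shift left_shift"
  assumes X: "subshift X" and \<nu>: "\<nu> \<in> ergodic_measures left_shift X"
    and erg: "ergodic_measures left_shift Y =
        {distr \<rho> (restrict_space borel Y) coord_mult | \<rho>.
          \<rho> \<in> ergodic_measures T (X \<times> UNIV) \<and> distr \<rho> (restrict_space borel X) fst = \<nu>}"
    and e: "e1 \<in> ergodic_measures left_shift Y" "e2 \<in> ergodic_measures left_shift Y"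
    and t: "0 < t" "t < 1" and \<epsilon>: "0 < (\<epsilon>::real)"
  shows "\<exists>e\<in>ergodic_measures left_shift Y.
    charge_dist Y L (\<lambda>A. t * charge_of Y e1 A + (1 - t) * charge_of Y e2 A) (charge_of Y e) \<le> \<epsilon>"
proof -
  let ?W = "window L" and ?Z = "X \<times> (UNIV :: binseq set)"
  let ?M = "\<lambda>\<rho>. distr \<rho> (restrict_space borel Y) coord_mult"
  have Xc: "closed X" "left_shift ` X = X" using X by (auto simp: subshift_def)
  have Yc: "closed Y" using subshift_hereditary_hull[OF X] by (simp add: subshift_def Y_def)
  have Yb: "Y \<in> sets borel" using Yc by simp
  have Z: "?Z \<in> sets borel" using Xc by (intro borel_closed closed_Times) auto
  have Tm: "T \<in> borel \<rightarrow>\<^sub>M borel"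
    unfolding T_def map_prod_def split_beta
    by (intro borel_measurable_continuous_onI continuous_intros continuous_on_compose2[OF shift_continuous, of UNIV]) auto
  have TZ: "T ` ?Z \<subseteq> ?Z" using Xc(2) by (auto simp: T_def)
  have "\<nu> \<in> invariant_measures left_shift X" using \<nu> by (simp add: ergodic_measures_def)
  note V = invariant_measuresD[OF this borel_closed[OF Xc(1)]]
  interpret V: prob_space \<nu> by (rule V)
  obtain \<rho>1 \<rho>2 where \<rho>12: "\<rho>1 \<in> ergodic_measures T ?Z" "distr \<rho>1 (restrict_space borel X) fst = \<nu>" "e1 = ?M \<rho>1"
    "\<rho>2 \<in> ergodic_measures T ?Z" "distr \<rho>2 (restrict_space borel X) fst = \<nu>" "e2 = ?M \<rho>2"
    using e unfolding erg by blast
  have i: "\<rho>1 \<in> invariant_measures T ?Z" "\<rho>2 \<in> invariant_measures T ?Z"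
    using \<rho>12 by (simp_all add: ergodic_measures_def)
  obtain \<rho> where \<rho>: "\<rho> \<in> invariant_measures T ?Z"
    "\<And>A. A \<in> sets (restrict_space borel ?Z) \<Longrightarrow> measure \<rho> A = t * measure \<rho>1 A + (1 - t) * measure \<rho>2 A"
    using invariant_mixture[OF Z Tm TZ i] t by (metis less_imp_le)
  note R = invariant_measuresD[OF \<rho>(1) Z] and R1 = invariant_measuresD[OF i(1) Z] and R2 = invariant_measuresD[OF i(2) Z]
  interpret R: prob_space \<rho> by (rule R)
  have fst: "fst \<in> restrict_space borel ?Z \<rightarrow>\<^sub>M restrict_space borel X"
    by (rule measurable_restrict_space3) (auto intro!: borel_measurable_continuous_onI continuous_on_fst)
  have cm: "coord_mult \<in> restrict_space borel ?Z \<rightarrow>\<^sub>M restrict_space borel Y"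
    by (rule measurable_restrict_space3)
       (auto simp: Y_def hereditary_hull_eq_image intro: borel_measurable_continuous_onI continuous_on_coord_mult)
  have mix: "measure (distr \<rho> N f) A = t * measure (distr \<rho>1 N f) A + (1 - t) * measure (distr \<rho>2 N f) A"
    if "f \<in> restrict_space borel ?Z \<rightarrow>\<^sub>M N" "A \<in> sets N" for N :: "binseq measure" and f A
  proof -
    have f: "f \<in> \<rho> \<rightarrow>\<^sub>M N" "f \<in> \<rho>1 \<rightarrow>\<^sub>M N" "f \<in> \<rho>2 \<rightarrow>\<^sub>M N"
      using that(1) measurable_cong_sets[OF R(2) refl] measurable_cong_sets[OF R1(2) refl]
        measurable_cong_sets[OF R2(2) refl] by blast+
    have "f -` A \<inter> ?Z \<in> sets (restrict_space borel ?Z)"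
      using measurable_sets[OF f(1) that(2)] R by simp
    then show ?thesis using that(2) f by (simp add: measure_distr R R1 R2 \<rho>(2))
  qed
  have marg: "distr \<rho> (restrict_space borel X) fst = \<nu>"
  proof (rule measure_eqI)
    show "sets (distr \<rho> (restrict_space borel X) fst) = sets \<nu>" by (simp add: V)
    have "fst \<in> \<rho> \<rightarrow>\<^sub>M restrict_space borel X" using fst measurable_cong_sets[OF R(2) refl] by blast
    then interpret D: prob_space "distr \<rho> (restrict_space borel X) fst" by (rule R.prob_space_distr)
    fix B assume "B \<in> sets (distr \<rho> (restrict_space borel X) fst)"
    then have "measure (distr \<rho> (restrict_space borel X) fst) B = t * measure \<nu> B + (1 - t) * measure \<nu> B"
      using mix[OF fst, of B] \<rho>12 by simp
    then show "emeasure (distr \<rho> (restrict_space borel X) fst) B = emeasure \<nu> B"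
      by (simp add: D.emeasure_eq_measure V.emeasure_eq_measure algebra_simps)
  qed
  obtain \<rho>' where \<rho>': "\<rho>' \<in> ergodic_measures T ?Z" "distr \<rho>' (restrict_space borel X) fst = \<nu>"
    "\<And>A. A \<subseteq> ?W \<Longrightarrow> (1 - \<epsilon> / 2) * measure (?M \<rho>) (cylinder ?W A \<inter> Y) \<le> measure (?M \<rho>') (cylinder ?W A \<inter> Y)"
    using coord_mult_joining_approximation[OF X \<nu> \<rho>(1)[unfolded T_def] marg, of "\<epsilon> / 2" L] \<epsilon>
    unfolding Y_def T_def by auto
  have e': "?M \<rho>' \<in> ergodic_measures left_shift Y" unfolding erg using \<rho>'(1,2) by blast
  have one: "(\<Sum>A\<in>Pow ?W. measure \<mu> (cylinder ?W A \<inter> Y)) = 1" if "\<mu> \<in> ergodic_measures left_shift Y" for \<mu>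
  proof -
    have "\<mu> \<in> invariant_measures left_shift Y" using that by (simp add: ergodic_measures_def)
    from invariant_measuresD[OF this Yb] show ?thesis by (intro sum_measure_cylinders[OF Yc]) auto
  qed
  have cyl: "cylinder ?W A \<inter> Y \<in> sets (restrict_space borel Y)" for A
    by (rule clopens_sets[OF Yc refl clopens_cylinder]) simp
  have mixM: "measure (?M \<rho>) (cylinder ?W A \<inter> Y) =
      t * measure e1 (cylinder ?W A \<inter> Y) + (1 - t) * measure e2 (cylinder ?W A \<inter> Y)" for A
    using mix[OF cm cyl] \<rho>12 by simp
  have "(\<Sum>A\<in>Pow ?W. \<bar>measure (?M \<rho>') (cylinder ?W A \<inter> Y) - measure (?M \<rho>) (cylinder ?W A \<inter> Y)\<bar>) \<le> 2 * (\<epsilon> / 2)"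
  proof (rule l1_le_of_lower_bound)
    show "(\<Sum>A\<in>Pow ?W. measure (?M \<rho>) (cylinder ?W A \<inter> Y)) = 1"
      unfolding mixM sum.distrib sum_distrib_left[symmetric] one[OF e(1)] one[OF e(2)] by simp
  qed (use \<rho>'(3) one[OF e'] \<epsilon> in auto)
  then have "charge_dist Y L (\<lambda>A. t * charge_of Y e1 A + (1 - t) * charge_of Y e2 A) (charge_of Y (?M \<rho>')) \<le> \<epsilon>"
    by (simp add: charge_dist_def charge_of_def clopens_cylinder mixM abs_minus_commute)
  then show ?thesis using e' by blast
qed

lemma point_mass_zero_invariant:
  assumes "Y \<in> sets borel" "left_shift ` Y \<subseteq> Y" "(\<lambda>_. False) \<in> Y"
  shows "return (restrict_space borel Y) (\<lambda>_. False) \<in> invariant_measures left_shift Y"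
proof (rule invariant_measuresI[OF _ _ assms(1) left_shift_measurable assms(2)])
  let ?z = "\<lambda>_::int. False"
  show "prob_space (return (restrict_space borel Y) ?z)"
    by (rule prob_space_return) (simp add: space_restrict_space assms)
  fix A assume "A \<in> sets (return (restrict_space borel Y) ?z)"
  then have A: "A \<in> sets (restrict_space borel Y)" by simp
  have "left_shift -` A \<inter> Y \<in> sets (restrict_space borel Y)"
    using measurable_sets[OF measurable_selfmap[OF refl left_shift_measurable assms(2)] A] assms(1)
    by (simp add: space_restrict_space)
  then show "measure (return (restrict_space borel Y) ?z) (left_shift -` A \<inter> Y) =
      measure (return (restrict_space borel Y) ?z) A"
    using A assms(3) by (simp add: measure_return indicator_def left_shift_def)
qed simp

theorem theorem1:
  fixes X :: "binseq set"
  assumes "subshift X"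
    and "\<exists>\<nu>\<in>ergodic_measures left_shift X.
      ergodic_measures left_shift (hereditary_hull X) =
        {distr \<rho> (restrict_space borel (hereditary_hull X)) coord_mult | \<rho>.
          \<rho> \<in> ergodic_measures (map_prod left_shift left_shift) (X \<times> UNIV) \<and>
          distr \<rho> (restrict_space borel X) fst = \<nu>}"
    and "top_entropy left_shift (hereditary_hull X) > 0"
  shows "Poulsen (hereditary_hull X) (invariant_measures left_shift (hereditary_hull X))"
proof -
  define Y where "Y = hereditary_hull X"
  let ?K = "invariant_measures left_shift Y" and ?E = "ergodic_measures left_shift Y"
  have Y: "closed Y" "left_shift ` Y = Y"
    using subshift_hereditary_hull[OF assms(1)] by (auto simp: subshift_def Y_def)
  have Yb: "Y \<in> sets borel" and SY: "left_shift ` Y \<subseteq> Y" using Y by auto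
  have ext: "?E \<subseteq> extreme_measures ?K"
    by (rule ergodic_measures_subset_extreme[OF Yb left_shift_measurable SY])
  obtain \<nu> where \<nu>: "\<nu> \<in> ergodic_measures left_shift X"
    "?E = {distr \<rho> (restrict_space borel Y) coord_mult | \<rho>.
      \<rho> \<in> ergodic_measures (map_prod left_shift left_shift) (X \<times> UNIV) \<and>
      distr \<rho> (restrict_space borel X) fst = \<nu>}"
    using assms(2) unfolding Y_def by blast
  have dense: "\<exists>e\<in>?E. charge_dist Y L (charge_of Y \<mu>) (charge_of Y e) < \<epsilon>" if "\<mu> \<in> ?K" "0 < \<epsilon>" for \<mu> L \<epsilon>
    using ergodic_almost_convex[OF assms(1) \<nu>(1) \<nu>(2)[unfolded Y_def], folded Y_def]
    by (intro ergodic_dense_if_almost_convex[OF Y] charge_of_charges[OF Y that(1)] that(2))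
  have "weak_topology Y ?K closure_of extreme_measures ?K = ?K"
  proof (rule weak_closure_eq[OF Y(1)])
    show "prob_space \<mu> \<and> sets \<mu> = sets (restrict_space borel Y)" if "\<mu> \<in> ?K" for \<mu>
      using invariant_measuresD[OF that Yb] by blast
    show "extreme_measures ?K \<subseteq> ?K" by (auto simp: extreme_measures_def)
    show "\<exists>e\<in>extreme_measures ?K. charge_dist Y L (charge_of Y \<mu>) (charge_of Y e) < \<epsilon>"
      if "\<mu> \<in> ?K" "0 < \<epsilon>" for \<mu> L \<epsilon>
      using dense[OF that, of L] ext by blast
  qed
  moreover have "\<exists>\<mu>1\<in>?K. \<exists>\<mu>2\<in>?K. \<mu>1 \<noteq> \<mu>2"
  proof (rule ccontr)
    assume single: "\<not> ?thesis"
    let ?z = "\<lambda>_::int. False"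
    obtain x where "x \<in> X" using assms(1) by (auto simp: subshift_def)
    then have zY: "?z \<in> Y" by (auto simp: Y_def hereditary_hull_def intro!: bexI[of _ x])
    have z: "return (restrict_space borel Y) ?z \<in> ?K"
      by (rule point_mass_zero_invariant[OF Yb SY zY])
    have "measure \<mu> ({x. x 0} \<inter> Y) = 0" if "\<mu> \<in> ?E" for \<mu>
    proof -
      have "\<mu> \<in> ?K" using that by (simp add: ergodic_measures_def)
      then have eq: "\<mu> = return (restrict_space borel Y) ?z" using single z by blast
      have "{x. x 0} \<inter> Y \<in> sets (restrict_space borel Y)"
        using clopen_coordinate[of 0 True] by (intro clopens_sets[OF Y(1) refl clopensI]) simp_all
      then show ?thesis unfolding eq by (simp add: measure_return)
    qed
    from entropy_zero_if_rare_ones[OF Y this] show False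
      using assms(3) unfolding Y_def by simp
  qed
  ultimately show ?thesis unfolding Poulsen_def Y_def by blast
qed

end
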